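(* Let $\overline V={\limsup}^{\#}V^\varepsilon$ be the upper weak semilimit of the value functions $V^\varepsilon$ as $\varepsilon\to 0$, regarded as a function of $(x,t)\in\mathbb R^N\times(0,+\infty)$. Then $\overline V$ is a viscosity subsolution of $$u_t+\overline H(x,Du)=0\quad\text{in }\mathbb R^N\times(0,+\infty),$$ and it satisfies $$\limsup_{(x,t)\to(x_0,0),\ t>0}\overline V(x,t)\le \overline u_0(x_0)\qquad\text{for any }x_0\in\mathbb R^N.$$
   Context: Standing assumptions. $N,M$ are positive integers; $A$ is a compact subset of a Euclidean space; $f:\mathbb R^N\times\mathbb R^M\times A\to\mathbb R^N$ and $g:\mathbb R^N\times\mathbb R^M\times A\to\mathbb R^M$ are the controlled vector fields, $\ell:\mathbb R^N\times\mathbb R^M\times A\to\mathbb R$ is the running cost, $u_0:\mathbb R^N\times\mathbb R^M\to\mathbb R$ is the terminal cost. (1) There is $L_0>0$ with $|f(x_1,y_1,a)-f(x_2,y_2,a)|\le L_0(|x_1-x_2|+|y_1-y_2|)$ and $|g(x_1,y_1,a)-g(x_2,y_2,a)|\le L_0(|x_1-x_2|+|y_1-y_2|)$ for all $(x_i,y_i)\in\mathbb R^N\times\mathbb R^M$, $i=1,2$, and $a\in A$; $|f|$ is bounded, with upper bound $Q_0$. (2) For any compact $K\subset\mathbb R^N\times\mathbb R^M$ there is $r=r(K)>0$ such that $B(0,r)\subset\overline{\mathrm{co}}\,g(x,y,A)$ for all $(x,y)\in K$, where $g(x,y,A)=\{g(x,y,a)\mid a\in A\}$ and $\overline{\mathrm{co}}$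 is the closed convex hull. (3) $\ell$ is continuous in $\mathbb R^N\times\mathbb R^M\times A$, and for any compact $B\subset\mathbb R^N$, $\lim_{|y|\to+\infty}\min_{(x,a)\in B\times A}\ell(x,y,a)=+\infty$. (4) $u_0$ is continuous and bounded from below in $\mathbb R^N\times\mathbb R^M$, with $-Q_0$ taken also as lower bound of $u_0$. Controls are measurable functions $\alpha:[0,+\infty)\to A$. For $\varepsilon>0$, the controlled dynamics is $\dot\xi=\varepsilon f(\xi,\eta,\alpha)$, $\dot\eta=g(\xi,\eta,\alpha)$. The value function is $$V^\varepsilon(x,y,t)=\inf_\alpha\Big\{\varepsilon\int_0^{t/\varepsilon}\ell(\xi,\eta,\alpha)\,ds+u_0\big(\xi(t/\varepsilon),\eta(t/\varepsilon)\big)\Big\},$$ where $(\xi,\eta)$ is the trajectory of the dynamics with control $\alpha$ and $(\xi(0),\eta(0))=(x,y)$. Weak semilimit: $({\limsup}^{\#}V^\varepsilon)(x,y,t)=\sup\{\limsup_n V^{\varepsilon_n}(x_n,y_n,t_n)\mid \varepsilon_n\to0,\ (x_n,y_n,t_n)\to(x,y,t)\}$. The $V^\varepsilon$ are locally equibounded, and for $t>0$ this semilimit does not depend on $y$, so it defines a function $\overline V(x,t)$. Hamiltonian: $H(x,y,p,q)=\max_{a\in A}\{-p\cdot f(x,y,a)-q\cdot g(x,y,a)-\ell(x,y,a)\}$. Effective Hamiltonian: $\overline H(x,p)=\inf\{b\in\mathbb R\mid H(x,y,p,Du(y))=b\text{ admits a viscosity subsolution in }\mathbb R^M\}$, where the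 equation is in the variable $y$ only, with $(x,p)$ frozen (this is a finite quantity). Limit initial datum: $\overline u_0(x)=\inf_{y\in\mathbb R^M}u_0(x,y)$. *)

theory Defs
  imports "HOL-Analysis.Analysis"
begin

section \<open>Viscosity subsolutions\<close>

definition usc_on :: "'a::topological_space set \<Rightarrow> ('a \<Rightarrow> real) \<Rightarrow> bool" where
  "usc_on \<Omega> u \<longleftrightarrow> (\<forall>z\<in>\<Omega>. \<forall>c>u z. \<forall>\<^sub>F w in at z within \<Omega>. u w < c)"

text \<open>Subsolutions of \<open>F(z, Du(z)) = 0\<close> in an open set \<open>\<Omega>\<close>. The test functions \<open>\<phi>\<close> are of class
  \<open>C\<^sup>1\<close> on \<open>\<Omega>\<close>, with gradient \<open>D\<phi>\<close>, and touch \<open>u\<close> locally from above at \<open>z\<close> up to an additive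
  constant. \<open>F\<close> takes extended real values because \<open>hamiltonian\<close> below does.\<close>

definition viscosity_subsolution ::
    "'a::euclidean_space set \<Rightarrow> ('a \<Rightarrow> 'a \<Rightarrow> ereal) \<Rightarrow> ('a \<Rightarrow> real) \<Rightarrow> bool" where
  "viscosity_subsolution \<Omega> F u \<longleftrightarrow>
     usc_on \<Omega> u \<and>
     (\<forall>\<phi> D\<phi> z.
        (\<forall>w\<in>\<Omega>. (\<phi> has_derivative (\<lambda>h. D\<phi> w \<bullet> h)) (at w)) \<longrightarrow>
        continuous_on \<Omega> D\<phi> \<longrightarrow>
        z \<in> \<Omega> \<longrightarrow>
        (\<exists>r>0. \<forall>w\<in>ball z r \<inter> \<Omega>. u w - \<phi> w \<le> u z - \<phi> z) \<longrightarrow>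
        F z (D\<phi> z) \<le> 0)"

section \<open>Controlled dynamics and value functions\<close>

definition control :: "'k::euclidean_space set \<Rightarrow> (real \<Rightarrow> 'k) \<Rightarrow> bool" where
  "control A \<alpha> \<longleftrightarrow> \<alpha> \<in> borel_measurable (lebesgue_on {0..}) \<and> (\<forall>s\<ge>0. \<alpha> s \<in> A)"

text \<open>Since controls are merely measurable, the differential equations hold in the sense of
  Caratheodory, that is, in integrated form. By the Lipschitz assumption \<open>(\<xi>, \<eta>)\<close> is determined
  on \<open>[0, \<infinity>)\<close> by the control and the starting point; it exists for every control
  if \<open>f\<close> and \<open>g\<close> are continuous in the control variable.\<close>

definition trajectory ::
    "(real^'n \<Rightarrow> real^'m \<Rightarrow> 'k \<Rightarrow> real^'n) \<Rightarrow> (real^'n \<Rightarrow> real^'m \<Rightarrow> 'k \<Rightarrow> real^'m) \<Rightarrow> real \<Rightarrow>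
     (real \<Rightarrow> 'k) \<Rightarrow> real^'n \<Rightarrow> real^'m \<Rightarrow> (real \<Rightarrow> real^'n) \<Rightarrow> (real \<Rightarrow> real^'m) \<Rightarrow> bool" where
  "trajectory f g \<epsilon> \<alpha> x y \<xi> \<eta> \<longleftrightarrow>
     (\<forall>T\<ge>0.
        (\<lambda>s. f (\<xi> s) (\<eta> s) (\<alpha> s)) absolutely_integrable_on {0..T} \<and>
        (\<lambda>s. g (\<xi> s) (\<eta> s) (\<alpha> s)) absolutely_integrable_on {0..T} \<and>
        \<xi> T = x + integral {0..T} (\<lambda>s. \<epsilon> *\<^sub>R f (\<xi> s) (\<eta> s) (\<alpha> s)) \<and>
        \<eta> T = y + integral {0..T} (\<lambda>s. g (\<xi> s) (\<eta> s) (\<alpha> s)))"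

definition value_fn ::
    "(real^'n \<Rightarrow> real^'m \<Rightarrow> 'k \<Rightarrow> real^'n) \<Rightarrow> (real^'n \<Rightarrow> real^'m \<Rightarrow> 'k \<Rightarrow> real^'m) \<Rightarrow>
     (real^'n \<Rightarrow> real^'m \<Rightarrow> 'k \<Rightarrow> real) \<Rightarrow> (real^'n \<Rightarrow> real^'m \<Rightarrow> real) \<Rightarrow> 'k::euclidean_space set \<Rightarrow>
     real \<Rightarrow> real^'n \<Rightarrow> real^'m \<Rightarrow> real \<Rightarrow> real" where
  "value_fn f g l u0 A \<epsilon> x y t =
     Inf {\<epsilon> * integral {0..t/\<epsilon>} (\<lambda>s. l (\<xi> s) (\<eta> s) (\<alpha> s)) + u0 (\<xi> (t/\<epsilon>)) (\<eta> (t/\<epsilon>)) | \<alpha> \<xi> \<eta>.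
          control A \<alpha> \<and> trajectory f g \<epsilon> \<alpha> x y \<xi> \<eta>}"

section \<open>Upper weak semilimit\<close>

definition weak_limsup ::
    "'a::topological_space set \<Rightarrow> (real \<Rightarrow> 'a \<Rightarrow> real) \<Rightarrow> 'a \<Rightarrow> ereal" where
  "weak_limsup D V z =
     Sup {limsup (\<lambda>n. ereal (V (e n) (w n))) | e w.
          (\<forall>n. e n > 0) \<and> e \<longlonglongrightarrow> 0 \<and> (\<forall>n. w n \<in> D) \<and> w \<longlonglongrightarrow> z}"

text \<open>For \<open>t > 0\<close> the semilimit of the value functions is finite and does not depend on \<open>y\<close>;
  the function of \<open>(x, t)\<close> thus defined is its common value. At \<open>t \<le> 0\<close> it is unspecified.\<close>

definition value_limsup ::
    "(real^'n \<Rightarrow> real^'m \<Rightarrow> 'k \<Rightarrow> real^'n) \<Rightarrow> (real^'n \<Rightarrow> real^'m \<Rightarrow> 'k \<Rightarrow> real^'m) \<Rightarrow>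
     (real^'n \<Rightarrow> real^'m \<Rightarrow> 'k \<Rightarrow> real) \<Rightarrow> (real^'n \<Rightarrow> real^'m \<Rightarrow> real) \<Rightarrow> 'k::euclidean_space set \<Rightarrow>
     (real^'n) \<times> real \<Rightarrow> real" where
  "value_limsup f g l u0 A = (\<lambda>(x, t).
     THE v. \<forall>y. weak_limsup (UNIV \<times> UNIV \<times> {0..})
                  (\<lambda>\<epsilon> (x', y', t'). value_fn f g l u0 A \<epsilon> x' y' t') (x, y, t) = ereal v)"

section \<open>Hamiltonians and limit initial datum\<close>

text \<open>If \<open>f\<close> and \<open>g\<close> are continuous in the control, the supremum is a finite maximum. As this
  continuity is not assumed, the supremum is taken in the extended reals.\<close>

definition hamiltonian ::
    "(real^'n \<Rightarrow> real^'m \<Rightarrow> 'k \<Rightarrow> real^'n) \<Rightarrow> (real^'n \<Rightarrow> real^'m \<Rightarrow> 'k \<Rightarrow> real^'m) \<Rightarrow>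
     (real^'n \<Rightarrow> real^'m \<Rightarrow> 'k \<Rightarrow> real) \<Rightarrow> 'k set \<Rightarrow>
     real^'n \<Rightarrow> real^'m \<Rightarrow> real^'n \<Rightarrow> real^'m \<Rightarrow> ereal" where
  "hamiltonian f g l A x y p q =
     (SUP a\<in>A. ereal (- (p \<bullet> f x y a) - q \<bullet> g x y a - l x y a))"

definition effective_hamiltonian ::
    "(real^'n \<Rightarrow> real^'m \<Rightarrow> 'k \<Rightarrow> real^'n) \<Rightarrow> (real^'n \<Rightarrow> real^'m \<Rightarrow> 'k \<Rightarrow> real^'m) \<Rightarrow>
     (real^'n \<Rightarrow> real^'m \<Rightarrow> 'k \<Rightarrow> real) \<Rightarrow> 'k set \<Rightarrow> real^'n \<Rightarrow> real^'n \<Rightarrow> real" where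
  "effective_hamiltonian f g l A x p =
     Inf {b. \<exists>u. viscosity_subsolution UNIV (\<lambda>y q. hamiltonian f g l A x y p q - ereal b) u}"

definition limit_datum :: "(real^'n \<Rightarrow> real^'m \<Rightarrow> real) \<Rightarrow> real^'n \<Rightarrow> real" where
  "limit_datum u0 x = (INF y. u0 x y)"

end

theory Submission
  imports Defs
begin

text \<open>The proof is a dynamic programming argument that works with cycles of the fast dynamics in place
  of correctors.

  \<^emph>\<open>The subsolution property.\<close> Freeze a point \<open>x0\<close> and a covector \<open>p\<close>, and charge every motion of the
  fast variable the cost \<open>\<integral> (l + p \<bullet> f + b)\<close>. If no closed motion based at \<open>0\<close> has negative cost, then the
  least cost of moving from \<open>y\<close> to \<open>0\<close> is a finite function of \<open>y\<close>, and comparing \<open>y\<close> with a point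
  reached from it in a short time by a constant control shows that this function is a subsolution of
  \<open>H(x0, y, p, Du) = b\<close>. Hence \<open>b\<close> is at least the effective Hamiltonian. So, if \<open>b\<close> lies strictly below
  the effective Hamiltonian, a cycle of negative cost exists
  (\<open>effective_hamiltonian_le_or_negative_cycle\<close>). For small \<open>\<epsilon>\<close> and slow variable close to \<open>x0\<close> this cycle
  can be run again and again for a macroscopic time \<open>h\<close>, that is, for a time \<open>h / \<epsilon>\<close> of the fast dynamics.
  Dynamic programming then gives
  \<open>V\<^sup>\<epsilon>(x, y, t) \<le> V\<^sup>\<epsilon>(x', y', t - h) - p \<bullet> (x' - x) - b h\<close> with \<open>y'\<close> near the base point and
  \<open>|x' - x| \<le> Q0 h\<close>, up to errors that vanish with \<open>\<epsilon>\<close>. This passes to the semilimit (\<open>value_limsup_decreases_along_cycle\<close>). If a test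
  function with derivative \<open>(p, \<tau>)\<close> at \<open>(x0, t0)\<close> touched the semilimit from above there and \<open>-\<tau>\<close> were
  below the effective Hamiltonian, then taking \<open>b\<close> strictly between them would contradict the
  first-order expansion of the test function as \<open>h \<rightarrow> 0\<close>.

  \<^emph>\<open>The cost of corrections.\<close> A cycle of the frozen system does not close up for the true system, and the
  error would accumulate over some \<open>1 / \<epsilon>\<close> repetitions. Controllability repairs this: a greedy choice of the
  control decreases the distance to a target at a uniform rate (\<open>greedy_step\<close>, \<open>steering\<close>), so an error of
  size \<open>\<delta>\<close> is removed in a time, and at a cost, of order \<open>\<delta>\<close>. All motions of the frozen system are therefore
  described by \<open>robust_transit\<close>, which speaks only about the true system for small \<open>\<epsilon>\<close> and is stable under
  composition.

  \<^emph>\<open>The other claims.\<close> Steering from \<open>y\<close> to \<open>y'\<close> takes a bounded time of the fast dynamics, which is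
  negligible on the slow scale; hence the semilimit does not depend on \<open>y\<close>. Keeping the fast variable near
  a prescribed point \<open>y\<close> for the whole time (\<open>staying_near\<close>) costs \<open>O(t)\<close>, with a terminal
  cost close to \<open>u0 x y\<close> for small \<open>t\<close>; this bounds the semilimit from above and, with \<open>y\<close> almost minimising \<open>u0 x0\<close>, yields the initial condition.

  Apart from a crude lower bound that keeps the infima finite, each of these steps rests on upper bounds for
  \<open>V\<^sup>\<epsilon>\<close>, hence on particular controls. These are piecewise constant, which ensures that they have
  trajectories: \<open>f\<close> and \<open>g\<close> may depend on the control in an arbitrary way.\<close>

section \<open>Differential equations with Lipschitz right-hand side\<close>

lemma continuous_on_of_lipschitz:
  fixes h :: "'a::real_normed_vector \<Rightarrow> 'b::real_normed_vector"
  assumes "\<And>z w. norm (h z - h w) \<le> L * norm (z - w)" "0 \<le> L"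
  shows "continuous_on S h"
  by (rule lipschitz_on_continuous_on[where L = L]) (use assms in \<open>auto intro: lipschitz_onI simp: dist_norm\<close>)

lemma integral_exp_le:
  fixes K t :: real assumes "K > 0" "t \<ge> 0"
  shows "integral {0..t} (\<lambda>s. exp (K * s)) \<le> exp (K * t) / K"
proof -
  have "((\<lambda>s. exp (K * s)) has_integral (exp (K * t) / K - exp (K * 0) / K)) {0..t}"
    by (rule fundamental_theorem_of_calculus)
      (use assms in \<open>auto intro!: derivative_eq_intros simp: has_real_derivative_iff_has_vector_derivative[symmetric]\<close>)
  then show ?thesis using assms by (auto simp: integral_unique field_simps)
qed

lemma continuous_on_atLeastI:
  fixes h :: "real \<Rightarrow> 'a::topological_space"
  assumes "\<And>T. continuous_on {a..T} h"
  shows "continuous_on {a..} h"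
  unfolding continuous_on_eq_continuous_within
proof
  fix x assume "x \<in> {a..}"
  then have "continuous (at x within {a..x + 1}) h"
    using assms[of "x + 1"] by (auto simp: continuous_on_eq_continuous_within)
  moreover have "at x within {a..} = at x within {a..x + 1}"
    by (rule at_within_nhd[where S = "{x - 1<..<x + 1}"]) auto
  ultimately show "continuous (at x within {a..}) h" by simp
qed

text \<open>Picard's theorem in one step. In the weighted unknown \<open>exp (- 2 L t) (\<zeta> t - z)\<close> the integral operator
  maps bounded continuous functions to bounded continuous functions and contracts by \<open>1 / 2\<close>, so its fixed
  point lives on the whole half-line.\<close>

lemma lipschitz_ode_global_solution:
  fixes F :: "'a::euclidean_space \<Rightarrow> 'a"
  assumes lip: "\<And>z w. norm (F z - F w) \<le> L * norm (z - w)" and "L > 0"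
  shows "\<exists>\<zeta>. continuous_on {0..} \<zeta> \<and> (\<forall>t\<ge>0. \<zeta> t = z + integral {0..t::real} (\<lambda>s. F (\<zeta> s)))"
proof -
  define K where "K = 2 * L"
  have K: "K > 0" using \<open>L > 0\<close> by (simp add: K_def)
  have contF: "continuous_on UNIV F" using \<open>L > 0\<close> by (intro continuous_on_of_lipschitz[OF lip]) simp
  define G where "G u s = F (z + exp (K * s) *\<^sub>R apply_bcontfun u s)" for u :: "real \<Rightarrow>\<^sub>C 'a" and s
  define \<Phi> where "\<Phi> u t = exp (- K * max 0 t) *\<^sub>R integral {0..max 0 t} (G u)" for u t
  have contG: "continuous_on S (G u)" for u S
    unfolding G_def
    by (rule continuous_on_compose2[OF contF]) (auto intro!: continuous_intros)
  have intG: "(G u) integrable_on {0..t}" for u t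
    by (rule integrable_continuous_real) (rule contG)
  have intE: "(\<lambda>s. c * exp (K * s)) integrable_on {0..t}" for c t
    by (rule integrable_continuous_real) (auto intro!: continuous_intros)
  have est: "norm (exp (- K * t) *\<^sub>R integral {0..t} h) \<le> c / K"
    if "t \<ge> 0" "h integrable_on {0..t}" "\<And>s. s \<ge> 0 \<Longrightarrow> norm (h s) \<le> c * exp (K * s)" "c \<ge> 0"
    for h :: "real \<Rightarrow> 'a" and t c
  proof -
    have "norm (integral {0..t} h) \<le> integral {0..t} (\<lambda>s. c * exp (K * s))"
      by (rule integral_norm_bound_integral) (use that intE in auto)
    also have "\<dots> \<le> c * (exp (K * t) / K)"
      using mult_left_mono[OF integral_exp_le[OF K \<open>t \<ge> 0\<close>] \<open>c \<ge> 0\<close>] by simp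
    finally have "norm (integral {0..t} h) \<le> c * (exp (K * t) / K)" .
    then have "exp (- K * t) * norm (integral {0..t} h) \<le> exp (- K * t) * (c * (exp (K * t) / K))"
      by (intro mult_left_mono) auto
    also have "\<dots> = c / K" by (simp add: exp_minus field_simps)
    finally show ?thesis by simp
  qed
  have bound: "norm (G u s) \<le> (norm (F z) + L * norm u) * exp (K * s)" if "s \<ge> 0" for u s
  proof -
    have "norm (G u s) \<le> norm (F z) + L * norm (exp (K * s) *\<^sub>R apply_bcontfun u s)"
      using lip[of "z + exp (K * s) *\<^sub>R apply_bcontfun u s" z] norm_triangle_sub[of "G u s" "F z"]
      by (simp add: G_def)
    also have "\<dots> \<le> norm (F z) * exp (K * s) + L * (exp (K * s) * norm u)"
    proof (intro add_mono)
      show "norm (F z) \<le> norm (F z) * exp (K * s)"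
        using that K by (intro mult_le_cancel_left1[THEN iffD2]) auto
      show "L * norm (exp (K * s) *\<^sub>R apply_bcontfun u s) \<le> L * (exp (K * s) * norm u)"
        using \<open>L > 0\<close> norm_bounded[of u s] by (simp add: mult_left_mono)
    qed
    finally show ?thesis by (simp add: algebra_simps)
  qed
  have diff: "norm (G u s - G v s) \<le> (L * dist u v) * exp (K * s)" if "s \<ge> 0" for u v s
  proof -
    have "norm (G u s - G v s) \<le> L * norm (exp (K * s) *\<^sub>R (apply_bcontfun u s - apply_bcontfun v s))"
      using lip[of "z + exp (K * s) *\<^sub>R apply_bcontfun u s" "z + exp (K * s) *\<^sub>R apply_bcontfun v s"]
      by (simp add: G_def algebra_simps)
    also have "\<dots> \<le> L * (exp (K * s) * dist u v)"
      using dist_bounded[of u s v] \<open>L > 0\<close> by (simp add: dist_norm mult_left_mono)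
    finally show ?thesis by (simp add: algebra_simps)
  qed
  have contI: "continuous_on {0..} (\<lambda>t. integral {0..t} (G u))" for u
    by (rule continuous_on_atLeastI) (rule indefinite_integral_continuous_1[OF intG])
  have \<Phi>: "\<Phi> u \<in> bcontfun" for u
  proof (rule bcontfun_normI)
    show "continuous_on UNIV (\<Phi> u)" unfolding \<Phi>_def
      by (intro continuous_intros continuous_on_compose2[OF contI]) auto
    show "norm (\<Phi> u t) \<le> (norm (F z) + L * norm u) / K" for t
      unfolding \<Phi>_def using \<open>L > 0\<close> by (intro est intG bound) auto
  qed
  have "dist (Bcontfun (\<Phi> u)) (Bcontfun (\<Phi> v)) \<le> 1 / 2 * dist u v" for u v
  proof (rule dist_bound)
    fix t
    have "norm (\<Phi> u t - \<Phi> v t) = norm (exp (- K * max 0 t) *\<^sub>R integral {0..max 0 t} (\<lambda>s. G u s - G v s))"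
      unfolding \<Phi>_def by (subst integral_diff[OF intG intG]) (simp add: scaleR_diff_right)
    also have "\<dots> \<le> (L * dist u v) / K"
      using \<open>L > 0\<close> by (intro est integrable_diff intG diff) auto
    also have "\<dots> = 1 / 2 * dist u v" using \<open>L > 0\<close> by (simp add: K_def)
    finally show "dist (apply_bcontfun (Bcontfun (\<Phi> u)) t) (apply_bcontfun (Bcontfun (\<Phi> v)) t) \<le> 1 / 2 * dist u v"
      using \<Phi> by (simp add: Bcontfun_inverse dist_norm)
  qed
  then have "\<exists>!u. Bcontfun (\<Phi> u) = u"
    by (intro banach_fix_type[where c = "1 / 2"]) auto
  then obtain u where u: "Bcontfun (\<Phi> u) = u" by blast
  have u': "apply_bcontfun u t = exp (- K * t) *\<^sub>R integral {0..t} (G u)" if "t \<ge> 0" for t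
    using \<Phi>[of u] u that by (metis Bcontfun_inverse \<Phi>_def max_absorb2)
  show ?thesis
  proof (intro exI[of _ "\<lambda>t. z + exp (K * t) *\<^sub>R apply_bcontfun u t"] conjI allI impI)
    show "continuous_on {0..} (\<lambda>t. z + exp (K * t) *\<^sub>R apply_bcontfun u t)"
      by (intro continuous_intros) auto
    show "z + exp (K * t) *\<^sub>R apply_bcontfun u t =
        z + integral {0..t} (\<lambda>s. F (z + exp (K * s) *\<^sub>R apply_bcontfun u s))" if "t \<ge> 0" for t
      using u'[OF that] by (simp add: G_def[abs_def] exp_minus)
  qed
qed

text \<open>For times \<open>s \<le> 1 / (2 L)\<close> the maximum of \<open>|w|\<close> is at most half of itself plus the data, so it can be
  absorbed without an exponential.\<close>

lemma short_time_gronwall: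
  fixes w v :: "real \<Rightarrow> 'a::euclidean_space"
  assumes w: "\<And>t. t \<in> {0..s} \<Longrightarrow> w t = w0 + integral {0..t} v"
    and v: "continuous_on {0..s} v" and "s \<ge> 0"
    and vw: "\<And>t. t \<in> {0..s} \<Longrightarrow> norm (v t) \<le> L * norm (w t) + e"
    and L: "L \<ge> 0" "s * L \<le> 1 / 2" and e: "e \<ge> 0" and t: "t \<in> {0..s}"
  shows "norm (w t) \<le> 2 * (norm w0 + s * e)"
proof -
  have "continuous_on {0..s} (\<lambda>t. w0 + integral {0..t} v)"
    by (intro continuous_intros indefinite_integral_continuous_1 integrable_continuous_real v)
  then have "continuous_on {0..s} w" using w by (subst continuous_on_cong[OF refl w]) auto
  then have "\<exists>t\<in>{0..s}. \<forall>t'\<in>{0..s}. norm (w t') \<le> norm (w t)"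
    using \<open>s \<ge> 0\<close> by (intro continuous_attains_sup continuous_intros) auto
  then obtain t1 where t1: "t1 \<in> {0..s}" and max: "\<And>t'. t' \<in> {0..s} \<Longrightarrow> norm (w t') \<le> norm (w t1)"
    by auto
  let ?m = "norm (w t1)"
  have "norm (integral {0..t1} v) \<le> (L * ?m + e) * (t1 - 0)"
  proof (rule integral_bound)
    show "continuous_on {0..t1} v" by (rule continuous_on_subset[OF v]) (use t1 in auto)
    fix t assume "t \<in> {0..t1}"
    then have "t \<in> {0..s}" using t1 by auto
    with vw[OF this] max[OF this] L show "norm (v t) \<le> L * ?m + e"
      by (meson add_right_mono mult_left_mono order_trans)
  qed (use t1 in auto)
  also have "\<dots> \<le> (L * ?m + e) * s"
    using t1 L e by (intro mult_left_mono) auto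
  finally have "?m \<le> norm w0 + (L * ?m + e) * s"
    using w[OF t1] norm_triangle_ineq[of w0 "integral {0..t1} v"] by simp
  also have "\<dots> = norm w0 + s * e + (s * L) * ?m" by (simp add: algebra_simps)
  also have "\<dots> \<le> norm w0 + s * e + (1 / 2) * ?m"
    using L by (intro add_left_mono mult_right_mono) auto
  finally show ?thesis using max[OF t] by simp
qed

section \<open>Semilimits and semicontinuity\<close>

text \<open>The next two lemmas replace the sequences in the definition of the semilimit by neighbourhoods: a bound
  on the semilimit at a point is a bound on all \<open>V e w\<close> with \<open>e\<close> small and \<open>w\<close> close to that point. Otherwise
  one could select a sequence that violates it.\<close>

lemma weak_limsup_less_imp_locally_less:
  fixes V :: "real \<Rightarrow> 'a::metric_space \<Rightarrow> real"
  assumes "weak_limsup D V z < ereal c"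
  shows "\<exists>\<rho>>0. \<forall>e w. 0 < e \<and> e < \<rho> \<and> w \<in> D \<and> dist w z < \<rho> \<longrightarrow> V e w < c"
proof (rule ccontr)
  assume "\<not> ?thesis"
  then have "\<exists>e w. 0 < e \<and> e < \<rho> \<and> w \<in> D \<and> dist w z < \<rho> \<and> c \<le> V e w" if "\<rho> > 0" for \<rho>
    using that by (metis not_le)
  then have "\<forall>n. \<exists>e w. 0 < e \<and> e < 1 / real (Suc n) \<and> w \<in> D \<and> dist w z < 1 / real (Suc n) \<and> c \<le> V e w"
    by simp
  then obtain e w where ew: "\<And>n. 0 < e n" "\<And>n. e n < 1 / real (Suc n)" "\<And>n. w n \<in> D"
    "\<And>n. dist (w n) z < 1 / real (Suc n)" "\<And>n. c \<le> V (e n) (w n)"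
    by metis
  have lim: "(\<lambda>n. 1 / real (Suc n)) \<longlonglongrightarrow> 0"
    using LIMSEQ_inverse_real_of_nat by (simp add: inverse_eq_divide)
  \<comment> \<open>both sequences are squeezed by \<open>1 / (n + 1)\<close>\<close>
  have to_0: "X \<longlonglongrightarrow> 0" if "\<And>n. 0 \<le> X n" "\<And>n. X n < 1 / real (Suc n)" for X :: "nat \<Rightarrow> real"
    by (rule tendsto_sandwich[OF always_eventually always_eventually tendsto_const lim])
      (use that in \<open>auto intro: less_imp_le simp del: of_nat_Suc\<close>)
  have e0: "e \<longlonglongrightarrow> 0" by (rule to_0) (use ew(1,2) in \<open>auto intro: less_imp_le simp del: of_nat_Suc\<close>)
  have "(\<lambda>n. dist (w n) z) \<longlonglongrightarrow> 0" by (rule to_0[OF zero_le_dist ew(4)])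
  then have w0: "w \<longlonglongrightarrow> z" by (rule tendsto_dist_iff[THEN iffD2])
  have "ereal c \<le> limsup (\<lambda>n. ereal (V (e n) (w n)))"
    by (rule le_Limsup) (use ew in auto)
  also have "\<dots> \<le> weak_limsup D V z"
    unfolding weak_limsup_def by (rule Sup_upper) (use ew e0 w0 in blast)
  finally show False using assms by simp
qed

lemma weak_limsup_le_of_locally_le:
  fixes V :: "real \<Rightarrow> 'a::metric_space \<Rightarrow> real"
  assumes "\<rho> > 0" "\<And>e w. 0 < e \<Longrightarrow> e < \<rho> \<Longrightarrow> w \<in> D \<Longrightarrow> dist w z < \<rho> \<Longrightarrow> V e w \<le> c"
  shows "weak_limsup D V z \<le> ereal c"
  unfolding weak_limsup_def
proof (rule Sup_least, clarsimp)
  fix e :: "nat \<Rightarrow> real" and w :: "nat \<Rightarrow> 'a"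
  assume a: "\<forall>n. 0 < e n" "e \<longlonglongrightarrow> 0" "\<forall>n. w n \<in> D" "w \<longlonglongrightarrow> z"
  have "\<forall>\<^sub>F n in sequentially. e n < \<rho>" "\<forall>\<^sub>F n in sequentially. dist (w n) z < \<rho>"
    using order_tendstoD(2)[OF a(2) assms(1)] tendstoD[OF a(4) assms(1)] by auto
  then have "\<forall>\<^sub>F n in sequentially. ereal (V (e n) (w n)) \<le> ereal c"
    by eventually_elim (use a assms(2) in auto)
  then show "limsup (\<lambda>n. ereal (V (e n) (w n))) \<le> ereal c" by (rule Limsup_bounded)
qed

lemma weak_limsup_ge_of_locally_ge:
  fixes V :: "real \<Rightarrow> 'a::metric_space \<Rightarrow> real"
  assumes "z \<in> D" "\<rho> > 0" "\<And>e. 0 < e \<Longrightarrow> e < \<rho> \<Longrightarrow> c \<le> V e z"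
  shows "ereal c \<le> weak_limsup D V z"
proof (rule ccontr)
  assume "\<not> ereal c \<le> weak_limsup D V z"
  then have "weak_limsup D V z < ereal c" by simp
  from weak_limsup_less_imp_locally_less[OF this] obtain \<rho>'
    where \<rho>': "\<rho>' > 0" "\<And>e. 0 < e \<Longrightarrow> e < \<rho>' \<Longrightarrow> V e z < c"
    using assms(1) by (metis dist_self)
  define e where "e = min \<rho> \<rho>' / 2"
  have "0 < e" "e < \<rho>" "e < \<rho>'" using assms(2) \<rho>'(1) by (auto simp: e_def)
  then show False using assms(3)[of e] \<rho>'(2)[of e] by simp
qed

lemma ereal_le_of_all_real_above:
  fixes a b :: ereal
  assumes "\<And>c::real. b < ereal c \<Longrightarrow> a \<le> ereal c"
  shows "a \<le> b"
proof (rule ccontr)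
  assume "\<not> a \<le> b"
  then have "b < a" by simp
  then obtain c where "b < ereal c" "ereal c < a" using ereal_dense2 by blast
  then show False using assms by force
qed

text \<open>If there were no maximum point, the open sets on which the function lies below one of its values would
  cover \<open>K\<close>; in a finite subcover, the best of the finitely many points lies in none of these sets. This
  provides points at which subsolutions are touched by test functions.\<close>

lemma usc_minus_continuous_attains_max:
  fixes u \<psi> :: "'a::euclidean_space \<Rightarrow> real"
  assumes u: "usc_on UNIV u" and \<psi>: "continuous_on UNIV \<psi>" and K: "compact K" "K \<noteq> {}"
  shows "\<exists>z\<in>K. \<forall>w\<in>K. u w - \<psi> w \<le> u z - \<psi> z"
proof (rule ccontr)
  assume "\<not> ?thesis"
  then have no_max: "\<exists>w\<in>K. u z - \<psi> z < u w - \<psi> w" if "z \<in> K" for z using that by force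
  have op: "open {w. u w - \<psi> w < c}" for c
  proof (subst open_subopen, intro ballI)
    fix w assume "w \<in> {w. u w - \<psi> w < c}"
    then obtain d where d: "u w - \<psi> w < d" "d < c" using dense by blast
    then have "\<forall>\<^sub>F w' in at w. u w' < d + \<psi> w" using u[unfolded usc_on_def, rule_format, of w "d + \<psi> w"] by simp
    then have "\<forall>\<^sub>F w' in nhds w. u w' < d + \<psi> w" using d by (simp add: eventually_nhds_conv_at)
    moreover have "\<forall>\<^sub>F w' in nhds w. \<psi> w - (c - d) < \<psi> w'"
      using \<psi> d by (intro order_tendstoD) (auto simp: continuous_on_eq_continuous_at isCont_def tendsto_at_iff_tendsto_nhds)
    ultimately have "\<forall>\<^sub>F w' in nhds w. u w' - \<psi> w' < c" by eventually_elim simp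
    then show "\<exists>T. open T \<and> w \<in> T \<and> T \<subseteq> {w. u w - \<psi> w < c}" by (auto simp: eventually_nhds)
  qed
  have "K \<subseteq> (\<Union>z\<in>K. {w. u w - \<psi> w < u z - \<psi> z})" using no_max by blast
  then obtain F where F: "F \<subseteq> K" "finite F" "K \<subseteq> (\<Union>z\<in>F. {w. u w - \<psi> w < u z - \<psi> z})"
    using compactE_image[of K K "\<lambda>z. {w. u w - \<psi> w < u z - \<psi> z}"] K(1) op by metis
  then have "F \<noteq> {}" using K(2) by auto
  then obtain z where z: "z \<in> F" "\<And>z'. z' \<in> F \<Longrightarrow> u z' - \<psi> z' \<le> u z - \<psi> z"
    using Max_in[of "(\<lambda>z. u z - \<psi> z) ` F"] Max_ge[of "(\<lambda>z. u z - \<psi> z) ` F"] F(2) by fastforce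
  then obtain z' where "z' \<in> F" "u z - \<psi> z < u z' - \<psi> z'" using F(1,3) by blast
  then show False using z(2)[of z'] by simp
qed

section \<open>Switching between two controls\<close>

definition switch_at :: "real \<Rightarrow> (real \<Rightarrow> 'b) \<Rightarrow> (real \<Rightarrow> 'b) \<Rightarrow> real \<Rightarrow> 'b" where
  "switch_at s u v t = (if t < s then u t else v (t - s))"

lemma switch_at_has_integral:
  fixes u v :: "real \<Rightarrow> 'b::euclidean_space"
  assumes u: "(u has_integral I) {0..s}" and v: "(v has_integral J) {0..T - s}" and "0 \<le> s" "s \<le> T"
  shows "(switch_at s u v has_integral (I + J)) {0..T}"
proof (rule has_integral_combine)
  show "(switch_at s u v has_integral I) {0..s}"
    by (rule has_integral_spike_finite[of "{s}", OF _ _ u]) (auto simp: switch_at_def)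
  have "(((\<lambda>t. v (t - s)) \<circ> (+) s) has_integral J) {0..T - s}"
    using v by (simp add: o_def)
  then have "((\<lambda>t. v (t - s)) has_integral J) {s..T}"
    by (subst (asm) has_integral_shift_Icc_real) simp
  then show "(switch_at s u v has_integral J) {s..T}"
    by (rule has_integral_eq[rotated]) (auto simp: switch_at_def)
qed (use assms in auto)

lemma switch_at_absolutely_integrable:
  fixes u v :: "real \<Rightarrow> 'b::euclidean_space"
  assumes u: "u absolutely_integrable_on {0..s}" and v: "v absolutely_integrable_on {0..T - s}"
    and "0 \<le> s" "s \<le> T"
  shows "switch_at s u v absolutely_integrable_on {0..T}"
    and "integral {0..T} (switch_at s u v) = integral {0..s} u + integral {0..T - s} v"
proof -
  have i: "u integrable_on {0..s}" "v integrable_on {0..T - s}"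
    "(\<lambda>x. norm (u x)) integrable_on {0..s}" "(\<lambda>x. norm (v x)) integrable_on {0..T - s}"
    using u v by (auto simp: absolutely_integrable_on_def)
  note h = switch_at_has_integral[OF integrable_integral[OF i(1)] integrable_integral[OF i(2)] assms(3,4)]
  have "(\<lambda>t. norm (switch_at s u v t)) = switch_at s (\<lambda>t. norm (u t)) (\<lambda>t. norm (v t))"
    by (auto simp: switch_at_def)
  with switch_at_has_integral[OF integrable_integral[OF i(3)] integrable_integral[OF i(4)] assms(3,4)] h
  show "switch_at s u v absolutely_integrable_on {0..T}"
    by (auto simp: absolutely_integrable_on_def has_integral_iff)
  show "integral {0..T} (switch_at s u v) = integral {0..s} u + integral {0..T - s} v"
    using h by (simp add: integral_unique)
qed

lemma switch_at_before:
  assumes "T < s" shows "integral {0..T} (switch_at s u v) = integral {0..T} u"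
    and "switch_at s u v absolutely_integrable_on {0..T} \<longleftrightarrow> u absolutely_integrable_on {0..T}"
proof -
  have "switch_at s u v t = u t" if "t \<in> {0..T}" for t using that assms by (auto simp: switch_at_def)
  then have "(\<lambda>t. indicat_real {0..T} t *\<^sub>R switch_at s u v t) = (\<lambda>t. indicat_real {0..T} t *\<^sub>R u t)"
    and "integral {0..T} (switch_at s u v) = integral {0..T} u"
    by (auto simp: indicator_def fun_eq_iff intro!: integral_cong)
  then show "integral {0..T} (switch_at s u v) = integral {0..T} u"
    "switch_at s u v absolutely_integrable_on {0..T} \<longleftrightarrow> u absolutely_integrable_on {0..T}"
    by (simp_all add: set_integrable_def)
qed

text \<open>Controls are Lebesgue measurable only on the half-line, so the shifted control is first extended by
  \<open>0\<close> to the whole line, where translations preserve measurability.\<close>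

lemma control_switch_at:
  assumes "a \<in> A" "0 \<le> s" "control A \<alpha>"
  shows "control A (switch_at s (\<lambda>_. a) \<alpha>)"
  unfolding control_def
proof
  define \<alpha>0 where "\<alpha>0 t = (if t \<in> {0..} then \<alpha> t else 0)" for t
  have "\<alpha>0 \<in> borel_measurable lebesgue"
    unfolding \<alpha>0_def[abs_def]
    by (rule borel_measurable_if_I) (use assms(3) in \<open>auto simp: control_def\<close>)
  moreover have "(\<lambda>t. - s + 1 * t) \<in> lebesgue \<rightarrow>\<^sub>M (lebesgue :: real measure)"
    using lebesgue_affine_measurable[where c= "\<lambda>x::real. 1" and t = "- s"] by simp
  ultimately have m: "(\<lambda>t. \<alpha>0 (- s + 1 * t)) \<in> borel_measurable lebesgue" by (rule measurable_compose[rotated])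
  have "(\<lambda>t. if t < s then a else \<alpha>0 (- s + 1 * t)) \<in> borel_measurable lebesgue"
    by (rule measurable_If[OF _ m]) auto
  then have "(\<lambda>t. if t < s then a else \<alpha>0 (- s + 1 * t)) \<in> borel_measurable (lebesgue_on {0..})"
    by (rule measurable_restrict_space1)
  then show "switch_at s (\<lambda>_. a) \<alpha> \<in> borel_measurable (lebesgue_on {0..})"
    by (subst measurable_cong[where g = "\<lambda>t. if t < s then a else \<alpha>0 (- s + 1 * t)"])
      (auto simp: switch_at_def \<alpha>0_def)
  show "\<forall>t\<ge>0. switch_at s (\<lambda>_. a) \<alpha> t \<in> A"
    using assms by (auto simp: switch_at_def control_def)
qed

section \<open>The control problem\<close>

text \<open>Otherwise \<open>S\<close>, and with it its closed convex hull, would lie in a closed half-space that misses the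
  point \<open>- (3 / 4) r e\<close> of the ball.\<close>

lemma halfspace_meets_of_ball_subset_hull:
  fixes S :: "'a::euclidean_space set"
  assumes "r > 0" "ball 0 r \<subseteq> closure (convex hull S)" "norm e = 1"
  shows "\<exists>v\<in>S. e \<bullet> v < - r / 2"
proof (rule ccontr)
  assume "\<not> ?thesis"
  then have "S \<subseteq> {v. e \<bullet> v \<ge> - r / 2}" by auto
  then have "closure (convex hull S) \<subseteq> {v. e \<bullet> v \<ge> - r / 2}"
    by (intro closure_minimal hull_minimal convex_halfspace_ge closed_halfspace_ge)
  moreover have "(- (3 / 4) * r) *\<^sub>R e \<in> ball 0 r" using assms by simp
  ultimately have "e \<bullet> ((- (3 / 4) * r) *\<^sub>R e) \<ge> - r / 2" using assms(2) by blast
  then show False using assms by (simp add: dot_square_norm)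
qed

text \<open>States are pairs \<open>z\<close> of the slow variable \<open>fst z\<close> and the fast variable \<open>snd z\<close>. The value \<open>\<epsilon> = 0\<close> in
  \<open>field\<close> below gives the frozen dynamics, in which only the fast variable moves.\<close>

locale two_scale_control =
  fixes A :: "'k::euclidean_space set"
    and f :: "real^'n \<Rightarrow> real^'m \<Rightarrow> 'k \<Rightarrow> real^'n"
    and g :: "real^'n \<Rightarrow> real^'m \<Rightarrow> 'k \<Rightarrow> real^'m"
    and l :: "real^'n \<Rightarrow> real^'m \<Rightarrow> 'k \<Rightarrow> real"
    and u0 :: "real^'n \<Rightarrow> real^'m \<Rightarrow> real"
    and L0 Q0 :: real
  assumes A_compact: "compact A"
    and L0_pos: "L0 > 0"
    and f_lipschitz: "\<And>x1 y1 x2 y2 a. a \<in> A \<Longrightarrow>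
          norm (f x1 y1 a - f x2 y2 a) \<le> L0 * (norm (x1 - x2) + norm (y1 - y2))"
    and g_lipschitz: "\<And>x1 y1 x2 y2 a. a \<in> A \<Longrightarrow>
          norm (g x1 y1 a - g x2 y2 a) \<le> L0 * (norm (x1 - x2) + norm (y1 - y2))"
    and f_bounded: "\<And>x y a. a \<in> A \<Longrightarrow> norm (f x y a) \<le> Q0"
    and controllability: "\<And>K :: ((real^'n) \<times> (real^'m)) set. compact K \<Longrightarrow>
          \<exists>r>0. \<forall>(x, y)\<in>K. ball 0 r \<subseteq> closure (convex hull (g x y ` A))"
    and l_continuous: "continuous_on (UNIV \<times> UNIV \<times> A) (\<lambda>(x, y, a). l x y a)"
    and l_coercive: "\<And>B :: (real^'n) set. compact B \<Longrightarrow> B \<noteq> {} \<Longrightarrow>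
          filterlim (\<lambda>y. INF (x, a)\<in>B \<times> A. l x y a) at_top at_infinity"
    and u0_continuous: "continuous_on UNIV (\<lambda>(x, y). u0 x y)"
    and u0_bounded_below: "\<And>x y. - Q0 \<le> u0 x y"
begin

lemma A_nonempty: "A \<noteq> {}"
proof
  assume "A = {}"
  then obtain r :: real where "r > 0" "ball (0::real^'m) r \<subseteq> {}"
    using controllability[of "{(0, 0)}"] by auto
  then show False by auto
qed

lemma Q0_nonneg: "Q0 \<ge> 0"
proof -
  obtain a where "a \<in> A" using A_nonempty by blast
  then show ?thesis using norm_ge_zero f_bounded[of a 0 0] by (meson order_trans)
qed

definition field :: "real \<Rightarrow> 'k \<Rightarrow> (real^'n) \<times> (real^'m) \<Rightarrow> (real^'n) \<times> (real^'m)" where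
  "field \<epsilon> a z = (\<epsilon> *\<^sub>R f (fst z) (snd z) a, g (fst z) (snd z) a)"

definition cost :: "'k \<Rightarrow> (real^'n) \<times> (real^'m) \<Rightarrow> real" where
  "cost a z = l (fst z) (snd z) a"

lemma norm_fst_le_norm: "norm (fst z) \<le> norm z" and norm_snd_le_norm: "norm (snd z) \<le> norm z"
  using norm_fst_le[of "fst z" "snd z"] norm_snd_le[of "snd z" "fst z"] by simp_all

lemma f_lipschitz_pair:
  assumes "a \<in> A"
  shows "norm (f (fst z) (snd z) a - f (fst w) (snd w) a) \<le> 2 * L0 * norm (z - w)"
proof -
  have "norm (f (fst z) (snd z) a - f (fst w) (snd w) a) \<le> L0 * (norm (fst (z - w)) + norm (snd (z - w)))"
    using f_lipschitz[OF assms] by simp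
  also have "\<dots> \<le> L0 * (norm (z - w) + norm (z - w))"
    using L0_pos by (intro mult_left_mono add_mono norm_fst_le_norm norm_snd_le_norm) auto
  finally show ?thesis by simp
qed

lemma g_lipschitz_pair:
  assumes "a \<in> A"
  shows "norm (g (fst z) (snd z) a - g (fst w) (snd w) a) \<le> 2 * L0 * norm (z - w)"
proof -
  have "norm (g (fst z) (snd z) a - g (fst w) (snd w) a) \<le> L0 * (norm (fst (z - w)) + norm (snd (z - w)))"
    using g_lipschitz[OF assms] by simp
  also have "\<dots> \<le> L0 * (norm (z - w) + norm (z - w))"
    using L0_pos by (intro mult_left_mono add_mono norm_fst_le_norm norm_snd_le_norm) auto
  finally show ?thesis by simp
qed

lemma field_lipschitz:
  assumes "a \<in> A" "0 \<le> \<epsilon>" "\<epsilon> \<le> 1"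
  shows "norm (field \<epsilon> a z - field \<epsilon> a w) \<le> 4 * L0 * norm (z - w)"
proof -
  have "norm (field \<epsilon> a z - field \<epsilon> a w)
      = norm (\<epsilon> *\<^sub>R (f (fst z) (snd z) a - f (fst w) (snd w) a), g (fst z) (snd z) a - g (fst w) (snd w) a)"
    by (simp add: field_def scaleR_diff_right)
  also have "\<dots> \<le> \<epsilon> * norm (f (fst z) (snd z) a - f (fst w) (snd w) a) + norm (g (fst z) (snd z) a - g (fst w) (snd w) a)"
    using norm_Pair_le[of "\<epsilon> *\<^sub>R (f (fst z) (snd z) a - f (fst w) (snd w) a)"] assms by simp
  also have "\<dots> \<le> 1 * (2 * L0 * norm (z - w)) + 2 * L0 * norm (z - w)"
    using assms L0_pos by (intro add_mono mult_mono f_lipschitz_pair g_lipschitz_pair) auto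
  finally show ?thesis by simp
qed

lemma continuous_on_f: "a \<in> A \<Longrightarrow> continuous_on S (\<lambda>z. f (fst z) (snd z) a)"
  using L0_pos by (intro continuous_on_of_lipschitz[OF f_lipschitz_pair]) auto

lemma continuous_on_g: "a \<in> A \<Longrightarrow> continuous_on S (\<lambda>z. g (fst z) (snd z) a)"
  using L0_pos by (intro continuous_on_of_lipschitz[OF g_lipschitz_pair]) auto

lemma continuous_on_field: "a \<in> A \<Longrightarrow> continuous_on S (field \<epsilon> a)"
  unfolding field_def by (intro continuous_intros continuous_on_f continuous_on_g)

lemma continuous_on_cost: "a \<in> A \<Longrightarrow> continuous_on S (cost a)"
proof -
  assume "a \<in> A"
  have "continuous_on S (\<lambda>z. (\<lambda>(x, y, a). l x y a) (fst z, snd z, a))"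
    by (rule continuous_on_compose2[OF l_continuous]) (use \<open>a \<in> A\<close> in \<open>auto intro!: continuous_intros\<close>)
  then show ?thesis by (simp add: cost_def[abs_def])
qed

lemma l_bounded_on_compact:
  assumes "compact X" "compact Y"
  shows "\<exists>\<kappa>\<ge>0. \<forall>x\<in>X. \<forall>y\<in>Y. \<forall>a\<in>A. \<bar>l x y a\<bar> \<le> \<kappa>"
proof -
  have "compact ((\<lambda>(x, y, a). l x y a) ` (X \<times> Y \<times> A))"
    by (intro compact_continuous_image continuous_on_subset[OF l_continuous] compact_Times assms A_compact) auto
  then obtain \<kappa> where "\<forall>v\<in>(\<lambda>(x, y, a). l x y a) ` (X \<times> Y \<times> A). norm v \<le> \<kappa>"
    using compact_imp_bounded bounded_iff by blast
  then have "\<bar>l x y a\<bar> \<le> \<bar>\<kappa>\<bar>" if "x \<in> X" "y \<in> Y" "a \<in> A" for x y a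
    using that by force
  then show ?thesis by (intro exI[of _ "\<bar>\<kappa>\<bar>"]) auto
qed

text \<open>Coercivity gives nonnegativity outside a ball in \<open>y\<close>, uniformly over the compact set of slow variables;
  inside the ball compactness applies.\<close>

lemma l_bounded_below:
  assumes "compact X"
  shows "\<exists>\<kappa>\<ge>0. \<forall>x\<in>X. \<forall>y. \<forall>a\<in>A. - \<kappa> \<le> l x y a"
proof (cases "X = {}")
  case False
  have "\<forall>\<^sub>F y in at_infinity. 0 \<le> (INF (x, a)\<in>X \<times> A. l x y a)"
    using l_coercive[OF assms False] by (simp add: filterlim_at_top)
  then obtain R where R: "\<And>y. R \<le> norm y \<Longrightarrow> 0 \<le> (INF (x, a)\<in>X \<times> A. l x y a)"
    by (auto simp: eventually_at_infinity)
  have out: "0 \<le> l x y a" if "R \<le> norm y" "x \<in> X" "a \<in> A" for x y a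
  proof -
    obtain \<kappa> where \<kappa>: "\<forall>x\<in>X. \<forall>y'\<in>{y}. \<forall>a\<in>A. \<bar>l x y' a\<bar> \<le> \<kappa>"
      using l_bounded_on_compact[OF assms, of "{y}"] by auto
    have "bdd_below ((\<lambda>(x, a). l x y a) ` (X \<times> A))"
      by (rule bdd_belowI[of _ "- \<kappa>"]) (use \<kappa> in force)
    then have "(INF (x, a)\<in>X \<times> A. l x y a) \<le> l x y a"
      using cINF_lower[of "\<lambda>(x, a). l x y a" "X \<times> A" "(x, a)"] that by auto
    then show ?thesis using R[OF that(1)] by simp
  qed
  obtain \<kappa> where \<kappa>: "\<kappa> \<ge> 0" "\<forall>x\<in>X. \<forall>y\<in>cball 0 R. \<forall>a\<in>A. \<bar>l x y a\<bar> \<le> \<kappa>"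
    using l_bounded_on_compact[OF assms, of "cball 0 R"] by auto
  have "- \<kappa> \<le> l x y a" if "x \<in> X" "a \<in> A" for x y a
  proof (cases "R \<le> norm y")
    case True
    then show ?thesis using out[OF _ that] \<kappa>(1) by (meson neg_le_0_iff_le order_trans)
  next
    case False
    then have "\<bar>l x y a\<bar> \<le> \<kappa>" using \<kappa>(2) that by (auto simp: dist_norm)
    then show ?thesis by simp
  qed
  then show ?thesis using \<kappa>(1) by blast
qed auto

definition flow_line :: "real \<Rightarrow> 'k \<Rightarrow> (real^'n) \<times> (real^'m) \<Rightarrow> (real \<Rightarrow> (real^'n) \<times> (real^'m)) \<Rightarrow> bool" where
  "flow_line \<epsilon> a z \<zeta> \<longleftrightarrow> continuous_on {0..} \<zeta> \<and> (\<forall>t\<ge>0. \<zeta> t = z + integral {0..t} (\<lambda>s. field \<epsilon> a (\<zeta> s)))"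

lemma flow_line_exists:
  assumes "a \<in> A" "0 \<le> \<epsilon>" "\<epsilon> \<le> 1"
  shows "\<exists>\<zeta>. flow_line \<epsilon> a z \<zeta>"
  unfolding flow_line_def
  by (rule lipschitz_ode_global_solution[OF field_lipschitz[OF assms]]) (use L0_pos in simp)

lemma flow_line_continuous:
  assumes "flow_line \<epsilon> a z \<zeta>" "S \<subseteq> {0..}" shows "continuous_on S \<zeta>"
  using assms(1)[unfolded flow_line_def] by (intro continuous_on_subset[OF _ assms(2)]) (rule conjunct1)

lemma flow_line_eq: "flow_line \<epsilon> a z \<zeta> \<Longrightarrow> 0 \<le> t \<Longrightarrow> \<zeta> t = z + integral {0..t} (\<lambda>s. field \<epsilon> a (\<zeta> s))"
  unfolding flow_line_def by (drule conjunct2) (drule spec, erule mp)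

lemma flow_line_continuous_compose:
  assumes "flow_line \<epsilon> a z \<zeta>" "\<And>S. continuous_on S h"
  shows "continuous_on {0..T} (\<lambda>s. h (\<zeta> s))"
  by (rule continuous_on_compose2[OF assms(2) flow_line_continuous[OF assms(1)], where t = UNIV]) auto

lemma flow_line_components:
  assumes "flow_line \<epsilon> a z \<zeta>" "a \<in> A" "0 \<le> t"
  shows "fst (\<zeta> t) = fst z + integral {0..t} (\<lambda>s. \<epsilon> *\<^sub>R f (fst (\<zeta> s)) (snd (\<zeta> s)) a)"
    and "snd (\<zeta> t) = snd z + integral {0..t} (\<lambda>s. g (fst (\<zeta> s)) (snd (\<zeta> s)) a)"
proof -
  have "(\<lambda>s. field \<epsilon> a (\<zeta> s)) integrable_on {0..t}"
    by (rule integrable_continuous_real)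
      (rule flow_line_continuous_compose[OF assms(1)], rule continuous_on_field[OF assms(2)])
  note i = integral_linear[OF this bounded_linear_fst] integral_linear[OF this bounded_linear_snd]
  show "fst (\<zeta> t) = fst z + integral {0..t} (\<lambda>s. \<epsilon> *\<^sub>R f (fst (\<zeta> s)) (snd (\<zeta> s)) a)"
    "snd (\<zeta> t) = snd z + integral {0..t} (\<lambda>s. g (fst (\<zeta> s)) (snd (\<zeta> s)) a)"
    using i unfolding flow_line_eq[OF assms(1,3)] by (simp_all add: o_def field_def)
qed

text \<open>The slow variable moves with speed at most \<open>\<epsilon> Q0\<close>; over a time of order \<open>1 / \<epsilon>\<close> it stays in a bounded set,
  and over a bounded time it hardly moves.\<close>

lemma trajectory_slow_drift:
  assumes "control A \<alpha>" "trajectory f g \<epsilon> \<alpha> x y \<xi> \<eta>" "0 \<le> s" "0 \<le> \<epsilon>"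
  shows "norm (\<xi> s - x) \<le> \<epsilon> * Q0 * s"
proof -
  have i: "(\<lambda>s. f (\<xi> s) (\<eta> s) (\<alpha> s)) integrable_on {0..s}"
    using assms unfolding trajectory_def by (meson set_lebesgue_integral_eq_integral(1))
  then have "norm (integral {0..s} (\<lambda>s. \<epsilon> *\<^sub>R f (\<xi> s) (\<eta> s) (\<alpha> s))) \<le> integral {0..s} (\<lambda>_. \<epsilon> * Q0)"
    using assms by (intro integral_norm_bound_integral integrable_cmul)
      (auto simp: control_def intro!: mult_left_mono f_bounded)
  also have "\<dots> = \<epsilon> * Q0 * s" using assms(3) by simp
  finally show ?thesis using assms(2,3) by (simp add: trajectory_def)
qed

lemma trajectory_continuous:
  assumes "trajectory f g \<epsilon> \<alpha> x y \<xi> \<eta>"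
  shows "continuous_on {0..T} \<xi>" "continuous_on {0..T} \<eta>"
proof -
  have i': "(\<lambda>s. f (\<xi> s) (\<eta> s) (\<alpha> s)) integrable_on {0..T}" if "0 \<le> T"
    using assms that unfolding trajectory_def by (meson set_lebesgue_integral_eq_integral(1))
  have i1: "(\<lambda>s. \<epsilon> *\<^sub>R f (\<xi> s) (\<eta> s) (\<alpha> s)) integrable_on {0..T}" if "0 \<le> T"
    by (rule integrable_cmul[OF i'[OF that]])
  have i2: "(\<lambda>s. g (\<xi> s) (\<eta> s) (\<alpha> s)) integrable_on {0..T}" if "0 \<le> T"
    using assms that unfolding trajectory_def by (meson set_lebesgue_integral_eq_integral(1))
  have x: "\<xi> t = x + integral {0..t} (\<lambda>s. \<epsilon> *\<^sub>R f (\<xi> s) (\<eta> s) (\<alpha> s))"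
    and y: "\<eta> t = y + integral {0..t} (\<lambda>s. g (\<xi> s) (\<eta> s) (\<alpha> s))" if "t \<in> {0..T}" for t
    using assms that by (auto simp: trajectory_def)
  show "continuous_on {0..T} \<xi>"
  proof (cases "0 \<le> T")
    case True
    show ?thesis
      by (rule continuous_on_cong[OF refl x, THEN iffD2], assumption)
        (intro continuous_intros indefinite_integral_continuous_1 i1 True)
  qed simp
  show "continuous_on {0..T} \<eta>"
  proof (cases "0 \<le> T")
    case True
    show ?thesis
      by (rule continuous_on_cong[OF refl y, THEN iffD2], assumption)
        (intro continuous_intros indefinite_integral_continuous_1 i2 True)
  qed simp
qed

lemma running_cost_absolutely_integrable:
  assumes "control A \<alpha>" "trajectory f g \<epsilon> \<alpha> x y \<xi> \<eta>"
  shows "(\<lambda>s. l (\<xi> s) (\<eta> s) (\<alpha> s)) absolutely_integrable_on {0..T}"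
proof -
  note c = trajectory_continuous[OF assms(2), of T]
  let ?M = "lebesgue_on {0..T}"
  have \<alpha>: "\<alpha> \<in> borel_measurable ?M"
    by (rule measurable_restrict_mono[of _ _ "{0..}"]) (use assms(1) in \<open>auto simp: control_def\<close>)
  have "\<xi> \<in> borel_measurable ?M" "\<eta> \<in> borel_measurable ?M"
    using c by (auto intro!: continuous_imp_measurable_on_sets_lebesgue)
  then have "(\<lambda>s. (\<xi> s, \<eta> s, \<alpha> s)) \<in> borel_measurable ?M"
    using \<alpha> by (intro borel_measurable_Pair)
  then have "(\<lambda>s. (\<xi> s, \<eta> s, \<alpha> s)) \<in> measurable ?M (restrict_space borel (UNIV \<times> UNIV \<times> A))"
    by (rule measurable_restrict_space2[rotated]) (use assms(1) in \<open>auto simp: control_def\<close>)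
  from measurable_compose[OF this borel_measurable_continuous_on_restrict[OF l_continuous]]
  have m: "(\<lambda>s. l (\<xi> s) (\<eta> s) (\<alpha> s)) \<in> borel_measurable ?M" by simp
  obtain \<kappa> where \<kappa>: "\<forall>x\<in>\<xi> ` {0..T}. \<forall>y\<in>\<eta> ` {0..T}. \<forall>a\<in>A. \<bar>l x y a\<bar> \<le> \<kappa>"
    using l_bounded_on_compact[OF compact_continuous_image[OF c(1)] compact_continuous_image[OF c(2)]] by auto
  show ?thesis
    by (rule measurable_bounded_by_integrable_imp_absolutely_integrable[where g = "\<lambda>_. \<kappa>", OF m])
      (use \<kappa> assms(1) in \<open>auto simp: control_def\<close>)
qed

section \<open>Value functions and dynamic programming\<close>

abbreviation V :: "real \<Rightarrow> (real^'n) \<times> (real^'m) \<Rightarrow> real \<Rightarrow> real" where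
  "V \<epsilon> z t \<equiv> value_fn f g l u0 A \<epsilon> (fst z) (snd z) t"

definition payoffs :: "real \<Rightarrow> (real^'n) \<times> (real^'m) \<Rightarrow> real \<Rightarrow> real set" where
  "payoffs \<epsilon> z t =
     {\<epsilon> * integral {0..t/\<epsilon>} (\<lambda>s. l (\<xi> s) (\<eta> s) (\<alpha> s)) + u0 (\<xi> (t/\<epsilon>)) (\<eta> (t/\<epsilon>)) | \<alpha> \<xi> \<eta>.
          control A \<alpha> \<and> trajectory f g \<epsilon> \<alpha> (fst z) (snd z) \<xi> \<eta>}"

lemma value_eq_Inf_payoffs: "V \<epsilon> z t = Inf (payoffs \<epsilon> z t)"
  by (simp add: value_fn_def payoffs_def)

lemma payoffs_lower_bound:
  assumes "\<forall>x\<in>cball (fst z) (Q0 * t). \<forall>y. \<forall>a\<in>A. - \<kappa> \<le> l x y a" "0 < \<epsilon>" "0 \<le> t" "v \<in> payoffs \<epsilon> z t"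
  shows "- \<kappa> * t - Q0 \<le> v"
proof -
  obtain \<alpha> \<xi> \<eta> where v: "v = \<epsilon> * integral {0..t/\<epsilon>} (\<lambda>s. l (\<xi> s) (\<eta> s) (\<alpha> s)) + u0 (\<xi> (t/\<epsilon>)) (\<eta> (t/\<epsilon>))"
    and c: "control A \<alpha>" and tr: "trajectory f g \<epsilon> \<alpha> (fst z) (snd z) \<xi> \<eta>"
    using assms(4) unfolding payoffs_def by blast
  have "integral {0..t/\<epsilon>} (\<lambda>_. - \<kappa>) \<le> integral {0..t/\<epsilon>} (\<lambda>s. l (\<xi> s) (\<eta> s) (\<alpha> s))"
  proof (rule integral_le)
    show "(\<lambda>s. l (\<xi> s) (\<eta> s) (\<alpha> s)) integrable_on {0..t/\<epsilon>}"
      using running_cost_absolutely_integrable[OF c tr] by (simp add: absolutely_integrable_on_def)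
    fix s assume s: "s \<in> {0..t/\<epsilon>}"
    then have "\<epsilon> * s \<le> t" using assms(2) by (simp add: field_simps)
    then have "\<epsilon> * Q0 * s \<le> Q0 * t"
      using mult_left_mono[OF _ Q0_nonneg, of "\<epsilon> * s" t] by (simp add: mult.commute mult.left_commute)
    then have "\<xi> s \<in> cball (fst z) (Q0 * t)"
      using trajectory_slow_drift[OF c tr, of s] s assms(2) by (auto simp: dist_norm norm_minus_commute)
    then show "- \<kappa> \<le> l (\<xi> s) (\<eta> s) (\<alpha> s)" using assms(1) c s by (auto simp: control_def)
  qed auto
  then have "\<epsilon> * (t / \<epsilon> * (- \<kappa>)) \<le> \<epsilon> * integral {0..t/\<epsilon>} (\<lambda>s. l (\<xi> s) (\<eta> s) (\<alpha> s))"
    using assms by (intro mult_left_mono) auto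
  then show ?thesis using v u0_bounded_below[of "\<xi> (t/\<epsilon>)" "\<eta> (t/\<epsilon>)"] assms(2) by (simp add: mult.commute)
qed

lemma payoffs_bdd_below:
  assumes "0 < \<epsilon>" "0 \<le> t" shows "bdd_below (payoffs \<epsilon> z t)"
proof -
  obtain \<kappa> where "\<forall>x\<in>cball (fst z) (Q0 * t). \<forall>y. \<forall>a\<in>A. - \<kappa> \<le> l x y a"
    using l_bounded_below[OF compact_cball] by blast
  from payoffs_lower_bound[OF this assms] show ?thesis by (intro bdd_belowI) auto
qed

lemma flow_line_trajectory:
  assumes "flow_line \<epsilon> a z \<zeta>" "a \<in> A"
  shows "trajectory f g \<epsilon> (\<lambda>_. a) (fst z) (snd z) (\<lambda>t. fst (\<zeta> t)) (\<lambda>t. snd (\<zeta> t))"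
  using assms flow_line_components[OF assms] unfolding trajectory_def
  by (auto intro!: absolutely_integrable_continuous_real flow_line_continuous_compose[OF assms(1)]
      continuous_on_f continuous_on_g)

text \<open>Constant controls have trajectories, so the infimum is taken over a nonempty set and is not a default
  value.\<close>

lemma payoffs_nonempty:
  assumes "0 < \<epsilon>" "\<epsilon> \<le> 1" shows "payoffs \<epsilon> z t \<noteq> {}"
proof -
  obtain a where a: "a \<in> A" using A_nonempty by blast
  then obtain \<zeta> where "flow_line \<epsilon> a z \<zeta>" using flow_line_exists assms by (metis less_imp_le)
  moreover have "control A (\<lambda>_. a)" using a by (auto simp: control_def)
  ultimately show ?thesis using flow_line_trajectory[OF _ a] unfolding payoffs_def by blast
qed

lemma value_lower_bound:
  assumes "\<forall>x\<in>cball (fst z) (Q0 * t). \<forall>y. \<forall>a\<in>A. - \<kappa> \<le> l x y a" "0 < \<epsilon>" "\<epsilon> \<le> 1" "0 \<le> t"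
  shows "- \<kappa> * t - Q0 \<le> V \<epsilon> z t"
  unfolding value_eq_Inf_payoffs
  using assms by (intro cInf_greatest payoffs_nonempty payoffs_lower_bound)

lemma value_terminal:
  assumes "0 < \<epsilon>" "\<epsilon> \<le> 1" shows "V \<epsilon> z 0 \<le> u0 (fst z) (snd z)"
proof -
  have "u0 (fst z) (snd z) \<in> payoffs \<epsilon> z 0"
  proof -
    obtain v where v: "v \<in> payoffs \<epsilon> z 0" using payoffs_nonempty[OF assms] by blast
    then have "v = u0 (fst z) (snd z)" by (auto simp: payoffs_def trajectory_def)
    with v show ?thesis by simp
  qed
  then show ?thesis unfolding value_eq_Inf_payoffs using assms by (intro cInf_lower payoffs_bdd_below) auto
qed

lemma trajectory_switch_at:
  assumes "a \<in> A" "flow_line \<epsilon> a z \<zeta>" "0 \<le> s" "control A \<alpha>"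
    and tr: "trajectory f g \<epsilon> \<alpha> (fst (\<zeta> s)) (snd (\<zeta> s)) \<xi> \<eta>"
  shows "trajectory f g \<epsilon> (switch_at s (\<lambda>_. a) \<alpha>) (fst z) (snd z)
      (switch_at s (\<lambda>t. fst (\<zeta> t)) \<xi>) (switch_at s (\<lambda>t. snd (\<zeta> t)) \<eta>)"
proof -
  let ?\<zeta>1 = "\<lambda>t. fst (\<zeta> t)" and ?\<zeta>2 = "\<lambda>t. snd (\<zeta> t)"
  have sw: "h (switch_at s ?\<zeta>1 \<xi> t) (switch_at s ?\<zeta>2 \<eta> t) (switch_at s (\<lambda>_. a) \<alpha> t)
      = switch_at s (\<lambda>t. h (?\<zeta>1 t) (?\<zeta>2 t) a) (\<lambda>t. h (\<xi> t) (\<eta> t) (\<alpha> t)) t"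
    for h :: "real^'n \<Rightarrow> real^'m \<Rightarrow> 'k \<Rightarrow> 'c" and t
    by (simp add: switch_at_def)
  have tr1: "trajectory f g \<epsilon> (\<lambda>_. a) (fst z) (snd z) ?\<zeta>1 ?\<zeta>2" by (rule flow_line_trajectory) fact+
  have i1: "(\<lambda>t. f (?\<zeta>1 t) (?\<zeta>2 t) a) absolutely_integrable_on {0..T}"
      "(\<lambda>t. g (?\<zeta>1 t) (?\<zeta>2 t) a) absolutely_integrable_on {0..T}"
      "(\<lambda>t. \<epsilon> *\<^sub>R f (?\<zeta>1 t) (?\<zeta>2 t) a) absolutely_integrable_on {0..T}" if "T \<ge> 0" for T
    using tr1 that by (auto simp: trajectory_def)
  have i2: "(\<lambda>t. f (\<xi> t) (\<eta> t) (\<alpha> t)) absolutely_integrable_on {0..T}"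
      "(\<lambda>t. g (\<xi> t) (\<eta> t) (\<alpha> t)) absolutely_integrable_on {0..T}"
      "(\<lambda>t. \<epsilon> *\<^sub>R f (\<xi> t) (\<eta> t) (\<alpha> t)) absolutely_integrable_on {0..T}" if "T \<ge> 0" for T
    using tr that by (auto simp: trajectory_def)
  show ?thesis
    unfolding trajectory_def
  proof (intro allI impI)
    fix T :: real assume T: "0 \<le> T"
    show "(\<lambda>t. f (switch_at s ?\<zeta>1 \<xi> t) (switch_at s ?\<zeta>2 \<eta> t) (switch_at s (\<lambda>_. a) \<alpha> t)) absolutely_integrable_on {0..T} \<and>
      (\<lambda>t. g (switch_at s ?\<zeta>1 \<xi> t) (switch_at s ?\<zeta>2 \<eta> t) (switch_at s (\<lambda>_. a) \<alpha> t)) absolutely_integrable_on {0..T} \<and>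
      switch_at s ?\<zeta>1 \<xi> T = fst z + integral {0..T} (\<lambda>t. \<epsilon> *\<^sub>R f (switch_at s ?\<zeta>1 \<xi> t) (switch_at s ?\<zeta>2 \<eta> t) (switch_at s (\<lambda>_. a) \<alpha> t)) \<and>
      switch_at s ?\<zeta>2 \<eta> T = snd z + integral {0..T} (\<lambda>t. g (switch_at s ?\<zeta>1 \<xi> t) (switch_at s ?\<zeta>2 \<eta> t) (switch_at s (\<lambda>_. a) \<alpha> t))"
    proof (cases "T < s")
      case True
      then show ?thesis
        unfolding sw[of f] sw[of g] sw[of "\<lambda>x y a. \<epsilon> *\<^sub>R f x y a"]
        using T tr1 by (simp add: switch_at_before) (simp add: switch_at_def trajectory_def)
    next
      case False
      then have "0 \<le> T - s" "s \<le> T" by auto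
      then show ?thesis
        unfolding sw[of f] sw[of g] sw[of "\<lambda>x y a. \<epsilon> *\<^sub>R f x y a"]
        using T tr1 tr \<open>0 \<le> s\<close> i1 i2
        by (simp add: switch_at_absolutely_integrable)
          (simp add: switch_at_def trajectory_def scaleR_add_right)
    qed
  qed
qed

text \<open>The easy half of the dynamic programming principle for one constant piece: put the piece in front of
  any control that competes for the value at the end of the piece.\<close>

lemma value_dynamic_programming_flow_line:
  assumes "0 < \<epsilon>" "\<epsilon> \<le> 1" and a: "a \<in> A" and arc: "flow_line \<epsilon> a z \<zeta>" and s: "0 \<le> s" "\<epsilon> * s \<le> t"
  shows "V \<epsilon> z t \<le> \<epsilon> * integral {0..s} (\<lambda>s. cost a (\<zeta> s)) + V \<epsilon> (\<zeta> s) (t - \<epsilon> * s)"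
proof -
  let ?I = "integral {0..s} (\<lambda>s. cost a (\<zeta> s))"
  have t: "0 \<le> t" using s assms(1) by (meson mult_nonneg_nonneg less_imp_le order_trans)
  have "V \<epsilon> z t - \<epsilon> * ?I \<le> v" if v: "v \<in> payoffs \<epsilon> (\<zeta> s) (t - \<epsilon> * s)" for v
  proof -
    let ?T = "t / \<epsilon>"
    have T: "(t - \<epsilon> * s) / \<epsilon> = ?T - s" "s \<le> ?T" using assms(1) s by (auto simp: field_simps)
    obtain \<alpha> \<xi> \<eta> where v: "v = \<epsilon> * integral {0..?T - s} (\<lambda>s. l (\<xi> s) (\<eta> s) (\<alpha> s)) + u0 (\<xi> (?T - s)) (\<eta> (?T - s))"
      and c: "control A \<alpha>" and tr: "trajectory f g \<epsilon> \<alpha> (fst (\<zeta> s)) (snd (\<zeta> s)) \<xi> \<eta>"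
      using v unfolding payoffs_def T(1) by blast
    let ?\<alpha> = "switch_at s (\<lambda>_. a) \<alpha>" and ?\<xi> = "switch_at s (\<lambda>t. fst (\<zeta> t)) \<xi>" and ?\<eta> = "switch_at s (\<lambda>t. snd (\<zeta> t)) \<eta>"
    have c': "control A ?\<alpha>" by (rule control_switch_at) fact+
    have tr': "trajectory f g \<epsilon> ?\<alpha> (fst z) (snd z) ?\<xi> ?\<eta>" by (rule trajectory_switch_at) fact+
    have "(\<lambda>t. l (?\<xi> t) (?\<eta> t) (?\<alpha> t)) = switch_at s (\<lambda>t. cost a (\<zeta> t)) (\<lambda>t. l (\<xi> t) (\<eta> t) (\<alpha> t))"
      by (auto simp: switch_at_def cost_def)
    moreover have "(\<lambda>t. cost a (\<zeta> t)) absolutely_integrable_on {0..s}"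
      by (intro absolutely_integrable_continuous_real flow_line_continuous_compose[OF arc] continuous_on_cost a)
    ultimately have "integral {0..?T} (\<lambda>t. l (?\<xi> t) (?\<eta> t) (?\<alpha> t)) = ?I + integral {0..?T - s} (\<lambda>t. l (\<xi> t) (\<eta> t) (\<alpha> t))"
      using running_cost_absolutely_integrable[OF c tr] s T(2) by (simp add: switch_at_absolutely_integrable)
    moreover have "?\<xi> ?T = \<xi> (?T - s)" "?\<eta> ?T = \<eta> (?T - s)" using T(2) by (auto simp: switch_at_def)
    ultimately have "\<epsilon> * ?I + v \<in> payoffs \<epsilon> z t"
      unfolding payoffs_def mem_Collect_eq
      by (intro exI[of _ ?\<alpha>] exI[of _ ?\<xi>] exI[of _ ?\<eta>] conjI c' tr') (simp add: v algebra_simps)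
    then show ?thesis
      unfolding value_eq_Inf_payoffs using cInf_lower[OF _ payoffs_bdd_below[OF assms(1) t]] by fastforce
  qed
  then have "V \<epsilon> z t - \<epsilon> * ?I \<le> V \<epsilon> (\<zeta> s) (t - \<epsilon> * s)"
    unfolding value_eq_Inf_payoffs[of \<epsilon> "\<zeta> s"] by (intro cInf_greatest payoffs_nonempty assms)
  then show ?thesis by simp
qed

text \<open>\<open>reach \<epsilon> z T C z'\<close> means that a piecewise constant control leads from \<open>z\<close> to \<open>z'\<close> in time \<open>T\<close> with
  accumulated running cost \<open>C\<close>. Time is that of the fast dynamics, so the slow time spent is \<open>\<epsilon> T\<close>, and
  \<open>\<epsilon> C\<close> is the contribution to the payoff.\<close>

inductive reach :: "real \<Rightarrow> (real^'n) \<times> (real^'m) \<Rightarrow> real \<Rightarrow> real \<Rightarrow> (real^'n) \<times> (real^'m) \<Rightarrow> bool"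
  for \<epsilon> where
  reach_refl: "reach \<epsilon> z 0 0 z"
| reach_flow_line: "a \<in> A \<Longrightarrow> flow_line \<epsilon> a z \<zeta> \<Longrightarrow> 0 \<le> s \<Longrightarrow> reach \<epsilon> (\<zeta> s) T C z' \<Longrightarrow>
    reach \<epsilon> z (s + T) (integral {0..s} (\<lambda>t. cost a (\<zeta> t)) + C) z'"

lemma reach_single:
  "a \<in> A \<Longrightarrow> flow_line \<epsilon> a z \<zeta> \<Longrightarrow> 0 \<le> s \<Longrightarrow> reach \<epsilon> z s (integral {0..s} (\<lambda>t. cost a (\<zeta> t))) (\<zeta> s)"
  using reach_flow_line[OF _ _ _ reach_refl] by fastforce

lemma reach_trans:
  assumes "reach \<epsilon> z T C z'" "reach \<epsilon> z' T' C' z''"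
  shows "reach \<epsilon> z (T + T') (C + C') z''"
  using assms by (induction) (auto simp: add.assoc intro: reach.intros)

lemma reach_time_nonneg: "reach \<epsilon> z T C z' \<Longrightarrow> 0 \<le> T"
  by (induction rule: reach.induct) auto

lemma flow_line_slow_drift:
  assumes "flow_line \<epsilon> a z \<zeta>" "a \<in> A" "0 \<le> s" "0 \<le> \<epsilon>"
  shows "norm (fst (\<zeta> s) - fst z) \<le> \<epsilon> * Q0 * s"
  using trajectory_slow_drift[OF _ flow_line_trajectory[OF assms(1,2)] assms(3,4)] assms(2)
  by (auto simp: control_def)

lemma reach_slow_drift:
  assumes "reach \<epsilon> z T C z'" "0 \<le> \<epsilon>"
  shows "norm (fst z' - fst z) \<le> \<epsilon> * Q0 * T"
  using assms
proof (induction rule: reach.induct)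
  case (reach_flow_line a z \<zeta> s T C z')
  then have "norm (fst z' - fst (\<zeta> s)) \<le> \<epsilon> * Q0 * T" by simp
  moreover have "norm (fst (\<zeta> s) - fst z) \<le> \<epsilon> * Q0 * s"
    using flow_line_slow_drift reach_flow_line by blast
  ultimately show ?case
    using norm_triangle_ineq[of "fst z' - fst (\<zeta> s)" "fst (\<zeta> s) - fst z"] by (simp add: algebra_simps)
qed simp

lemma value_dynamic_programming:
  assumes "reach \<epsilon> z T C z'" "0 < \<epsilon>" "\<epsilon> \<le> 1" "\<epsilon> * T \<le> t"
  shows "V \<epsilon> z t \<le> \<epsilon> * C + V \<epsilon> z' (t - \<epsilon> * T)"
  using assms
proof (induction arbitrary: t rule: reach.induct)
  case (reach_flow_line a z \<zeta> s T C z')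
  have T: "0 \<le> \<epsilon> * T" using reach_time_nonneg[OF reach_flow_line(4)] reach_flow_line.prems(1) by simp
  have "V \<epsilon> z t \<le> \<epsilon> * integral {0..s} (\<lambda>s. cost a (\<zeta> s)) + V \<epsilon> (\<zeta> s) (t - \<epsilon> * s)"
    by (rule value_dynamic_programming_flow_line) (use reach_flow_line T in \<open>auto simp: algebra_simps\<close>)
  moreover have "V \<epsilon> (\<zeta> s) (t - \<epsilon> * s) \<le> \<epsilon> * C + V \<epsilon> z' (t - \<epsilon> * s - \<epsilon> * T)"
    by (rule reach_flow_line.IH) (use reach_flow_line in \<open>auto simp: algebra_simps\<close>)
  ultimately show ?case by (simp add: algebra_simps)
qed simp

text \<open>A motion of very negative cost must take a long time. This will show that each run of a cycle of negative
  cost lasts for at least a fixed time, so that finitely many runs fill the time \<open>h / \<epsilon>\<close>.\<close>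

lemma reach_cost_lower_bound:
  assumes "reach \<epsilon> z T C z'" "0 \<le> \<epsilon>" "\<forall>x\<in>X. \<forall>y. \<forall>a\<in>A. - \<kappa> \<le> l x y a" "cball (fst z) (\<epsilon> * Q0 * T) \<subseteq> X"
  shows "- \<kappa> * T \<le> C"
  using assms
proof (induction rule: reach.induct)
  case (reach_flow_line a z \<zeta> s T C z')
  have T: "0 \<le> T" using reach_time_nonneg reach_flow_line by blast
  have e: "0 \<le> \<epsilon> * Q0" using reach_flow_line Q0_nonneg by simp
  have d: "norm (fst (\<zeta> t) - fst z) \<le> \<epsilon> * Q0 * t" if "0 \<le> t" for t
    using flow_line_slow_drift that reach_flow_line by blast
  have "cball (fst (\<zeta> s)) (\<epsilon> * Q0 * T) \<subseteq> cball (fst z) (\<epsilon> * Q0 * (s + T))"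
  proof
    fix x assume x: "x \<in> cball (fst (\<zeta> s)) (\<epsilon> * Q0 * T)"
    have "dist (fst z) x \<le> dist (fst z) (fst (\<zeta> s)) + dist (fst (\<zeta> s)) x" by (rule dist_triangle)
    also have "\<dots> \<le> \<epsilon> * Q0 * s + \<epsilon> * Q0 * T"
      using d[OF reach_flow_line(3)] x by (intro add_mono) (auto simp: dist_norm norm_minus_commute)
    finally show "x \<in> cball (fst z) (\<epsilon> * Q0 * (s + T))" by (simp add: algebra_simps)
  qed
  then have "- \<kappa> * T \<le> C" using reach_flow_line by blast
  moreover have "integral {0..s} (\<lambda>_. - \<kappa>) \<le> integral {0..s} (\<lambda>t. cost a (\<zeta> t))"
  proof (rule integral_le)
    show "(\<lambda>t. cost a (\<zeta> t)) integrable_on {0..s}"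
      by (rule integrable_continuous_real, rule flow_line_continuous_compose[OF reach_flow_line(2)])
        (rule continuous_on_cost[OF reach_flow_line(1)])
    fix t assume t: "t \<in> {0..s}"
    then have "\<epsilon> * Q0 * t \<le> \<epsilon> * Q0 * (s + T)" using e T by (intro mult_left_mono) auto
    then have "fst (\<zeta> t) \<in> X" using d[of t] t reach_flow_line.prems(3) by (auto simp: dist_norm norm_minus_commute subset_iff)
    then show "- \<kappa> \<le> cost a (\<zeta> t)" using reach_flow_line by (auto simp: cost_def)
  qed auto
  ultimately show ?case using reach_flow_line(3) by (simp add: algebra_simps)
qed simp

section \<open>Steering the fast variable\<close>

text \<open>By controllability every direction can be countered by some control, and the inequality persists for
  nearby states and directions. Compactness leaves finitely many controls, whose velocities are bounded on
  \<open>K\<close> even if \<open>g\<close> is unbounded over all of \<open>A\<close>.\<close>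

lemma uniformly_pushing_controls:
  assumes "compact K"
  shows "\<exists>r>0. \<exists>G. \<forall>z\<in>K. \<forall>e. norm e = 1 \<longrightarrow>
      (\<exists>a\<in>A. e \<bullet> g (fst z) (snd z) a \<le> - r \<and> norm (g (fst z) (snd z) a) \<le> G)"
proof -
  obtain r where r: "r > 0" "\<forall>(x, y)\<in>K. ball 0 r \<subseteq> closure (convex hull (g x y ` A))"
    using controllability[OF assms] by blast
  define U where "U a = {(z, e). e \<bullet> g (fst z) (snd z) a < - r / 2}" for a
  have "open (U a)" if "a \<in> A" for a
  proof -
    have "continuous_on UNIV (\<lambda>w. snd w \<bullet> g (fst (fst w)) (snd (fst w)) a)"
      by (intro continuous_intros continuous_on_compose2[OF continuous_on_g[OF that, of UNIV], of _ fst, simplified])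
    from open_Collect_less[OF this continuous_on_const]
    show ?thesis by (simp add: U_def case_prod_unfold)
  qed
  moreover have "compact (K \<times> sphere (0::real^'m) 1)" using assms by (intro compact_Times compact_sphere)
  moreover have "K \<times> sphere 0 1 \<subseteq> (\<Union>a\<in>A. U a)"
  proof
    fix w assume "w \<in> K \<times> sphere (0::real^'m) 1"
    then obtain x y e where w: "w = ((x, y), e)" "(x, y) \<in> K" "norm e = 1" by force
    then have "ball 0 r \<subseteq> closure (convex hull (g x y ` A))" using r by auto
    from halfspace_meets_of_ball_subset_hull[OF r(1) this w(3)] w(1)
    show "w \<in> (\<Union>a\<in>A. U a)" by (auto simp: U_def)
  qed
  ultimately obtain F where F: "F \<subseteq> A" "finite F" "K \<times> sphere 0 1 \<subseteq> (\<Union>a\<in>F. U a)"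
    using compactE_image[of "K \<times> sphere 0 1" A U] by metis
  have "bounded (\<Union>a\<in>F. (\<lambda>z. g (fst z) (snd z) a) ` K)"
    using F assms by (intro bounded_UN compact_imp_bounded compact_continuous_image continuous_on_g ballI) auto
  then obtain G where G: "\<And>v. v \<in> (\<Union>a\<in>F. (\<lambda>z. g (fst z) (snd z) a) ` K) \<Longrightarrow> norm v \<le> G"
    unfolding bounded_iff by blast
  show ?thesis
  proof (rule exI[of _ "r / 2"], rule conjI, use r in simp, rule exI[of _ G], intro ballI allI impI)
    fix z and e :: "real^'m" assume z: "z \<in> K" "norm e = 1"
    then have "(z, e) \<in> K \<times> sphere 0 1" by simp
    then have "(z, e) \<in> (\<Union>a\<in>F. U a)" using F(3) by blast
    then obtain a where "a \<in> F" "e \<bullet> g (fst z) (snd z) a < - r / 2" by (auto simp: U_def)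
    then show "\<exists>a\<in>A. e \<bullet> g (fst z) (snd z) a \<le> - (r / 2) \<and> norm (g (fst z) (snd z) a) \<le> G"
      using F(1) z(1) G by (intro bexI[of _ a]) auto
  qed
qed

lemma flow_line_displacement:
  assumes arc: "flow_line \<epsilon> a z \<zeta>" and a: "a \<in> A" and \<epsilon>: "0 \<le> \<epsilon>" "\<epsilon> \<le> 1" and s: "s * (4 * L0) \<le> 1 / 2" "t \<in> {0..s}"
  shows "norm (\<zeta> t - z) \<le> 2 * s * norm (field \<epsilon> a z)"
proof -
  have "norm (\<zeta> t - z) \<le> 2 * (norm (0::(real^'n) \<times> (real^'m)) + s * norm (field \<epsilon> a z))"
  proof (rule short_time_gronwall[where v = "\<lambda>t. field \<epsilon> a (\<zeta> t)" and L = "4 * L0" and s = s])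
    show "\<zeta> t - z = 0 + integral {0..t} (\<lambda>t. field \<epsilon> a (\<zeta> t))" if "t \<in> {0..s}" for t
      using flow_line_eq[OF arc, of t] that by simp
    show "continuous_on {0..s} (\<lambda>t. field \<epsilon> a (\<zeta> t))"
      by (rule flow_line_continuous_compose[OF arc continuous_on_field[OF a]])
    show "norm (field \<epsilon> a (\<zeta> t)) \<le> 4 * L0 * norm (\<zeta> t - z) + norm (field \<epsilon> a z)" for t
      using field_lipschitz[OF a \<epsilon>, of "\<zeta> t" z] norm_triangle_sub[of "field \<epsilon> a (\<zeta> t)" "field \<epsilon> a z"] by simp
  qed (use s L0_pos in auto)
  then show ?thesis by simp
qed

lemma flow_line_first_order:
  assumes \<zeta>: "flow_line \<epsilon> a z \<zeta>" and a: "a \<in> A" and "0 \<le> \<epsilon>" "\<epsilon> \<le> 1" and s: "0 \<le> s" "s * (4 * L0) \<le> 1 / 2"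
    and B: "norm (field \<epsilon> a z) \<le> B"
  shows "norm (snd (\<zeta> s) - snd z - s *\<^sub>R g (fst z) (snd z) a) \<le> s * (4 * L0 * B) * s"
proof -
  have cg: "continuous_on {0..s} (\<lambda>t. g (fst (\<zeta> t)) (snd (\<zeta> t)) a)"
    by (rule flow_line_continuous_compose[OF \<zeta> continuous_on_g[OF a]])
  then have "snd (\<zeta> s) - snd z - s *\<^sub>R g (fst z) (snd z) a
      = integral {0..s} (\<lambda>t. g (fst (\<zeta> t)) (snd (\<zeta> t)) a - g (fst z) (snd z) a)"
    using flow_line_components(2)[OF \<zeta> a, of s] s by (subst integral_diff) (auto intro: integrable_continuous_real)
  also have "norm \<dots> \<le> (2 * L0 * (2 * s * B)) * (s - 0)"
  proof (rule integral_bound)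
    fix t assume "t \<in> {0..s}"
    then have "norm (\<zeta> t - z) \<le> 2 * s * norm (field \<epsilon> a z)" using flow_line_displacement[OF \<zeta> a assms(3,4) s(2)] by blast
    also have "\<dots> \<le> 2 * s * B" using B s by (intro mult_left_mono) auto
    finally show "norm (g (fst (\<zeta> t)) (snd (\<zeta> t)) a - g (fst z) (snd z) a) \<le> 2 * L0 * (2 * s * B)"
      using g_lipschitz_pair[OF a, of "\<zeta> t" z] mult_left_mono[of "norm (\<zeta> t - z)" "2 * s * B" "2 * L0"] L0_pos by linarith
  qed (use s in \<open>auto intro!: continuous_intros cg\<close>)
  also have "\<dots> = s * (4 * L0 * B) * s" by simp
  finally show ?thesis .
qed

text \<open>The vector fields of the true and of the frozen system differ by at most \<open>\<epsilon> Q0\<close>.\<close>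

lemma flow_line_close_to_frozen_flow_line:
  assumes arc: "flow_line \<epsilon> a z \<zeta>" and arc0: "flow_line 0 a z0 \<zeta>0" and a: "a \<in> A" and \<epsilon>: "0 \<le> \<epsilon>" "\<epsilon> \<le> 1"
    and s: "s * (4 * L0) \<le> 1 / 2" "t \<in> {0..s}"
  shows "norm (\<zeta> t - \<zeta>0 t) \<le> 2 * (norm (z - z0) + s * (\<epsilon> * Q0))"
proof (rule short_time_gronwall[where v = "\<lambda>t. field \<epsilon> a (\<zeta> t) - field 0 a (\<zeta>0 t)" and L = "4 * L0"])
  have c: "continuous_on {0..t} (\<lambda>t. field \<epsilon> a (\<zeta> t))" "continuous_on {0..t} (\<lambda>t. field 0 a (\<zeta>0 t))" for t
    by (rule flow_line_continuous_compose[OF arc continuous_on_field[OF a]]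
        flow_line_continuous_compose[OF arc0 continuous_on_field[OF a]])+
  show "\<zeta> t - \<zeta>0 t = z - z0 + integral {0..t} (\<lambda>t. field \<epsilon> a (\<zeta> t) - field 0 a (\<zeta>0 t))" if "t \<in> {0..s}" for t
    using flow_line_eq[OF arc, of t] flow_line_eq[OF arc0, of t] that
    by (subst integral_diff) (auto intro!: integrable_continuous_real c)
  show "continuous_on {0..s} (\<lambda>t. field \<epsilon> a (\<zeta> t) - field 0 a (\<zeta>0 t))"
    by (intro continuous_intros c)
  show "norm (field \<epsilon> a (\<zeta> t) - field 0 a (\<zeta>0 t)) \<le> 4 * L0 * norm (\<zeta> t - \<zeta>0 t) + \<epsilon> * Q0" for t
  proof -
    have "norm (field \<epsilon> a (\<zeta>0 t) - field 0 a (\<zeta>0 t)) \<le> \<epsilon> * Q0"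
      using \<epsilon> f_bounded[OF a] by (simp add: field_def norm_Pair mult_left_mono)
    then show ?thesis
      using field_lipschitz[OF a \<epsilon>, of "\<zeta> t" "\<zeta>0 t"]
        norm_triangle_ineq[of "field \<epsilon> a (\<zeta> t) - field \<epsilon> a (\<zeta>0 t)" "field \<epsilon> a (\<zeta>0 t) - field 0 a (\<zeta>0 t)"] by simp
  qed
qed (use s L0_pos \<epsilon> Q0_nonneg in auto)

text \<open>Choose a constant control that pushes the fast variable towards \<open>y0\<close>. As long as the distance
  \<open>d\<close> to \<open>y0\<close> is large compared with \<open>s\<close>, the new distance is \<open>d\<close> minus a fixed multiple of \<open>s\<close>, up to
  terms of order \<open>s\<^sup>2\<close>. If \<open>d\<close> is of order \<open>s\<close> already, it remains so because the velocity is bounded. The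
  maximum in the conclusion covers both cases.\<close>

lemma greedy_step:
  shows "\<exists>r>0. \<exists>\<kappa>\<ge>0. \<exists>m\<ge>0. \<exists>c>0. \<forall>\<epsilon> z s. 0 < \<epsilon> \<longrightarrow> \<epsilon> \<le> 1 \<longrightarrow> norm (fst z - x0) \<le> X \<longrightarrow> norm (snd z - y0) \<le> Y \<longrightarrow>
      0 < s \<longrightarrow> s \<le> c \<longrightarrow>
      (\<exists>C z'. reach \<epsilon> z s C z' \<and> C \<le> \<kappa> * s \<and> norm (snd z' - y0) \<le> max (m * s) (norm (snd z - y0) - r * s))"
proof -
  let ?K = "cball x0 X \<times> cball y0 Y"
  obtain r G where r: "r > 0" and push: "\<And>z e. z \<in> ?K \<Longrightarrow> norm e = 1 \<Longrightarrow>
      \<exists>a\<in>A. e \<bullet> g (fst z) (snd z) a \<le> - r \<and> norm (g (fst z) (snd z) a) \<le> G"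
    using uniformly_pushing_controls[OF compact_Times[OF compact_cball compact_cball], of x0 X y0 Y] by blast
  obtain \<kappa> where \<kappa>: "\<kappa> \<ge> 0" "\<forall>x\<in>cball x0 (X + 1). \<forall>y\<in>cball y0 (Y + 1). \<forall>a\<in>A. \<bar>l x y a\<bar> \<le> \<kappa>"
    using l_bounded_on_compact[OF compact_cball compact_cball] by blast
  \<comment> \<open>\<open>B\<close> bounds the speed of the chosen flow lines, \<open>m'\<close> separates the regimes \<open>d \<ge> m' s\<close> and \<open>d < m' s\<close>,
     and \<open>c\<close> makes the second-order errors smaller than a quarter of the first-order gain\<close>
  define B where "B = Q0 + \<bar>G\<bar>"
  have B: "B \<ge> 0" using Q0_nonneg by (simp add: B_def)
  define m' where "m' = (G\<^sup>2 + r\<^sup>2) / r"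
  have m': "m' > 0" using r by (auto simp: m'_def intro!: divide_pos_pos add_nonneg_pos)
  define c where "c = min (1 / (8 * L0)) (min (1 / (2 * B + 1)) (r / (16 * L0 * B + 1)))"
  have c: "c > 0" using B L0_pos r by (auto simp: c_def intro!: divide_pos_pos add_nonneg_pos)
  have main: "\<exists>C z'. reach \<epsilon> z s C z' \<and> C \<le> \<kappa> * s \<and> norm (snd z' - y0) \<le> max ((m' + 2 * B) * s) (norm (snd z - y0) - r / 4 * s)"
    if \<epsilon>: "0 < \<epsilon>" "\<epsilon> \<le> 1" and zK: "norm (fst z - x0) \<le> X" "norm (snd z - y0) \<le> Y" and s: "0 < s" "s \<le> c" for \<epsilon> z s
  proof -
    let ?d = "norm (snd z - y0)"
    have z: "z \<in> ?K" using zK by (cases z) (auto simp: dist_norm norm_minus_commute)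
    have sL: "s * (4 * L0) \<le> 1 / 2"
      using s L0_pos by (auto simp: c_def field_simps)
    have "s * (2 * B + 1) \<le> 1" using s B by (auto simp: c_def field_simps)
    then have sB: "2 * s * B \<le> 1" using s by (simp add: algebra_simps)
    have "s * (16 * L0 * B + 1) \<le> r"
      using s B L0_pos by (auto simp: c_def pos_le_divide_eq add_nonneg_pos)
    then have sr: "s * (4 * L0 * B) \<le> r / 4" using s by (simp add: algebra_simps)
    have arcs: "\<exists>\<zeta>. flow_line \<epsilon> a z \<zeta> \<and> reach \<epsilon> z s (integral {0..s} (\<lambda>t. cost a (\<zeta> t))) (\<zeta> s) \<and>
        integral {0..s} (\<lambda>t. cost a (\<zeta> t)) \<le> \<kappa> * s \<and> norm (\<zeta> s - z) \<le> 2 * s * B \<and>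
        norm (snd (\<zeta> s) - snd z - s *\<^sub>R g (fst z) (snd z) a) \<le> r / 4 * s"
      if a: "a \<in> A" "norm (g (fst z) (snd z) a) \<le> G" for a
    proof -
      obtain \<zeta> where \<zeta>: "flow_line \<epsilon> a z \<zeta>" using flow_line_exists[OF a(1), of \<epsilon> z] \<epsilon> by auto
      have "norm (field \<epsilon> a z) \<le> \<epsilon> * norm (f (fst z) (snd z) a) + norm (g (fst z) (snd z) a)"
        unfolding field_def using norm_Pair_le[of "\<epsilon> *\<^sub>R f (fst z) (snd z) a"] \<epsilon> by simp
      also have "\<dots> \<le> 1 * Q0 + \<bar>G\<bar>"
        using \<epsilon> a f_bounded[OF a(1)] by (intro add_mono mult_mono) auto
      finally have fB: "norm (field \<epsilon> a z) \<le> B" by (simp add: B_def)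
      have disp: "norm (\<zeta> t - z) \<le> 2 * s * B" if "t \<in> {0..s}" for t
      proof -
        have "norm (\<zeta> t - z) \<le> 2 * s * norm (field \<epsilon> a z)"
          using flow_line_displacement[OF \<zeta> a(1) _ _ sL that] \<epsilon> by simp
        also have "\<dots> \<le> 2 * s * B" using fB s by (intro mult_left_mono) auto
        finally show ?thesis .
      qed
      have "integral {0..s} (\<lambda>t. cost a (\<zeta> t)) \<le> integral {0..s} (\<lambda>_. \<kappa>)"
      proof (rule integral_le)
        show "(\<lambda>t. cost a (\<zeta> t)) integrable_on {0..s}"
          by (rule integrable_continuous_real, rule flow_line_continuous_compose[OF \<zeta>])
            (rule continuous_on_cost[OF a(1)])
        fix t assume "t \<in> {0..s}"
        then have "norm (\<zeta> t - z) \<le> 1" using disp sB by fastforce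
        then have "norm (fst (\<zeta> t) - fst z) \<le> 1" "norm (snd (\<zeta> t) - snd z) \<le> 1"
          using norm_fst_le_norm[of "\<zeta> t - z"] norm_snd_le_norm[of "\<zeta> t - z"] by auto
        then have "norm (fst (\<zeta> t) - x0) \<le> X + 1" "norm (snd (\<zeta> t) - y0) \<le> Y + 1"
          using zK norm_triangle_ineq[of "fst (\<zeta> t) - fst z" "fst z - x0"]
            norm_triangle_ineq[of "snd (\<zeta> t) - snd z" "snd z - y0"] by simp_all
        then have "\<bar>l (fst (\<zeta> t)) (snd (\<zeta> t)) a\<bar> \<le> \<kappa>"
          using \<kappa>(2) a(1) by (auto simp: dist_norm norm_minus_commute)
        then show "cost a (\<zeta> t) \<le> \<kappa>" by (simp add: cost_def)
      qed auto
      moreover have "norm (snd (\<zeta> s) - snd z - s *\<^sub>R g (fst z) (snd z) a) \<le> r / 4 * s"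
      proof -
        have "norm (snd (\<zeta> s) - snd z - s *\<^sub>R g (fst z) (snd z) a) \<le> s * (4 * L0 * B) * s"
          by (rule flow_line_first_order[OF \<zeta> a(1) _ _ _ sL fB]) (use \<epsilon> s in auto)
        also have "\<dots> \<le> r / 4 * s" using sr s by (intro mult_right_mono) auto
        finally show ?thesis .
      qed
      ultimately show ?thesis
        using \<zeta> reach_single[OF a(1) \<zeta>, of s] disp[of s] s
        by (intro exI[of _ \<zeta>]) (simp only: atLeastAtMost_iff content_real_if integral_const_real, simp add: mult.commute)
    qed
    show ?thesis
    proof (cases "m' * s \<le> ?d")
      case False
      obtain e :: "real^'m" where "norm e = 1" using vector_choose_size[of 1] by auto
      then obtain a where "a \<in> A" "norm (g (fst z) (snd z) a) \<le> G" using push[OF z] by blast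
      from arcs[OF this] obtain \<zeta> where \<zeta>: "reach \<epsilon> z s (integral {0..s} (\<lambda>t. cost a (\<zeta> t))) (\<zeta> s)"
        "integral {0..s} (\<lambda>t. cost a (\<zeta> t)) \<le> \<kappa> * s" "norm (\<zeta> s - z) \<le> 2 * s * B" by blast
      have "norm (snd (\<zeta> s) - y0) \<le> 2 * s * B + ?d"
        using norm_triangle_ineq[of "snd (\<zeta> s) - snd z" "snd z - y0"] norm_snd_le_norm[of "\<zeta> s - z"] \<zeta>(3) by simp
      also have "\<dots> \<le> (m' + 2 * B) * s" using False by (simp add: algebra_simps)
      finally show ?thesis using \<zeta> by (intro exI[of _ "integral {0..s} (\<lambda>t. cost a (\<zeta> t))"] exI[of _ "\<zeta> s"]) auto
    next
      case True
      then have d: "?d > 0" using m' s by (meson less_le_trans mult_pos_pos)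
      define e where "e = (1 / ?d) *\<^sub>R (snd z - y0)"
      have e: "norm e = 1" "snd z - y0 = ?d *\<^sub>R e" using d by (auto simp: e_def)
      obtain a where a: "a \<in> A" "e \<bullet> g (fst z) (snd z) a \<le> - r" "norm (g (fst z) (snd z) a) \<le> G"
        using push[OF z e(1)] by blast
      let ?g = "g (fst z) (snd z) a"
      from arcs[OF a(1,3)] obtain \<zeta> where \<zeta>: "reach \<epsilon> z s (integral {0..s} (\<lambda>t. cost a (\<zeta> t))) (\<zeta> s)"
        "integral {0..s} (\<lambda>t. cost a (\<zeta> t)) \<le> \<kappa> * s" "norm (snd (\<zeta> s) - snd z - s *\<^sub>R ?g) \<le> r / 4 * s" by blast
      have dm: "(G\<^sup>2 + r\<^sup>2) * s \<le> r * ?d" using True r by (simp add: m'_def field_simps)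
      have "r\<^sup>2 * s \<le> r * ?d" using dm s by (simp add: distrib_right) (smt (verit) mult_nonneg_nonneg zero_le_power2)
      then have rs: "r * s \<le> ?d" using r by (simp add: power2_eq_square)
      have "(norm (snd z - y0 + s *\<^sub>R ?g))\<^sup>2 = ?d\<^sup>2 + 2 * s * ((snd z - y0) \<bullet> ?g) + s\<^sup>2 * (norm ?g)\<^sup>2"
        unfolding power2_norm_eq_inner by (simp add: inner_add_left inner_add_right inner_commute power2_eq_square algebra_simps)
      also have "(snd z - y0) \<bullet> ?g = ?d * (e \<bullet> ?g)" using e(2) by (metis inner_scaleR_left)
      also have "?d\<^sup>2 + 2 * s * (?d * (e \<bullet> ?g)) + s\<^sup>2 * (norm ?g)\<^sup>2 \<le> ?d\<^sup>2 + 2 * s * (?d * (- r)) + s\<^sup>2 * G\<^sup>2"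
        using a s d by (intro add_mono mult_left_mono power_mono) auto
      also have "\<dots> \<le> ?d\<^sup>2 + 2 * s * (?d * (- r)) + s * (r * ?d)"
      proof -
        have "G\<^sup>2 * s \<le> r * ?d" using dm s by (simp add: distrib_right) (smt (verit) mult_nonneg_nonneg zero_le_power2)
        then have "s * (G\<^sup>2 * s) \<le> s * (r * ?d)" using s by (intro mult_left_mono) auto
        then show ?thesis by (simp add: power2_eq_square algebra_simps)
      qed
      also have "\<dots> \<le> (?d - r / 2 * s)\<^sup>2"
        using zero_le_power2[of "r * s"] by (simp add: power2_eq_square algebra_simps)
      finally have "norm (snd z - y0 + s *\<^sub>R ?g) \<le> ?d - r / 2 * s"
        by (rule power2_le_imp_le) (use rs r s in \<open>simp add: field_simps\<close>, smt (verit) mult_pos_pos)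
      then have "norm (snd (\<zeta> s) - y0) \<le> ?d - r / 2 * s + r / 4 * s"
        using \<zeta>(3) norm_triangle_ineq[of "snd z - y0 + s *\<^sub>R ?g" "snd (\<zeta> s) - snd z - s *\<^sub>R ?g"] by simp
      then have "norm (snd (\<zeta> s) - y0) \<le> ?d - r / 4 * s" by simp
      then show ?thesis using \<zeta> by (intro exI[of _ "integral {0..s} (\<lambda>t. cost a (\<zeta> t))"] exI[of _ "\<zeta> s"]) auto
    qed
  qed
  show ?thesis
    by (rule exI[of _ "r / 4"], rule conjI, use r in simp, rule exI[of _ \<kappa>], rule conjI, use \<kappa> in simp,
        rule exI[of _ "m' + 2 * B"], rule conjI, use m' B in simp, rule exI[of _ c], rule conjI, use c in simp)
      (intro allI impI main)
qed

text \<open>Iterate the greedy step with a fixed small step size until the tolerance \<open>\<delta>\<close> is met. The time needed is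
  at most the initial distance divided by the uniform rate \<open>r\<close>, however small \<open>\<delta>\<close> is.\<close>

lemma steering:
  assumes "Y > 0"
  shows "\<exists>r>0. \<exists>\<kappa>\<ge>0. \<forall>\<epsilon> z \<delta>. 0 < \<epsilon> \<longrightarrow> \<epsilon> \<le> 1 \<longrightarrow> 0 < \<delta> \<longrightarrow> norm (snd z - y0) \<le> Y \<longrightarrow>
      norm (fst z - x0) + \<epsilon> * Q0 * (norm (snd z - y0) / r) \<le> X \<longrightarrow>
      (\<exists>T C z'. reach \<epsilon> z T C z' \<and> T \<le> norm (snd z - y0) / r \<and> C \<le> \<kappa> * T \<and> norm (snd z' - y0) \<le> \<delta>)"
proof -
  obtain r \<kappa> m c where r: "r > 0" and \<kappa>: "\<kappa> \<ge> 0" and m: "m \<ge> 0" and c: "c > 0" and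
    step: "\<And>\<epsilon> z s. 0 < \<epsilon> \<Longrightarrow> \<epsilon> \<le> 1 \<Longrightarrow> norm (fst z - x0) \<le> X \<Longrightarrow> norm (snd z - y0) \<le> Y \<Longrightarrow>
      0 < s \<Longrightarrow> s \<le> c \<Longrightarrow>
      \<exists>C z'. reach \<epsilon> z s C z' \<and> C \<le> \<kappa> * s \<and> norm (snd z' - y0) \<le> max (m * s) (norm (snd z - y0) - r * s)"
    using greedy_step[of x0 X y0 Y] by blast
  have main: "\<exists>T C z'. reach \<epsilon> z T C z' \<and> T \<le> norm (snd z - y0) / r \<and> C \<le> \<kappa> * T \<and> norm (snd z' - y0) \<le> \<delta>"
    if \<epsilon>: "0 < \<epsilon>" "\<epsilon> \<le> 1" and \<delta>: "0 < \<delta>" and y: "norm (snd z - y0) \<le> Y"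
      and x: "norm (fst z - x0) + \<epsilon> * Q0 * (norm (snd z - y0) / r) \<le> X" for \<epsilon> \<delta> z
  proof (cases "norm (snd z - y0) \<le> \<delta>")
    case True
    then show ?thesis using r by (intro exI[of _ 0] exI[of _ z]) (auto intro: reach_refl)
  next
    case False
    \<comment> \<open>the step is so small that the distance cannot leave \<open>[0, \<delta>]\<close>, and that rounding up the number of
       steps costs at most the last \<open>\<delta>\<close> of distance, which need not be covered\<close>
    define s where "s = min c (min (\<delta> / (m + 1)) (\<delta> / r))"
    have s: "s > 0" "s \<le> c" "m * s \<le> \<delta>" "s * r \<le> \<delta>"
    proof -
      show "s > 0" "s \<le> c" using c \<delta> m r by (auto simp: s_def)
      have "s \<le> \<delta> / (m + 1)" "s \<le> \<delta> / r" by (auto simp: s_def)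
      then show "m * s \<le> \<delta>" "s * r \<le> \<delta>" using m r \<open>s > 0\<close> by (auto simp: field_simps)
    qed
    have e: "\<epsilon> * Q0 \<ge> 0" using \<epsilon> Q0_nonneg by simp
    have iter: "\<exists>T C z'. reach \<epsilon> z T C z' \<and> T \<le> real n * s \<and> C \<le> \<kappa> * T \<and> norm (snd z' - y0) \<le> \<delta>"
      if "norm (snd z - y0) \<le> Y" "norm (snd z - y0) \<le> \<delta> + real n * (s * r)"
        "norm (fst z - x0) + \<epsilon> * Q0 * (real n * s) \<le> X" for n z
      using that
    proof (induction n arbitrary: z)
      case 0
      then show ?case by (intro exI[of _ 0] exI[of _ z]) (auto intro: reach_refl)
    next
      case (Suc n)
      show ?case
      proof (cases "norm (snd z - y0) \<le> \<delta>")
        case True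
        then show ?thesis using s by (intro exI[of _ 0] exI[of _ z]) (auto intro: reach_refl)
      next
        case False
        have "norm (fst z - x0) \<le> X"
          using Suc.prems(3) mult_nonneg_nonneg[OF e, of "real (Suc n) * s"] s by simp
        then obtain C z1 where z1: "reach \<epsilon> z s C z1" "C \<le> \<kappa> * s"
          "norm (snd z1 - y0) \<le> max (m * s) (norm (snd z - y0) - r * s)"
          using step[OF \<epsilon> _ Suc.prems(1) s(1,2)] by blast
        have "norm (fst z1 - fst z) \<le> \<epsilon> * Q0 * s" using reach_slow_drift[OF z1(1)] \<epsilon> by simp
        then have x1: "norm (fst z1 - x0) + \<epsilon> * Q0 * (real n * s) \<le> X"
          using Suc.prems(3) norm_triangle_ineq[of "fst z1 - fst z" "fst z - x0"] by (simp add: algebra_simps)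
        have y1: "norm (snd z1 - y0) \<le> Y"
          using z1(3) s False Suc.prems(1) mult_pos_pos[OF r s(1)] by (auto simp: max_def split: if_splits)
        have d1: "norm (snd z1 - y0) \<le> \<delta> + real n * (s * r)"
        proof -
          have "0 \<le> real n * (s * r)" using s r by simp
          moreover have "norm (snd z - y0) - r * s \<le> \<delta> + real n * (s * r)"
            using Suc.prems(2) by (simp add: algebra_simps)
          ultimately show ?thesis using z1(3) s(3) by (auto simp: max_def split: if_splits)
        qed
        from Suc.IH[OF y1 d1 x1] obtain T C' z' where
          "reach \<epsilon> z1 T C' z'" "T \<le> real n * s" "C' \<le> \<kappa> * T" "norm (snd z' - y0) \<le> \<delta>" by blast
        then show ?thesis using z1 reach_trans[OF z1(1)]
          by (intro exI[of _ "s + T"] exI[of _ "C + C'"] exI[of _ z']) (auto simp: algebra_simps)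
      qed
    qed
    define n where "n = nat \<lceil>(norm (snd z - y0) - \<delta>) / (s * r)\<rceil>"
    have sr: "s * r > 0" using s r by simp
    have "0 < (norm (snd z - y0) - \<delta>) / (s * r)" using False sr by simp
    then have n: "(norm (snd z - y0) - \<delta>) / (s * r) \<le> real n" "real n \<le> (norm (snd z - y0) - \<delta>) / (s * r) + 1"
      unfolding n_def by linarith+
    have n1: "norm (snd z - y0) \<le> \<delta> + real n * (s * r)" using n(1) sr by (simp add: field_simps)
    have "real n * (s * r) \<le> ((norm (snd z - y0) - \<delta>) / (s * r) + 1) * (s * r)" using n(2) sr by (intro mult_right_mono) auto
    also have "\<dots> = norm (snd z - y0) - \<delta> + s * r" using s(1) r by (simp add: distrib_right)
    finally have n2: "real n * s \<le> norm (snd z - y0) / r" using s(4) r by (simp add: field_simps)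
    have "norm (fst z - x0) + \<epsilon> * Q0 * (real n * s) \<le> X"
      using x mult_left_mono[OF n2 e] by simp
    from iter[OF y n1 this] n2 show ?thesis by (meson order_trans)
  qed
  show ?thesis
    by (rule exI[of _ r], rule conjI[OF r], rule exI[of _ \<kappa>], rule conjI[OF \<kappa>]) (intro allI impI main)
qed

text \<open>Here the greedy step is iterated for a prescribed time \<open>T\<close>, exactly, with the step size a fraction of
  \<open>T\<close>: the ball of radius \<open>R\<close> around \<open>y0\<close> is invariant once \<open>m s \<le> R\<close>.\<close>

lemma staying_near:
  assumes "R > 0"
  shows "\<exists>\<kappa>\<ge>0. \<forall>\<epsilon> z T. 0 < \<epsilon> \<longrightarrow> \<epsilon> \<le> 1 \<longrightarrow> norm (snd z - y0) \<le> R \<longrightarrow> 0 \<le> T \<longrightarrow>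
      norm (fst z - x0) + \<epsilon> * Q0 * T \<le> X \<longrightarrow>
      (\<exists>C z'. reach \<epsilon> z T C z' \<and> C \<le> \<kappa> * T \<and> norm (snd z' - y0) \<le> R)"
proof -
  obtain r \<kappa> m c where r: "r > 0" and \<kappa>: "\<kappa> \<ge> 0" and m: "m \<ge> 0" and c: "c > 0" and
    step: "\<And>\<epsilon> z s. 0 < \<epsilon> \<Longrightarrow> \<epsilon> \<le> 1 \<Longrightarrow> norm (fst z - x0) \<le> X \<Longrightarrow> norm (snd z - y0) \<le> R \<Longrightarrow>
      0 < s \<Longrightarrow> s \<le> c \<Longrightarrow>
      \<exists>C z'. reach \<epsilon> z s C z' \<and> C \<le> \<kappa> * s \<and> norm (snd z' - y0) \<le> max (m * s) (norm (snd z - y0) - r * s)"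
    using greedy_step[of x0 X y0 R] by blast
  have main: "\<exists>C z'. reach \<epsilon> z T C z' \<and> C \<le> \<kappa> * T \<and> norm (snd z' - y0) \<le> R"
    if \<epsilon>: "0 < \<epsilon>" "\<epsilon> \<le> 1" and y: "norm (snd z - y0) \<le> R" and T: "0 \<le> T"
      and x: "norm (fst z - x0) + \<epsilon> * Q0 * T \<le> X" for \<epsilon> z T
  proof (cases "T = 0")
    case True
    then show ?thesis using y by (intro exI[of _ 0] exI[of _ z]) (auto intro: reach_refl)
  next
    case False
    define s0 where "s0 = min c (R / (m + 1))"
    have s0: "s0 > 0" using c assms m by (auto simp: s0_def)
    define n where "n = nat \<lceil>T / s0\<rceil>"
    have "T / s0 > 0" using T False s0 by simp
    then have n: "T / s0 \<le> real n" "0 < n" unfolding n_def by linarith+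
    define s where "s = T / real n"
    have s: "s > 0" "real n * s = T" using T False n by (auto simp: s_def)
    have "s \<le> s0" using n s0 by (simp add: s_def field_simps)
    then have "s \<le> c" "s \<le> R / (m + 1)" by (auto simp: s0_def)
    then have sc: "s \<le> c" "m * s \<le> R" using m s by (auto simp: field_simps)
    have e: "\<epsilon> * Q0 \<ge> 0" using \<epsilon> Q0_nonneg by simp
    have "\<exists>C z'. reach \<epsilon> z (real k * s) C z' \<and> C \<le> \<kappa> * (real k * s) \<and> norm (snd z' - y0) \<le> R"
      if "norm (snd z - y0) \<le> R" "norm (fst z - x0) + \<epsilon> * Q0 * (real k * s) \<le> X" for k z
      using that
    proof (induction k arbitrary: z)
      case 0
      then show ?case by (intro exI[of _ 0] exI[of _ z]) (auto intro: reach_refl)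
    next
      case (Suc k)
      have "norm (fst z - x0) \<le> X"
        using Suc.prems(2) mult_nonneg_nonneg[OF e, of "real (Suc k) * s"] s by simp
      then obtain C z1 where z1: "reach \<epsilon> z s C z1" "C \<le> \<kappa> * s"
        "norm (snd z1 - y0) \<le> max (m * s) (norm (snd z - y0) - r * s)"
        using step[OF \<epsilon> _ Suc.prems(1) s(1) sc(1)] by blast
      have "norm (fst z1 - fst z) \<le> \<epsilon> * Q0 * s" using reach_slow_drift[OF z1(1)] \<epsilon> by simp
      then have x1: "norm (fst z1 - x0) + \<epsilon> * Q0 * (real k * s) \<le> X"
        using Suc.prems(2) norm_triangle_ineq[of "fst z1 - fst z" "fst z - x0"] by (simp add: algebra_simps)
      have y1: "norm (snd z1 - y0) \<le> R"
        using z1(3) sc Suc.prems(1) mult_pos_pos[OF r s(1)] by (auto simp: max_def split: if_splits)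
      from Suc.IH[OF y1 x1] obtain C' z' where
        "reach \<epsilon> z1 (real k * s) C' z'" "C' \<le> \<kappa> * (real k * s)" "norm (snd z' - y0) \<le> R" by blast
      then have "reach \<epsilon> z (real (Suc k) * s) (C + C') z'" "C + C' \<le> \<kappa> * (real (Suc k) * s)"
        using z1(2) reach_trans[OF z1(1), of "real k * s" C' z'] by (auto simp: distrib_left distrib_right)
      then show ?case using \<open>norm (snd z' - y0) \<le> R\<close> by blast
    qed
    from this[of z n] y x s(2) show ?thesis by simp
  qed
  show ?thesis
    by (rule exI[of _ \<kappa>], rule conjI[OF \<kappa>]) (intro allI impI main)
qed

section \<open>The upper semilimit of the value functions\<close>

text \<open>The semilimit before its independence of \<open>y\<close> is known; \<open>value_limsup\<close> is its common value.\<close>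

definition upper_limit :: "real^'n \<Rightarrow> real^'m \<Rightarrow> real \<Rightarrow> ereal" where
  "upper_limit x y t = weak_limsup (UNIV \<times> UNIV \<times> {0..})
     (\<lambda>\<epsilon> (x', y', t'). value_fn f g l u0 A \<epsilon> x' y' t') (x, y, t)"

lemma upper_limit_lessD:
  assumes "upper_limit x y t < ereal c"
  shows "\<exists>\<rho>>0. \<forall>\<epsilon> z t'. 0 < \<epsilon> \<and> \<epsilon> < \<rho> \<and> norm (fst z - x) < \<rho> \<and> norm (snd z - y) < \<rho> \<and> \<bar>t' - t\<bar> < \<rho> \<and> 0 \<le> t'
      \<longrightarrow> V \<epsilon> z t' < c"
proof -
  from weak_limsup_less_imp_locally_less[OF assms[unfolded upper_limit_def]] obtain \<rho> where \<rho>: "\<rho> > 0"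
    "\<And>\<epsilon> w. 0 < \<epsilon> \<Longrightarrow> \<epsilon> < \<rho> \<Longrightarrow> w \<in> UNIV \<times> UNIV \<times> {0..} \<Longrightarrow> dist w (x, y, t) < \<rho> \<Longrightarrow>
      (case w of (x', y', t') \<Rightarrow> value_fn f g l u0 A \<epsilon> x' y' t') < c" by blast
  show ?thesis
  proof (intro exI[of _ "\<rho> / 3"] conjI allI impI)
    show "\<rho> / 3 > 0" using \<rho> by simp
    fix \<epsilon> z t'
    assume a: "0 < \<epsilon> \<and> \<epsilon> < \<rho> / 3 \<and> norm (fst z - x) < \<rho> / 3 \<and> norm (snd z - y) < \<rho> / 3 \<and> \<bar>t' - t\<bar> < \<rho> / 3 \<and> 0 \<le> t'"
    have "dist (fst z, snd z, t') (x, y, t) \<le> norm (fst z - x) + (norm (snd z - y) + \<bar>t' - t\<bar>)"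
      using norm_Pair_le[of "fst z - x" "(snd z - y, t' - t)"] norm_Pair_le[of "snd z - y" "t' - t"]
      by (simp add: dist_norm)
    then have "dist (fst z, snd z, t') (x, y, t) < \<rho>" using a by linarith
    then show "V \<epsilon> z t' < c" using \<rho>(2)[of \<epsilon> "(fst z, snd z, t')"] a by simp
  qed
qed

lemma upper_limit_leI:
  assumes "\<rho> > 0" "\<And>\<epsilon> z t'. 0 < \<epsilon> \<Longrightarrow> \<epsilon> < \<rho> \<Longrightarrow> norm (fst z - x) < \<rho> \<Longrightarrow> norm (snd z - y) < \<rho> \<Longrightarrow>
      \<bar>t' - t\<bar> < \<rho> \<Longrightarrow> 0 \<le> t' \<Longrightarrow> V \<epsilon> z t' \<le> c"
  shows "upper_limit x y t \<le> ereal c"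
  unfolding upper_limit_def
proof (rule weak_limsup_le_of_locally_le[OF assms(1)], clarsimp)
  fix \<epsilon> x' y' t' assume a: "0 < \<epsilon>" "\<epsilon> < \<rho>" "0 \<le> t'" "dist (x', y', t') (x, y, t) < \<rho>"
  have "dist x' x < \<rho>" "dist y' y < \<rho>" "dist t' t < \<rho>"
    using a(4) dist_fst_le[of "(x', y', t')" "(x, y, t)"] dist_snd_le[of "(x', y', t')" "(x, y, t)"]
      dist_fst_le[of "(y', t')" "(y, t)"] dist_snd_le[of "(y', t')" "(y, t)"] by simp_all
  then show "value_fn f g l u0 A \<epsilon> x' y' t' \<le> c"
    using assms(2)[of \<epsilon> "(x', y')" t'] a by (simp add: dist_norm)
qed

lemma upper_limit_lower_bound:
  assumes "0 \<le> t" shows "\<exists>c. ereal c \<le> upper_limit x y t"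
proof -
  obtain \<kappa> where "\<forall>x\<in>cball x (Q0 * t). \<forall>y. \<forall>a\<in>A. - \<kappa> \<le> l x y a"
    using l_bounded_below[OF compact_cball] by blast
  then have "- \<kappa> * t - Q0 \<le> V \<epsilon> (x, y) t" if "0 < \<epsilon>" "\<epsilon> < 1" for \<epsilon>
    using value_lower_bound[of "(x, y)" t \<kappa> \<epsilon>] that assms by simp
  then show ?thesis unfolding upper_limit_def
    by (intro exI[of _ "- \<kappa> * t - Q0"] weak_limsup_ge_of_locally_ge[where \<rho> = 1]) (use assms in auto)
qed

text \<open>Park the fast variable near \<open>y0\<close> until the terminal time \<open>t / \<epsilon>\<close>.\<close>

lemma value_le_by_staying_near:
  assumes "R > 0"
  shows "\<exists>\<kappa>\<ge>0. \<forall>(\<epsilon>::real) z t. 0 < \<epsilon> \<longrightarrow> \<epsilon> \<le> 1 \<longrightarrow> norm (snd z - y0) \<le> R \<longrightarrow> 0 \<le> t \<longrightarrow> norm (fst z - x0) + Q0 * t \<le> X \<longrightarrow>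
      (\<exists>x' y'. norm (x' - x0) \<le> X \<and> norm (y' - y0) \<le> R \<and> V \<epsilon> z t \<le> \<kappa> * t + u0 x' y')"
proof -
  obtain \<kappa> where \<kappa>: "\<kappa> \<ge> 0" and stay: "\<And>\<epsilon> z T. 0 < \<epsilon> \<Longrightarrow> \<epsilon> \<le> 1 \<Longrightarrow> norm (snd z - y0) \<le> R \<Longrightarrow> 0 \<le> T \<Longrightarrow>
      norm (fst z - x0) + \<epsilon> * Q0 * T \<le> X \<Longrightarrow>
      \<exists>C z'. reach \<epsilon> z T C z' \<and> C \<le> \<kappa> * T \<and> norm (snd z' - y0) \<le> R"
    using staying_near[OF assms, of y0 x0 X] by blast
  have "\<exists>x' y'. norm (x' - x0) \<le> X \<and> norm (y' - y0) \<le> R \<and> V \<epsilon> z t \<le> \<kappa> * t + u0 x' y'"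
    if \<epsilon>: "0 < \<epsilon>" "\<epsilon> \<le> 1" and y: "norm (snd z - y0) \<le> R" and t: "0 \<le> t" and x: "norm (fst z - x0) + Q0 * t \<le> X" for \<epsilon> z t
  proof -
    have T: "0 \<le> t / \<epsilon>" "\<epsilon> * Q0 * (t / \<epsilon>) = Q0 * t" "\<epsilon> * (t / \<epsilon>) = t" using \<epsilon> t by auto
    then obtain C z' where z': "reach \<epsilon> z (t / \<epsilon>) C z'" "C \<le> \<kappa> * (t / \<epsilon>)" "norm (snd z' - y0) \<le> R"
      using stay[OF \<epsilon> y, of "t / \<epsilon>"] x by metis
    have "norm (fst z' - fst z) \<le> Q0 * t" using reach_slow_drift[OF z'(1)] \<epsilon> T by simp
    then have "norm (fst z' - x0) \<le> X" using x norm_triangle_ineq[of "fst z' - fst z" "fst z - x0"] by simp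
    moreover have "V \<epsilon> z t \<le> \<kappa> * t + u0 (fst z') (snd z')"
    proof -
      have "V \<epsilon> z t \<le> \<epsilon> * C + V \<epsilon> z' 0"
        using value_dynamic_programming[OF z'(1) \<epsilon>, of t] T by simp
      moreover have "\<epsilon> * C \<le> \<kappa> * t"
        using mult_left_mono[OF z'(2), of \<epsilon>] \<epsilon> by simp
      ultimately show ?thesis using value_terminal[OF \<epsilon>, of z'] by simp
    qed
    ultimately show ?thesis using z'(3) by blast
  qed
  then show ?thesis using \<kappa> by blast
qed

lemma u0_continuous_at:
  assumes "e > 0"
  shows "\<exists>\<delta>>0. \<forall>x' y'. norm (x' - x) \<le> \<delta> \<longrightarrow> norm (y' - y) \<le> \<delta> \<longrightarrow> u0 x' y' < u0 x y + e"
proof -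
  have "isCont (\<lambda>(x, y). u0 x y) (x, y)" using u0_continuous by (simp add: continuous_on_eq_continuous_at)
  then obtain \<delta> where \<delta>: "\<delta> > 0" "\<And>w. dist w (x, y) < \<delta> \<Longrightarrow> dist ((\<lambda>(x, y). u0 x y) w) (u0 x y) < e"
    using assms unfolding continuous_at_eps_delta by fastforce
  have "u0 x' y' < u0 x y + e" if "norm (x' - x) \<le> \<delta> / 3" "norm (y' - y) \<le> \<delta> / 3" for x' y'
  proof -
    have "dist (x', y') (x, y) < \<delta>"
      using that \<delta>(1) norm_Pair_le[of "x' - x" "y' - y"] by (simp add: dist_norm)
    then show ?thesis using \<delta>(2)[of "(x', y')"] by (simp add: dist_norm)
  qed
  then show ?thesis using \<delta>(1) by (intro exI[of _ "\<delta> / 3"]) auto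
qed

lemma upper_limit_upper_bound:
  assumes "0 \<le> t" shows "\<exists>c. upper_limit x y t \<le> ereal c"
proof -
  define X where "X = 1 + Q0 * (t + 1)"
  obtain \<kappa> where \<kappa>: "\<kappa> \<ge> 0" and stay: "\<And>(\<epsilon>::real) z t. 0 < \<epsilon> \<Longrightarrow> \<epsilon> \<le> 1 \<Longrightarrow> norm (snd z - y) \<le> 1 \<Longrightarrow> 0 \<le> t \<Longrightarrow>
      norm (fst z - x) + Q0 * t \<le> X \<Longrightarrow>
      \<exists>x' y'. norm (x' - x) \<le> X \<and> norm (y' - y) \<le> 1 \<and> V \<epsilon> z t \<le> \<kappa> * t + u0 x' y'"
    using value_le_by_staying_near[of 1 y x X] by auto
  have "compact ((\<lambda>(x, y). u0 x y) ` (cball x X \<times> cball y 1))"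
    by (intro compact_continuous_image continuous_on_subset[OF u0_continuous] compact_Times compact_cball) auto
  then obtain M where "\<forall>v\<in>(\<lambda>(x, y). u0 x y) ` (cball x X \<times> cball y 1). norm v \<le> M"
    using compact_imp_bounded bounded_iff by blast
  then have M: "u0 x' y' \<le> M" if "norm (x' - x) \<le> X" "norm (y' - y) \<le> 1" for x' y'
    using that by (force simp: dist_norm norm_minus_commute)
  have "upper_limit x y t \<le> ereal (\<kappa> * (t + 1) + M)"
  proof (rule upper_limit_leI[of 1])
    fix \<epsilon> t' :: real and z :: "(real^'n) \<times> (real^'m)" assume a: "0 < \<epsilon>" "\<epsilon> < 1" "norm (fst z - x) < 1" "norm (snd z - y) < 1" "\<bar>t' - t\<bar> < 1" "0 \<le> t'"
    have "Q0 * t' \<le> Q0 * (t + 1)" using a Q0_nonneg by (intro mult_left_mono) auto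
    then obtain x' y' where "norm (x' - x) \<le> X" "norm (y' - y) \<le> 1" "V \<epsilon> z t' \<le> \<kappa> * t' + u0 x' y'"
      using stay[of \<epsilon> z t'] a by (auto simp: X_def)
    moreover have "\<kappa> * t' \<le> \<kappa> * (t + 1)" using a \<kappa> by (intro mult_left_mono) auto
    ultimately show "V \<epsilon> z t' \<le> \<kappa> * (t + 1) + M" using M[of x' y'] by simp
  qed simp
  then show ?thesis by blast
qed

text \<open>Steer from near \<open>y\<close> to near \<open>y'\<close> first. This takes a time of the fast dynamics that is bounded
  independently of \<open>\<epsilon>\<close>, hence changes the payoff, the slow variable and the remaining time only by \<open>O(\<epsilon>)\<close>.\<close>

lemma upper_limit_le_other_fast_state:
  assumes "0 < t" shows "upper_limit x y t \<le> upper_limit x y' t"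
proof (rule ereal_le_of_all_real_above)
  fix c assume "upper_limit x y' t < ereal c"
  then obtain c0 where c0: "upper_limit x y' t < ereal c0" "c0 < c" using ereal_dense2 by fastforce
  from upper_limit_lessD[OF c0(1)] obtain \<rho> where \<rho>: "\<rho> > 0" "\<And>\<epsilon> z t'. 0 < \<epsilon> \<Longrightarrow> \<epsilon> < \<rho> \<Longrightarrow>
      norm (fst z - x) < \<rho> \<Longrightarrow> norm (snd z - y') < \<rho> \<Longrightarrow> \<bar>t' - t\<bar> < \<rho> \<Longrightarrow> 0 \<le> t' \<Longrightarrow> V \<epsilon> z t' < c0" by blast
  define Y where "Y = norm (y - y') + 1"
  have Y: "Y > 0" by (simp add: Y_def add_nonneg_pos)
  obtain r \<kappa> where r: "r > 0" and \<kappa>: "\<kappa> \<ge> 0" and steer: "\<And>\<epsilon> z \<delta>. 0 < \<epsilon> \<Longrightarrow> \<epsilon> \<le> 1 \<Longrightarrow> 0 < \<delta> \<Longrightarrow> norm (snd z - y') \<le> Y \<Longrightarrow>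
      norm (fst z - x) + \<epsilon> * Q0 * (norm (snd z - y') / r) \<le> 2 \<Longrightarrow>
      \<exists>T C z'. reach \<epsilon> z T C z' \<and> T \<le> norm (snd z - y') / r \<and> C \<le> \<kappa> * T \<and> norm (snd z' - y') \<le> \<delta>"
    using steering[OF Y, of y' x 2] by blast
  define D where "D = Y / r"
  have D: "D > 0" using Y r by (simp add: D_def)
  define m where "m = Min {1, \<rho> / 2, t / 2}"
  have m: "m > 0" "m \<le> 1" "m \<le> \<rho> / 2" "m \<le> t / 2" using \<rho> assms by (auto simp: m_def)
  define \<rho>' where "\<rho>' = Min {m, m / D, m / (Q0 * D + 1), (c - c0) / (\<kappa> * D + 1)}"
  have pos: "Q0 * D + 1 > 0" "\<kappa> * D + 1 > 0" using Q0_nonneg D \<kappa> by (auto intro: add_nonneg_pos)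
  have \<rho>': "\<rho>' > 0" using m D pos c0(2) by (auto simp: \<rho>'_def)
  show "upper_limit x y t \<le> ereal c"
  proof (rule upper_limit_leI[OF \<rho>'])
    fix \<epsilon> t' :: real and z :: "(real^'n) \<times> (real^'m)" assume a: "0 < \<epsilon>" "\<epsilon> < \<rho>'" "norm (fst z - x) < \<rho>'" "norm (snd z - y) < \<rho>'" "\<bar>t' - t\<bar> < \<rho>'" "0 \<le> t'"
    have le: "\<rho>' \<le> m" "\<rho>' \<le> m / D" "\<rho>' \<le> m / (Q0 * D + 1)" "\<rho>' \<le> (c - c0) / (\<kappa> * D + 1)" by (auto simp: \<rho>'_def)
    have e: "\<epsilon> * D < m" "\<epsilon> * (Q0 * D + 1) < m" "\<epsilon> * (\<kappa> * D + 1) < c - c0"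
      using less_le_trans[OF a(2) le(2)] less_le_trans[OF a(2) le(3)] less_le_trans[OF a(2) le(4)] D pos
      by (auto simp: pos_less_divide_eq)
    have \<epsilon>1: "\<epsilon> \<le> 1" using a le m by simp
    have eQ: "\<epsilon> * Q0 \<ge> 0" using a Q0_nonneg by simp
    have dz: "norm (snd z - y') \<le> Y"
      using norm_triangle_ineq[of "snd z - y" "y - y'"] a le m by (simp add: Y_def)
    then have dD: "norm (snd z - y') / r \<le> D" using r by (simp add: D_def divide_right_mono)
    have drift: "\<epsilon> * Q0 * D < m" using e(2) a(1) by (simp add: algebra_simps)
    have "norm (fst z - x) + \<epsilon> * Q0 * (norm (snd z - y') / r) \<le> 2"
      using mult_left_mono[OF dD eQ] drift a(3) le(1) m by linarith
    from steer[OF a(1) \<epsilon>1 m(1) dz this] obtain T C z' where z': "reach \<epsilon> z T C z'"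
      "T \<le> norm (snd z - y') / r" "C \<le> \<kappa> * T" "norm (snd z' - y') \<le> m" by blast
    have T: "0 \<le> T" "T \<le> D" using reach_time_nonneg[OF z'(1)] z'(2) dD by auto
    have \<epsilon>T: "0 \<le> \<epsilon> * T" "\<epsilon> * T < m" using T(1) a(1) e(1) mult_left_mono[OF T(2), of \<epsilon>] by (simp, linarith)
    have "norm (fst z' - fst z) \<le> \<epsilon> * Q0 * T" using reach_slow_drift[OF z'(1)] a by simp
    also have "\<dots> < m" using mult_left_mono[OF T(2) eQ] drift by linarith
    finally have x': "norm (fst z' - x) < \<rho>"
      using norm_triangle_ineq[of "fst z' - fst z" "fst z - x"] a(3) le(1) m by simp
    have "V \<epsilon> z t' \<le> \<epsilon> * C + V \<epsilon> z' (t' - \<epsilon> * T)"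
      using value_dynamic_programming[OF z'(1) a(1) \<epsilon>1] \<epsilon>T a(5) le(1) m by simp
    moreover have "V \<epsilon> z' (t' - \<epsilon> * T) < c0"
      using \<epsilon>T a le m z'(4) x' by (intro \<rho>(2)) auto
    moreover have "\<epsilon> * C \<le> c - c0"
    proof -
      have "\<epsilon> * C \<le> \<epsilon> * (\<kappa> * D)"
        using z'(3) mult_left_mono[OF T(2) \<kappa>] a(1) by (intro mult_left_mono) auto
      also have "\<dots> \<le> c - c0" using e(3) a(1) by (simp add: algebra_simps)
      finally show ?thesis .
    qed
    ultimately show "V \<epsilon> z t' \<le> c" by simp
  qed
qed

abbreviation Vbar :: "(real^'n) \<times> real \<Rightarrow> real" where
  "Vbar \<equiv> value_limsup f g l u0 A"

lemma upper_limit_eq_value_limsup: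
  assumes "0 < t" shows "upper_limit x y t = ereal (Vbar (x, t))"
proof -
  obtain c d where "ereal c \<le> upper_limit x 0 t" "upper_limit x 0 t \<le> ereal d"
    using upper_limit_lower_bound[of t x 0] upper_limit_upper_bound[of t x 0] assms by auto
  then obtain v where v: "upper_limit x 0 t = ereal v" by (cases "upper_limit x 0 t") auto
  then have all: "upper_limit x y t = ereal v" for y
    using upper_limit_le_other_fast_state[OF assms, of x y 0] upper_limit_le_other_fast_state[OF assms, of x 0 y] by simp
  have "Vbar (x, t) = (THE v. \<forall>y. upper_limit x y t = ereal v)"
    by (simp add: value_limsup_def upper_limit_def)
  also have "\<dots> = v" using all by simp
  finally show ?thesis using all by simp
qed

lemma value_limsup_usc: "usc_on (UNIV \<times> {0<..}) Vbar"
  unfolding usc_on_def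
proof (intro ballI allI impI)
  fix w :: "(real^'n) \<times> real" and c assume w: "w \<in> UNIV \<times> {0<..}" "Vbar w < c"
  obtain x t where wxt: "w = (x, t)" "0 < t" using w by auto
  obtain c' where c': "Vbar w < c'" "c' < c" using w(2) dense by blast
  then have "upper_limit x 0 t < ereal c'" using upper_limit_eq_value_limsup[OF wxt(2)] wxt(1) by simp
  from upper_limit_lessD[OF this] obtain \<rho> where \<rho>: "\<rho> > 0" "\<And>\<epsilon> z t'. 0 < \<epsilon> \<Longrightarrow> \<epsilon> < \<rho> \<Longrightarrow>
      norm (fst z - x) < \<rho> \<Longrightarrow> norm (snd z) < \<rho> \<Longrightarrow> \<bar>t' - t\<bar> < \<rho> \<Longrightarrow> 0 \<le> t' \<Longrightarrow> V \<epsilon> z t' < c'" by auto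
  have "Vbar w' < c" if w': "w' \<in> UNIV \<times> {0<..}" "dist w' w < \<rho> / 2" for w'
  proof -
    obtain x1 t1 where x1: "w' = (x1, t1)" "0 < t1" using w' by auto
    have d: "norm (x1 - x) < \<rho> / 2" "\<bar>t1 - t\<bar> < \<rho> / 2"
      using w'(2) dist_fst_le[of w' w] dist_snd_le[of w' w] x1 wxt by (auto simp: dist_norm)
    have "upper_limit x1 0 t1 \<le> ereal c'"
    proof (rule upper_limit_leI[of "\<rho> / 2"])
      fix \<epsilon> t' :: real and z :: "(real^'n) \<times> (real^'m)" assume a: "0 < \<epsilon>" "\<epsilon> < \<rho> / 2" "norm (fst z - x1) < \<rho> / 2" "norm (snd z - 0) < \<rho> / 2" "\<bar>t' - t1\<bar> < \<rho> / 2" "0 \<le> t'"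
      have "norm (fst z - x) < \<rho>" using norm_triangle_ineq[of "fst z - x1" "x1 - x"] a(3) d by simp
      moreover have "\<bar>t' - t\<bar> < \<rho>" using a d by linarith
      ultimately show "V \<epsilon> z t' \<le> c'" using \<rho>(2)[of \<epsilon> z t'] a \<rho>(1) by simp
    qed (use \<rho> in simp)
    then show ?thesis using upper_limit_eq_value_limsup[OF x1(2)] x1(1) c'(2) by simp
  qed
  then show "\<forall>\<^sub>F w' in at w within UNIV \<times> {0<..}. Vbar w' < c"
    unfolding eventually_at using \<rho>(1) by (intro exI[of _ "\<rho> / 2"]) auto
qed

text \<open>Park the fast variable near a point \<open>y\<close> with \<open>u0 x0 y\<close> close to its infimum; the running cost of this
  is \<open>O(t)\<close>.\<close>

lemma value_limsup_initial_datum: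
  "Limsup (at (x0, 0) within UNIV \<times> {0<..}) (\<lambda>w. ereal (Vbar w)) \<le> ereal (limit_datum u0 x0)"
proof (rule ereal_le_of_all_real_above)
  fix c assume "ereal (limit_datum u0 x0) < ereal c"
  moreover have "bdd_below (range (u0 x0))" using u0_bounded_below by (intro bdd_belowI[of _ "- Q0"]) auto
  ultimately obtain y where y: "u0 x0 y < c"
    by (auto simp: limit_datum_def cINF_less_iff)
  obtain c1 where c1: "u0 x0 y < c1" "c1 < c" using y dense by blast
  obtain \<delta> where \<delta>: "\<delta> > 0" "\<And>x' y'. norm (x' - x0) \<le> \<delta> \<Longrightarrow> norm (y' - y) \<le> \<delta> \<Longrightarrow> u0 x' y' < c1"
    using u0_continuous_at[of "c1 - u0 x0 y" x0 y] c1 by auto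
  obtain \<kappa> where \<kappa>: "\<kappa> \<ge> 0" and stay: "\<And>(\<epsilon>::real) z t. 0 < \<epsilon> \<Longrightarrow> \<epsilon> \<le> 1 \<Longrightarrow> norm (snd z - y) \<le> \<delta> \<Longrightarrow> 0 \<le> t \<Longrightarrow>
      norm (fst z - x0) + Q0 * t \<le> \<delta> \<Longrightarrow>
      \<exists>x' y'. norm (x' - x0) \<le> \<delta> \<and> norm (y' - y) \<le> \<delta> \<and> V \<epsilon> z t \<le> \<kappa> * t + u0 x' y'"
    using value_le_by_staying_near[OF \<delta>(1), of y x0 \<delta>] by blast
  define \<rho> where "\<rho> = Min {1, \<delta> / (2 * (1 + Q0)), (c - c1) / (2 * (\<kappa> + 1))}"
  have \<rho>: "\<rho> > 0" "\<rho> \<le> 1" "\<rho> \<le> \<delta> / (2 * (1 + Q0))" "\<rho> \<le> (c - c1) / (2 * (\<kappa> + 1))"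
    using \<delta>(1) Q0_nonneg \<kappa> c1(2) by (auto simp: \<rho>_def)
  have \<rho>1: "2 * \<rho> + Q0 * (2 * \<rho>) \<le> \<delta>" using \<rho>(3) Q0_nonneg by (simp add: field_simps)
  have \<rho>2: "\<kappa> * (2 * \<rho>) \<le> c - c1" using \<rho>(1,4) \<kappa> by (simp add: field_simps)
  have \<rho>3: "2 * \<rho> \<le> \<delta>" using \<rho>1 mult_nonneg_nonneg[OF Q0_nonneg, of "2 * \<rho>"] \<rho>(1) by simp
  have "Vbar w \<le> c" if w: "w \<in> UNIV \<times> {0<..}" "dist w (x0, 0) < \<rho>" for w
  proof -
    obtain x1 t1 where x1: "w = (x1, t1)" "0 < t1" using w by auto
    have d: "norm (x1 - x0) < \<rho>" "t1 < \<rho>"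
      using w(2) dist_fst_le[of w "(x0, 0)"] dist_snd_le[of w "(x0, 0)"] x1 by (auto simp: dist_norm)
    have "upper_limit x1 y t1 \<le> ereal c"
    proof (rule upper_limit_leI[OF \<rho>(1)])
      fix \<epsilon> t' :: real and z :: "(real^'n) \<times> (real^'m)" assume a: "0 < \<epsilon>" "\<epsilon> < \<rho>" "norm (fst z - x1) < \<rho>" "norm (snd z - y) < \<rho>" "\<bar>t' - t1\<bar> < \<rho>" "0 \<le> t'"
      have t': "t' \<le> 2 * \<rho>" using a d by linarith
      have "norm (fst z - x0) \<le> 2 * \<rho>" using norm_triangle_ineq[of "fst z - x1" "x1 - x0"] a(3) d by simp
      then have "norm (fst z - x0) + Q0 * t' \<le> \<delta>"
        using mult_left_mono[OF t' Q0_nonneg] \<rho>1 by linarith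
      then obtain x' y' where "norm (x' - x0) \<le> \<delta>" "norm (y' - y) \<le> \<delta>" "V \<epsilon> z t' \<le> \<kappa> * t' + u0 x' y'"
        using stay[of \<epsilon> z t'] a \<rho> \<rho>3 by fastforce
      then show "V \<epsilon> z t' \<le> c"
        using \<delta>(2)[of x' y'] mult_left_mono[OF t' \<kappa>] \<rho>2 by simp
    qed
    then show ?thesis using upper_limit_eq_value_limsup[OF x1(2)] x1(1) by simp
  qed
  then have "\<forall>\<^sub>F w in at (x0, 0) within UNIV \<times> {0<..}. ereal (Vbar w) \<le> ereal c"
    unfolding eventually_at using \<rho>(1) by (intro exI[of _ \<rho>]) auto
  then show "Limsup (at (x0, 0) within UNIV \<times> {0<..}) (\<lambda>w. ereal (Vbar w)) \<le> ereal c"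
    by (rule Limsup_bounded)
qed

section \<open>Robust transits and the effective Hamiltonian\<close>

lemma hamiltonian_minus_le_0_iff:
  "hamiltonian f g l A x y p q - ereal b \<le> 0 \<longleftrightarrow> (\<forall>a\<in>A. - (p \<bullet> f x y a) - q \<bullet> g x y a - l x y a \<le> b)"
proof -
  have "h - ereal b \<le> 0 \<longleftrightarrow> h \<le> ereal b" for h :: ereal by (cases h) auto
  then show ?thesis by (simp add: hamiltonian_def SUP_le_iff)
qed

text \<open>Without this bound the infimum in the effective Hamiltonian would say nothing. A subsolution \<open>u\<close> is
  touched from above inside the unit ball by a steep paraboloid; there, a control along which the paraboloid
  does not increase bounds the Hamiltonian from below.\<close>

lemma subsolution_levels_bdd_below:
  "bdd_below {b. \<exists>u. viscosity_subsolution UNIV (\<lambda>y q. hamiltonian f g l A x y p q - ereal b) u}"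
proof -
  let ?B = "cball (0::real^'m) 1"
  obtain r G where push: "r > 0" "\<And>z e. z \<in> {x} \<times> ?B \<Longrightarrow> norm e = 1 \<Longrightarrow>
      \<exists>a\<in>A. e \<bullet> g (fst z) (snd z) a \<le> - r \<and> norm (g (fst z) (snd z) a) \<le> G"
    using uniformly_pushing_controls[OF compact_Times[OF compact_sing compact_cball], of x 0 1] by blast
  obtain \<kappa> where \<kappa>: "\<forall>x\<in>{x}. \<forall>y\<in>?B. \<forall>a\<in>A. \<bar>l x y a\<bar> \<le> \<kappa>"
    using l_bounded_on_compact[OF compact_sing compact_cball] by blast
  have "- norm p * Q0 - \<kappa> \<le> b"
    if "viscosity_subsolution UNIV (\<lambda>y q. hamiltonian f g l A x y p q - ereal b) u" for b u
  proof -
    have usc: "usc_on UNIV u" using that by (simp add: viscosity_subsolution_def)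
    from usc_minus_continuous_attains_max[OF usc continuous_on_const[of _ 0] compact_cball, of 0 1]
    obtain y1 where y1: "\<forall>w\<in>?B. u w \<le> u y1" by auto
    \<comment> \<open>so steep that the maximum over the ball cannot lie on its boundary\<close>
    define k where "k = u y1 - u 0 + 1"
    define \<phi> where "\<phi> y = k * (y \<bullet> y)" for y :: "real^'m"
    have "continuous_on UNIV \<phi>" unfolding \<phi>_def by (intro continuous_intros)
    from usc_minus_continuous_attains_max[OF usc this compact_cball, of 0 1]
    obtain y where y: "y \<in> ?B" "\<And>w. w \<in> ?B \<Longrightarrow> u w - \<phi> w \<le> u y - \<phi> y" by auto
    have "norm y < 1"
    proof (rule ccontr)
      assume "\<not> norm y < 1"
      then have "norm y = 1" using y(1) by simp
      then have "\<phi> y = k" by (simp add: \<phi>_def dot_square_norm)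
      moreover have "\<phi> 0 = 0" by (simp add: \<phi>_def)
      ultimately have "u y - k \<ge> u 0" using y(2)[of 0] by simp
      moreover have "u y \<le> u y1" using y1 y(1) by blast
      ultimately show False by (simp add: k_def)
    qed
    define q where "q = (2 * k) *\<^sub>R y"
    have "hamiltonian f g l A x y p ((\<lambda>y. (2 * k) *\<^sub>R y) y) - ereal b \<le> 0"
    proof (rule that[unfolded viscosity_subsolution_def, THEN conjunct2, rule_format, where \<phi> = \<phi>])
      show "(\<phi> has_derivative (\<lambda>h. (2 * k) *\<^sub>R w \<bullet> h)) (at w)" for w
        unfolding \<phi>_def by (auto intro!: derivative_eq_intros simp: inner_commute)
      show "continuous_on UNIV (\<lambda>y::real^'m. (2 * k) *\<^sub>R y)"
        by (intro continuous_on_scaleR continuous_on_const continuous_on_id)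
      show "\<exists>r>0. \<forall>w\<in>ball y r \<inter> UNIV. u w - \<phi> w \<le> u y - \<phi> y"
      proof (intro exI[of _ "1 - norm y"] conjI ballI)
        fix w assume "w \<in> ball y (1 - norm y) \<inter> UNIV"
        then have "norm (w - y) < 1 - norm y" by (simp add: dist_norm norm_minus_commute)
        then have "norm w \<le> 1" using norm_triangle_sub[of w y] by simp
        then show "u w - \<phi> w \<le> u y - \<phi> y" using y(2) by simp
      qed (use \<open>norm y < 1\<close> in simp)
    qed simp
    then have H: "\<forall>a\<in>A. - (p \<bullet> f x y a) - q \<bullet> g x y a - l x y a \<le> b"
      by (simp add: hamiltonian_minus_le_0_iff q_def)
    have "\<exists>a\<in>A. q \<bullet> g x y a \<le> 0"
    proof (cases "q = 0")
      case True
      then show ?thesis using A_nonempty by auto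
    next
      case False
      then have unit: "norm ((1 / norm q) *\<^sub>R q) = 1" by simp
      obtain a where a: "a \<in> A" "((1 / norm q) *\<^sub>R q) \<bullet> g x y a \<le> - r"
        using push(2)[OF _ unit, of "(x, y)"] y(1) by auto
      then have "(q \<bullet> g x y a) / norm q \<le> 0" using push(1) by simp
      then have "q \<bullet> g x y a \<le> 0" using False by (simp add: divide_le_0_iff)
      then show ?thesis using a(1) by blast
    qed
    then obtain a where a: "a \<in> A" "q \<bullet> g x y a \<le> 0" by blast
    have "p \<bullet> f x y a \<le> norm p * Q0"
      using norm_cauchy_schwarz[of p "f x y a"] mult_left_mono[OF f_bounded[OF a(1)], of "norm p" x y] by simp
    moreover have "\<bar>l x y a\<bar> \<le> \<kappa>" using \<kappa> y(1) a(1) by blast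
    ultimately show ?thesis using H a by force
  qed
  then show ?thesis by (intro bdd_belowI) auto
qed

text \<open>The fast variable can be moved from \<open>y\<close> to \<open>y'\<close> at cost \<open>c\<close> in the system frozen at \<open>x0\<close>, where the
  running cost is \<open>l + p \<bullet> f + b\<close>. The condition is expressed by approximating motions of the true system for
  small \<open>\<epsilon>\<close>, in which the integral of \<open>p \<bullet> f\<close> is \<open>p\<close> applied to the displacement of the slow variable,
  divided by \<open>\<epsilon>\<close>. The tolerance \<open>\<delta>\<close> at the end and the tolerance \<open>\<rho>\<close> at the start are quantified so that
  transits compose; the duration is bounded by \<open>T\<close> uniformly in \<open>\<delta>\<close>.\<close>

definition robust_transit :: "real^'n \<Rightarrow> real^'n \<Rightarrow> real \<Rightarrow> real^'m \<Rightarrow> real^'m \<Rightarrow> real \<Rightarrow> bool" where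
  "robust_transit x0 p b y y' c \<longleftrightarrow> (\<exists>T. \<forall>\<delta>>0. \<exists>\<rho>>0. \<forall>\<epsilon> z.
     0 < \<epsilon> \<and> \<epsilon> < \<rho> \<and> norm (fst z - x0) < \<rho> \<and> norm (snd z - y) < \<rho> \<longrightarrow>
     (\<exists>T' C z'. reach \<epsilon> z T' C z' \<and> T' \<le> T \<and> norm (snd z' - y') < \<delta> \<and>
        C + p \<bullet> (fst z' - fst z) / \<epsilon> + b * T' \<le> c + \<delta>))"

text \<open>The end tolerance of the first transit is chosen below the start tolerance of the second one; the slow
  variable drifts only by \<open>O(\<epsilon>)\<close> in between.\<close>

lemma robust_transit_trans:
  assumes "robust_transit x0 p b y y' c" "robust_transit x0 p b y' y'' c'"
  shows "robust_transit x0 p b y y'' (c + c')"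
proof -
  obtain T1 where T1: "\<And>\<delta>. \<delta> > 0 \<Longrightarrow> \<exists>\<rho>>0. \<forall>\<epsilon> z. 0 < \<epsilon> \<and> \<epsilon> < \<rho> \<and> norm (fst z - x0) < \<rho> \<and> norm (snd z - y) < \<rho> \<longrightarrow>
     (\<exists>T' C z'. reach \<epsilon> z T' C z' \<and> T' \<le> T1 \<and> norm (snd z' - y') < \<delta> \<and> C + p \<bullet> (fst z' - fst z) / \<epsilon> + b * T' \<le> c + \<delta>)"
    using assms(1) unfolding robust_transit_def by blast
  obtain T2 where T2: "\<And>\<delta>. \<delta> > 0 \<Longrightarrow> \<exists>\<rho>>0. \<forall>\<epsilon> z. 0 < \<epsilon> \<and> \<epsilon> < \<rho> \<and> norm (fst z - x0) < \<rho> \<and> norm (snd z - y') < \<rho> \<longrightarrow>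
     (\<exists>T' C z'. reach \<epsilon> z T' C z' \<and> T' \<le> T2 \<and> norm (snd z' - y'') < \<delta> \<and> C + p \<bullet> (fst z' - fst z) / \<epsilon> + b * T' \<le> c' + \<delta>)"
    using assms(2) unfolding robust_transit_def by blast
  show ?thesis
    unfolding robust_transit_def
  proof (rule exI[of _ "T1 + T2"], intro allI impI)
    fix \<delta> :: real assume \<delta>: "\<delta> > 0"
    then obtain \<rho>2 where \<rho>2: "\<rho>2 > 0" "\<And>\<epsilon> z. 0 < \<epsilon> \<and> \<epsilon> < \<rho>2 \<and> norm (fst z - x0) < \<rho>2 \<and> norm (snd z - y') < \<rho>2 \<Longrightarrow>
     (\<exists>T' C z'. reach \<epsilon> z T' C z' \<and> T' \<le> T2 \<and> norm (snd z' - y'') < \<delta> / 2 \<and> C + p \<bullet> (fst z' - fst z) / \<epsilon> + b * T' \<le> c' + \<delta> / 2)"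
      using T2[of "\<delta> / 2"] by auto
    define \<delta>1 where "\<delta>1 = min (\<delta> / 2) \<rho>2"
    have "\<delta>1 > 0" using \<delta> \<rho>2(1) by (simp add: \<delta>1_def)
    then obtain \<rho>1 where \<rho>1: "\<rho>1 > 0" "\<And>\<epsilon> z. 0 < \<epsilon> \<and> \<epsilon> < \<rho>1 \<and> norm (fst z - x0) < \<rho>1 \<and> norm (snd z - y) < \<rho>1 \<Longrightarrow>
     (\<exists>T' C z'. reach \<epsilon> z T' C z' \<and> T' \<le> T1 \<and> norm (snd z' - y') < \<delta>1 \<and> C + p \<bullet> (fst z' - fst z) / \<epsilon> + b * T' \<le> c + \<delta>1)"
      using T1[of \<delta>1] by auto
    define D where "D = Q0 * \<bar>T1\<bar> + 1"
    have D: "D > 0" using Q0_nonneg by (auto simp: D_def intro: add_nonneg_pos)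
    define \<rho> where "\<rho> = Min {\<rho>1, \<rho>2 / 2, \<rho>2 / (2 * D)}"
    have \<rho>: "\<rho> > 0" "\<rho> \<le> \<rho>1" "\<rho> \<le> \<rho>2 / 2" "\<rho> \<le> \<rho>2 / (2 * D)" using \<rho>1(1) \<rho>2(1) D by (auto simp: \<rho>_def)
    show "\<exists>\<rho>>0. \<forall>\<epsilon> z. 0 < \<epsilon> \<and> \<epsilon> < \<rho> \<and> norm (fst z - x0) < \<rho> \<and> norm (snd z - y) < \<rho> \<longrightarrow>
     (\<exists>T' C z'. reach \<epsilon> z T' C z' \<and> T' \<le> T1 + T2 \<and> norm (snd z' - y'') < \<delta> \<and> C + p \<bullet> (fst z' - fst z) / \<epsilon> + b * T' \<le> c + c' + \<delta>)"
    proof (rule exI[of _ \<rho>], intro conjI allI impI, fact \<rho>(1))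
      fix \<epsilon> z assume a: "0 < \<epsilon> \<and> \<epsilon> < \<rho> \<and> norm (fst z - x0) < \<rho> \<and> norm (snd z - y) < \<rho>"
      then obtain T' C z' where z': "reach \<epsilon> z T' C z'" "T' \<le> T1" "norm (snd z' - y') < \<delta>1" "C + p \<bullet> (fst z' - fst z) / \<epsilon> + b * T' \<le> c + \<delta>1"
        using \<rho>1(2)[of \<epsilon> z] \<rho>(2) by auto
      have "norm (fst z' - fst z) \<le> \<epsilon> * (Q0 * T')" using reach_slow_drift[OF z'(1)] a by (simp add: mult.assoc)
      also have "\<dots> \<le> \<rho> * D"
        using a reach_time_nonneg[OF z'(1)] z'(2) Q0_nonneg by (auto simp: D_def intro!: mult_mono add_increasing2 mult_nonneg_nonneg)
      also have "\<dots> \<le> \<rho>2 / 2" using \<rho>(4) D by (simp add: field_simps)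
      finally have "norm (fst z' - x0) < \<rho>2"
        using norm_triangle_ineq[of "fst z' - fst z" "fst z - x0"] a \<rho>(3) by simp
      moreover have "norm (snd z' - y') < \<rho>2" "\<epsilon> < \<rho>2" using z'(3) a \<rho> \<rho>2(1) by (auto simp: \<delta>1_def)
      ultimately obtain T'' C' z'' where z'': "reach \<epsilon> z' T'' C' z''" "T'' \<le> T2" "norm (snd z'' - y'') < \<delta> / 2"
          "C' + p \<bullet> (fst z'' - fst z') / \<epsilon> + b * T'' \<le> c' + \<delta> / 2"
        using \<rho>2(2)[of \<epsilon> z'] a by auto
      have "p \<bullet> (fst z'' - fst z) / \<epsilon> = p \<bullet> (fst z' - fst z) / \<epsilon> + p \<bullet> (fst z'' - fst z') / \<epsilon>"
        by (simp add: inner_diff_right diff_divide_distrib)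
      then have "(C + C') + p \<bullet> (fst z'' - fst z) / \<epsilon> + b * (T' + T'') \<le> c + c' + \<delta>"
        using z'(4) z''(4) by (simp add: \<delta>1_def distrib_left)
      moreover have "reach \<epsilon> z (T' + T'') (C + C') z''" by (rule reach_trans[OF z'(1) z''(1)])
      moreover have "T' + T'' \<le> T1 + T2" "norm (snd z'' - y'') < \<delta>" using z'(2) z''(2,3) \<delta> by auto
      ultimately show "\<exists>T' C z'. reach \<epsilon> z T' C z' \<and> T' \<le> T1 + T2 \<and> norm (snd z' - y'') < \<delta> \<and> C + p \<bullet> (fst z' - fst z) / \<epsilon> + b * T' \<le> c + c' + \<delta>"
        by blast
    qed
  qed
qed

lemma reach_total_cost_le:
  assumes "reach \<epsilon> z T C z'" "0 < \<epsilon>" "C \<le> \<kappa> * T"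
  shows "C + p \<bullet> (fst z' - fst z) / \<epsilon> + b * T \<le> (\<kappa> + norm p * Q0 + \<bar>b\<bar>) * T"
proof -
  have T: "0 \<le> T" by (rule reach_time_nonneg[OF assms(1)])
  have "p \<bullet> (fst z' - fst z) \<le> norm p * (\<epsilon> * Q0 * T)"
    using norm_cauchy_schwarz[of p "fst z' - fst z"] mult_left_mono[OF reach_slow_drift[OF assms(1)], of "norm p"] assms(2)
    by simp
  then have "p \<bullet> (fst z' - fst z) / \<epsilon> \<le> norm p * Q0 * T" using assms(2) by (simp add: field_simps)
  moreover have "b * T \<le> \<bar>b\<bar> * T" using T by (intro mult_right_mono) auto
  ultimately show ?thesis using assms(3) by (simp add: distrib_right)
qed

text \<open>The cost is proportional to the distance, with a constant that is uniform near the target. This makes the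
  minimal cost below upper semicontinuous.\<close>

lemma robust_transit_steering:
  assumes "Y > 0"
  shows "\<exists>K\<ge>0. \<forall>y. norm (y - y0) \<le> Y \<longrightarrow> robust_transit x0 p b y y0 (K * norm (y - y0))"
proof -
  have "Y + 1 > 0" using assms by simp
  from steering[OF this, of y0 x0 2]
  obtain r \<kappa> where r: "r > 0" and \<kappa>: "\<kappa> \<ge> 0" and steer: "\<And>\<epsilon> z \<delta>. 0 < \<epsilon> \<Longrightarrow> \<epsilon> \<le> 1 \<Longrightarrow> 0 < \<delta> \<Longrightarrow> norm (snd z - y0) \<le> Y + 1 \<Longrightarrow>
      norm (fst z - x0) + \<epsilon> * Q0 * (norm (snd z - y0) / r) \<le> 2 \<Longrightarrow>
      \<exists>T C z'. reach \<epsilon> z T C z' \<and> T \<le> norm (snd z - y0) / r \<and> C \<le> \<kappa> * T \<and> norm (snd z' - y0) \<le> \<delta>"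
    by blast
  define K0 where "K0 = \<kappa> + norm p * Q0 + \<bar>b\<bar>"
  have K0: "K0 \<ge> 0" using \<kappa> Q0_nonneg by (simp add: K0_def)
  have "robust_transit x0 p b y y0 (K0 / r * norm (y - y0))" if y: "norm (y - y0) \<le> Y" for y
    unfolding robust_transit_def
  proof (rule exI[of _ "(Y + 1) / r"], intro allI impI)
    fix \<delta> :: real assume \<delta>: "\<delta> > 0"
    define D where "D = Q0 * ((Y + 1) / r) + 1"
    have D: "D > 0" using Q0_nonneg r assms by (auto simp: D_def intro!: add_nonneg_pos)
    have K1: "K0 / r + 1 > 0" using K0 r by (auto intro!: add_nonneg_pos)
    define \<rho> where "\<rho> = Min {1, 1 / D, \<delta> / (K0 / r + 1)}"
    have \<rho>: "\<rho> > 0" "\<rho> \<le> 1" "\<rho> \<le> 1 / D" "\<rho> \<le> \<delta> / (K0 / r + 1)" using D K1 \<delta> by (auto simp: \<rho>_def)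
    have \<rho>1: "\<rho> * D \<le> 1" "\<rho> * (K0 / r + 1) \<le> \<delta>" using \<rho>(3,4) D K1 by (auto simp: pos_le_divide_eq)
    show "\<exists>\<rho>>0. \<forall>\<epsilon> z. 0 < \<epsilon> \<and> \<epsilon> < \<rho> \<and> norm (fst z - x0) < \<rho> \<and> norm (snd z - y) < \<rho> \<longrightarrow>
     (\<exists>T' C z'. reach \<epsilon> z T' C z' \<and> T' \<le> (Y + 1) / r \<and> norm (snd z' - y0) < \<delta> \<and>
        C + p \<bullet> (fst z' - fst z) / \<epsilon> + b * T' \<le> K0 / r * norm (y - y0) + \<delta>)"
    proof (rule exI[of _ \<rho>], intro conjI allI impI, fact \<rho>(1))
      fix \<epsilon> z assume a: "0 < \<epsilon> \<and> \<epsilon> < \<rho> \<and> norm (fst z - x0) < \<rho> \<and> norm (snd z - y) < \<rho>"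
      then have \<epsilon>: "0 < \<epsilon>" "\<epsilon> \<le> 1" using \<rho>(2) by auto
      have dz: "norm (snd z - y0) \<le> norm (y - y0) + \<rho>"
        using norm_triangle_ineq[of "snd z - y" "y - y0"] a by simp
      then have dY: "norm (snd z - y0) \<le> Y + 1" using y \<rho>(2) by simp
      then have dr: "norm (snd z - y0) / r \<le> (Y + 1) / r" using r by (simp add: divide_right_mono)
      have "\<epsilon> * Q0 * (norm (snd z - y0) / r) \<le> \<epsilon> * Q0 * ((Y + 1) / r)"
        using dr \<epsilon>(1) Q0_nonneg by (intro mult_left_mono) auto
      also have "\<dots> \<le> \<epsilon> * D" using \<epsilon>(1) by (simp add: D_def distrib_left mult.assoc)
      also have "\<dots> \<le> \<rho> * D" using a D by (intro mult_right_mono) auto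
      finally have "norm (fst z - x0) + \<epsilon> * Q0 * (norm (snd z - y0) / r) \<le> 2" using a \<rho>(2) \<rho>1(1) by linarith
      from steer[OF \<epsilon> _ dY this, of "\<delta> / 2"] \<delta> obtain T C z' where z': "reach \<epsilon> z T C z'" "T \<le> norm (snd z - y0) / r"
        "C \<le> \<kappa> * T" "norm (snd z' - y0) \<le> \<delta> / 2" by auto
      have "C + p \<bullet> (fst z' - fst z) / \<epsilon> + b * T \<le> K0 * T"
        unfolding K0_def by (rule reach_total_cost_le[OF z'(1) \<epsilon>(1) z'(3)])
      also have "\<dots> \<le> K0 * ((norm (y - y0) + \<rho>) / r)"
        using z'(2) divide_right_mono[OF dz, of r] r K0 by (intro mult_left_mono) auto
      also have "\<dots> = K0 / r * norm (y - y0) + \<rho> * (K0 / r)" by (simp add: add_divide_distrib distrib_left mult.commute)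
      also have "\<dots> \<le> K0 / r * norm (y - y0) + \<delta>" using \<rho>1(2) \<rho>(1) by (simp add: distrib_left)
      finally show "\<exists>T' C z'. reach \<epsilon> z T' C z' \<and> T' \<le> (Y + 1) / r \<and> norm (snd z' - y0) < \<delta> \<and>
        C + p \<bullet> (fst z' - fst z) / \<epsilon> + b * T' \<le> K0 / r * norm (y - y0) + \<delta>"
        using z' dr \<delta> by (intro exI[of _ T] exI[of _ C] exI[of _ z']) auto
    qed
  qed
  then show ?thesis using K0 r by (intro exI[of _ "K0 / r"]) auto
qed

lemma robust_transit_exists: "\<exists>c. robust_transit x0 p b y y' c"
proof -
  have "0 < norm (y - y') + 1" by (simp add: add_nonneg_pos)
  from robust_transit_steering[OF this, of y' x0 p b] obtain K
    where "\<And>y1. norm (y1 - y') \<le> norm (y - y') + 1 \<Longrightarrow> robust_transit x0 p b y1 y' (K * norm (y1 - y'))" by blast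
  from this[of y] show ?thesis by auto
qed

text \<open>On a short time interval the running cost is at most its initial value plus \<open>\<theta>\<close>, both along the frozen
  flow line and along nearby true ones.\<close>

lemma robust_transit_flow_line:
  assumes a: "a \<in> A" and \<theta>: "\<theta> > 0"
  shows "\<exists>\<sigma>>0. \<forall>s \<zeta>0. 0 < s \<and> s \<le> \<sigma> \<and> flow_line 0 a (x0, y) \<zeta>0 \<longrightarrow>
      robust_transit x0 p b y (snd (\<zeta>0 s)) (s * (l x0 y a + p \<bullet> f x0 y a + b + \<theta>))"
proof -
  define h where "h z = cost a z + p \<bullet> f (fst z) (snd z) a" for z
  have ch: "continuous_on S h" for S
    unfolding h_def by (intro continuous_intros continuous_on_cost continuous_on_f a)
  have "isCont h (x0, y)" using ch[of UNIV] by (simp add: continuous_on_eq_continuous_at)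
  then obtain \<eta> where \<eta>: "\<eta> > 0" "\<And>w. dist w (x0, y) < \<eta> \<Longrightarrow> dist (h w) (h (x0, y)) < \<theta>"
    using \<theta> unfolding continuous_at_eps_delta by blast
  define B where "B = norm (field 0 a (x0, y))"
  define \<sigma> where "\<sigma> = min (1 / (8 * L0)) (\<eta> / (4 * (B + 1)))"
  have B: "B \<ge> 0" by (simp add: B_def)
  have \<sigma>: "\<sigma> > 0" using L0_pos \<eta>(1) B by (simp add: \<sigma>_def)
  have main: "robust_transit x0 p b y (snd (\<zeta>0 s)) (s * (l x0 y a + p \<bullet> f x0 y a + b + \<theta>))"
    if s: "0 < s" "s \<le> \<sigma>" and \<zeta>0: "flow_line 0 a (x0, y) \<zeta>0" for s \<zeta>0
    unfolding robust_transit_def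
  proof (rule exI[of _ s], intro allI impI)
    fix \<delta> :: real assume \<delta>: "\<delta> > 0"
    have sL: "s * (4 * L0) \<le> 1 / 2" using s L0_pos by (auto simp: \<sigma>_def field_simps)
    have "s \<le> \<eta> / (4 * (B + 1))" using s by (simp add: \<sigma>_def)
    then have "s * (4 * (B + 1)) \<le> \<eta>" using B by (simp add: pos_le_divide_eq)
    then have sB: "2 * s * B < \<eta> / 2" using s(1) by (simp add: algebra_simps)
    define D where "D = 2 * (2 + s * Q0)"
    have D: "D > 0" using s Q0_nonneg by (simp add: D_def add_pos_nonneg)
    define \<rho> where "\<rho> = Min {1, \<eta> / (2 * D), \<delta> / (2 * D)}"
    have \<rho>: "\<rho> > 0" "\<rho> \<le> 1" "\<rho> \<le> \<eta> / (2 * D)" "\<rho> \<le> \<delta> / (2 * D)" using D \<eta>(1) \<delta> by (auto simp: \<rho>_def)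
    have \<rho>D: "\<rho> * D \<le> \<eta> / 2" "\<rho> * D \<le> \<delta> / 2" using \<rho>(3,4) D by (auto simp: field_simps)
    show "\<exists>\<rho>>0. \<forall>\<epsilon> z. 0 < \<epsilon> \<and> \<epsilon> < \<rho> \<and> norm (fst z - x0) < \<rho> \<and> norm (snd z - y) < \<rho> \<longrightarrow>
     (\<exists>T' C z'. reach \<epsilon> z T' C z' \<and> T' \<le> s \<and> norm (snd z' - snd (\<zeta>0 s)) < \<delta> \<and>
        C + p \<bullet> (fst z' - fst z) / \<epsilon> + b * T' \<le> s * (l x0 y a + p \<bullet> f x0 y a + b + \<theta>) + \<delta>)"
    proof (rule exI[of _ \<rho>], intro conjI allI impI, fact \<rho>(1))
      fix \<epsilon> z assume as: "0 < \<epsilon> \<and> \<epsilon> < \<rho> \<and> norm (fst z - x0) < \<rho> \<and> norm (snd z - y) < \<rho>"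
      then have \<epsilon>: "0 \<le> \<epsilon>" "\<epsilon> \<le> 1" "\<epsilon> \<noteq> 0" using \<rho>(2) by auto
      obtain \<zeta> where \<zeta>: "flow_line \<epsilon> a z \<zeta>" using flow_line_exists[OF a \<epsilon>(1,2), of z] by blast
      have "norm (z - (x0, y)) \<le> norm (fst z - x0) + norm (snd z - y)"
        using norm_Pair_le[of "fst z - x0" "snd z - y"] by (cases z) simp
      then have z0: "norm (z - (x0, y)) \<le> 2 * \<rho>" using as by simp
      have close: "norm (\<zeta> t - \<zeta>0 t) \<le> \<rho> * D" if "t \<in> {0..s}" for t
      proof -
        have "norm (\<zeta> t - \<zeta>0 t) \<le> 2 * (norm (z - (x0, y)) + s * (\<epsilon> * Q0))"
          by (rule flow_line_close_to_frozen_flow_line[OF \<zeta> \<zeta>0 a \<epsilon>(1,2) sL that])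
        also have "\<dots> \<le> 2 * (2 * \<rho> + s * (\<rho> * Q0))"
          using z0 as s Q0_nonneg by (intro mult_left_mono add_mono mult_right_mono) auto
        also have "\<dots> = \<rho> * D" by (simp add: D_def algebra_simps)
        finally show ?thesis .
      qed
      have hle: "h (\<zeta> t) \<le> h (x0, y) + \<theta>" if "t \<in> {0..s}" for t
      proof -
        have "norm (\<zeta>0 t - (x0, y)) \<le> 2 * s * B"
          unfolding B_def by (rule flow_line_displacement[OF \<zeta>0 a _ _ sL that]) auto
        then have "norm (\<zeta> t - (x0, y)) < \<eta>"
          using dist_triangle[of "\<zeta> t" "(x0, y)" "\<zeta>0 t"] close[OF that] \<rho>D(1) sB
          unfolding dist_norm by linarith
        then show ?thesis using \<eta>(2)[of "\<zeta> t"] by (simp add: dist_norm)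
      qed
      let ?C = "integral {0..s} (\<lambda>t. cost a (\<zeta> t))"
      have cf: "continuous_on {0..s} (\<lambda>t. f (fst (\<zeta> t)) (snd (\<zeta> t)) a)"
        by (rule flow_line_continuous_compose[OF \<zeta> continuous_on_f[OF a]])
      have "p \<bullet> (fst (\<zeta> s) - fst z) / \<epsilon> = p \<bullet> integral {0..s} (\<lambda>t. f (fst (\<zeta> t)) (snd (\<zeta> t)) a)"
        using flow_line_components(1)[OF \<zeta> a, of s] s \<epsilon> by simp
      also have "\<dots> = integral {0..s} (\<lambda>t. p \<bullet> f (fst (\<zeta> t)) (snd (\<zeta> t)) a)"
        using integral_linear[OF integrable_continuous_real[OF cf] bounded_linear_inner_right[of p]] by (simp add: o_def)
      finally have "?C + p \<bullet> (fst (\<zeta> s) - fst z) / \<epsilon> = integral {0..s} (\<lambda>t. h (\<zeta> t))"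
        unfolding h_def
        by (subst integral_add)
          (auto intro!: integrable_continuous_real continuous_intros cf flow_line_continuous_compose[OF \<zeta>] continuous_on_cost[OF a] continuous_on_f[OF a])
      also have "\<dots> \<le> integral {0..s} (\<lambda>_. h (x0, y) + \<theta>)"
        by (rule integral_le) (auto intro!: integrable_continuous_real flow_line_continuous_compose[OF \<zeta>] ch hle)
      also have "\<dots> = s * (h (x0, y) + \<theta>)" using s by simp
      finally have "?C + p \<bullet> (fst (\<zeta> s) - fst z) / \<epsilon> + b * s \<le> s * (l x0 y a + p \<bullet> f x0 y a + b + \<theta>) + \<delta>"
        using \<delta> by (simp add: h_def cost_def algebra_simps)
      moreover have "norm (snd (\<zeta> s) - snd (\<zeta>0 s)) < \<delta>"
        using norm_snd_le_norm[of "\<zeta> s - \<zeta>0 s"] close[of s] \<rho>D(2) \<delta> s by simp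
      moreover have "reach \<epsilon> z s ?C (\<zeta> s)" using reach_single[OF a \<zeta>] s by simp
      ultimately show "\<exists>T' C z'. reach \<epsilon> z T' C z' \<and> T' \<le> s \<and> norm (snd z' - snd (\<zeta>0 s)) < \<delta> \<and>
        C + p \<bullet> (fst z' - fst z) / \<epsilon> + b * T' \<le> s * (l x0 y a + p \<bullet> f x0 y a + b + \<theta>) + \<delta>"
        by (intro exI[of _ s] exI[of _ ?C] exI[of _ "\<zeta> s"]) simp
    qed
  qed
  show ?thesis using \<sigma> main by (intro exI[of _ \<sigma>]) auto
qed

text \<open>The least cost of moving to \<open>0\<close>, a Mane-type potential.\<close>

definition transit_cost :: "real^'n \<Rightarrow> real^'n \<Rightarrow> real \<Rightarrow> real^'m \<Rightarrow> real" where
  "transit_cost x0 p b y = Inf {c. robust_transit x0 p b y 0 c}"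

text \<open>The infimum is bounded below because a transit from \<open>0\<close> to \<open>y\<close> followed by one back to \<open>0\<close> is a
  cycle.\<close>

lemma transit_cost_le:
  assumes no_cycle: "\<And>c. robust_transit x0 p b 0 0 c \<Longrightarrow> 0 \<le> c" and "robust_transit x0 p b y y' c"
  shows "transit_cost x0 p b y \<le> c + transit_cost x0 p b y'"
proof -
  have bdd: "bdd_below {c. robust_transit x0 p b y 0 c}" for y
  proof -
    obtain c1 where "robust_transit x0 p b 0 y c1" using robust_transit_exists by blast
    then have "- c1 \<le> c" if "robust_transit x0 p b y 0 c" for c
      using no_cycle[OF robust_transit_trans[OF _ that]] by fastforce
    then show ?thesis by (intro bdd_belowI) auto
  qed
  have "transit_cost x0 p b y - c \<le> c'" if "robust_transit x0 p b y' 0 c'" for c'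
    using cInf_lower[OF _ bdd, of "c + c'" y] robust_transit_trans[OF assms(2) that]
    by (simp add: transit_cost_def)
  then have "transit_cost x0 p b y - c \<le> transit_cost x0 p b y'"
    unfolding transit_cost_def[of _ _ _ y'] using robust_transit_exists by (intro cInf_greatest) auto
  then show ?thesis by simp
qed

text \<open>Following a constant control \<open>a\<close> for a short time \<open>s\<close> gives
  \<open>S(y) \<le> s (l + p \<bullet> f + b) + S(y\<^sub>s) + o(s)\<close> with \<open>y\<^sub>s = y + s g + o(s)\<close>. At a point where a test
  function touches \<open>S\<close> from above, the same inequality holds for the test function; divide by \<open>s\<close>.\<close>

lemma transit_cost_subsolution:
  assumes no_cycle: "\<And>c. robust_transit x0 p b 0 0 c \<Longrightarrow> 0 \<le> c"
  shows "viscosity_subsolution UNIV (\<lambda>y q. hamiltonian f g l A x0 y p q - ereal b) (transit_cost x0 p b)"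
  (is "viscosity_subsolution _ _ ?S")
  unfolding viscosity_subsolution_def
proof (intro conjI allI impI)
  show "usc_on UNIV ?S"
    unfolding usc_on_def
  proof (intro ballI allI impI)
    fix y c assume c: "?S y < c"
    obtain K where K: "K \<ge> 0" "\<And>y1. norm (y1 - y) \<le> 1 \<Longrightarrow> robust_transit x0 p b y1 y (K * norm (y1 - y))"
      using robust_transit_steering[of 1 y x0 p b] by auto
    define d where "d = min 1 ((c - ?S y) / (K + 1))"
    have d: "d > 0" using c K(1) by (simp add: d_def)
    have "?S y1 < c" if "dist y1 y < d" for y1
    proof -
      have y1: "norm (y1 - y) \<le> 1" "norm (y1 - y) < (c - ?S y) / (K + 1)" using that by (auto simp: d_def dist_norm)
      have "?S y1 \<le> K * norm (y1 - y) + ?S y" by (rule transit_cost_le[OF no_cycle K(2)[OF y1(1)]])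
      also have "K * norm (y1 - y) \<le> (K + 1) * norm (y1 - y)" by (simp add: distrib_right)
      also have "(K + 1) * norm (y1 - y) < c - ?S y" using y1(2) K(1) by (simp add: pos_less_divide_eq mult.commute)
      finally show ?thesis by simp
    qed
    then show "\<forall>\<^sub>F w in at y within UNIV. ?S w < c" unfolding eventually_at using d by auto
  qed
next
  fix \<phi> D\<phi> y
  assume d\<phi>: "\<forall>w\<in>UNIV. (\<phi> has_derivative (\<lambda>h. D\<phi> w \<bullet> h)) (at w)"
    and max: "\<exists>r>0. \<forall>w\<in>ball y r \<inter> UNIV. ?S w - \<phi> w \<le> ?S y - \<phi> y"
  let ?q = "D\<phi> y"
  have "- (p \<bullet> f x0 y a) - ?q \<bullet> g x0 y a - l x0 y a \<le> b" if a: "a \<in> A" for a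
  proof (rule ccontr)
    assume neg: "\<not> ?thesis"
    let ?g = "g x0 y a"
    define \<theta> where "\<theta> = - (l x0 y a + p \<bullet> f x0 y a + ?q \<bullet> ?g + b)"
    have \<theta>: "\<theta> > 0" using neg by (simp add: \<theta>_def)
    obtain r where r: "r > 0" "\<And>w. dist y w < r \<Longrightarrow> ?S w - \<phi> w \<le> ?S y - \<phi> y" using max by auto
    obtain \<sigma> where \<sigma>: "\<sigma> > 0" "\<And>s \<zeta>0. 0 < s \<and> s \<le> \<sigma> \<and> flow_line 0 a (x0, y) \<zeta>0 \<Longrightarrow>
      robust_transit x0 p b y (snd (\<zeta>0 s)) (s * (l x0 y a + p \<bullet> f x0 y a + b + \<theta> / 2))"
      using robust_transit_flow_line[OF a, of "\<theta> / 2" x0 y p b] \<theta> by auto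
    obtain \<zeta> where \<zeta>: "flow_line 0 a (x0, y) \<zeta>" using flow_line_exists[OF a, of 0 "(x0, y)"] by auto
    define B where "B = norm (field 0 a (x0, y))"
    have B: "B \<ge> 0" by (simp add: B_def)
    define e where "e = \<theta> / (16 * (B + 1))"
    have e: "e > 0" using \<theta> B by (simp add: e_def)
    have "\<exists>d>0. \<forall>w. norm (w - y) < d \<longrightarrow> norm (\<phi> w - \<phi> y - ?q \<bullet> (w - y)) \<le> e * norm (w - y)"
      using d\<phi> e unfolding has_derivative_at_alt by blast
    then obtain d where d: "d > 0" "\<And>w. norm (w - y) < d \<Longrightarrow> \<bar>\<phi> w - \<phi> y - ?q \<bullet> (w - y)\<bar> \<le> e * norm (w - y)"
      by auto
    define M where "M = norm ?q * (4 * L0 * B)"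
    have M: "M \<ge> 0" using L0_pos B by (simp add: M_def)
    define s where "s = Min {\<sigma>, 1 / (8 * L0), min r d / (4 * (B + 1)), \<theta> / (8 * (M + 1))}"
    have s: "s > 0" "s \<le> \<sigma>" "s \<le> 1 / (8 * L0)" "s \<le> min r d / (4 * (B + 1))" "s \<le> \<theta> / (8 * (M + 1))"
      using \<sigma>(1) L0_pos r(1) d(1) B M \<theta> by (auto simp: s_def)
    have sL: "s * (4 * L0) \<le> 1 / 2" using s(3) L0_pos by (simp add: field_simps)
    have "s * (4 * (B + 1)) \<le> min r d" using s(4) B by (simp add: pos_le_divide_eq)
    moreover have "2 * s * B < s * (4 * (B + 1))" using s(1) B by (simp add: algebra_simps add_pos_nonneg)
    ultimately have sB: "2 * s * B < r" "2 * s * B < d" by auto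
    have sM: "s * M \<le> \<theta> / 8" using s(1,5) M by (simp add: pos_le_divide_eq algebra_simps)
    let ?w = "snd (\<zeta> s)"
    have "norm (\<zeta> s - (x0, y)) \<le> 2 * s * B"
      unfolding B_def by (rule flow_line_displacement[OF \<zeta> a _ _ sL]) (use s in auto)
    then have wy: "norm (?w - y) \<le> 2 * s * B" using norm_snd_le_norm[of "\<zeta> s - (x0, y)"] by simp
    have "norm (?w - y - s *\<^sub>R ?g) \<le> s * (4 * L0 * B) * s"
      using flow_line_first_order[OF \<zeta> a _ _ _ sL, of B] s(1) by (simp add: B_def)
    then have "norm ?q * norm (?w - y - s *\<^sub>R ?g) \<le> norm ?q * (s * (4 * L0 * B) * s)" by (intro mult_left_mono) auto
    then have "?q \<bullet> (?w - y - s *\<^sub>R ?g) \<le> s * (s * M)"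
      using norm_cauchy_schwarz[of ?q "?w - y - s *\<^sub>R ?g"] by (simp add: M_def algebra_simps)
    also have "\<dots> \<le> s * (\<theta> / 8)" using sM s(1) by (intro mult_left_mono) auto
    finally have 1: "?q \<bullet> (?w - y) \<le> s * (?q \<bullet> ?g) + s * (\<theta> / 8)" by (simp add: inner_diff_right)
    have "e * norm (?w - y) \<le> e * (2 * s * B)" using wy e by (intro mult_left_mono) auto
    also have "\<dots> \<le> s * (\<theta> / 8)"
    proof -
      have "e * (2 * B) \<le> e * (2 * (B + 1))" using e by simp
      also have "\<dots> = \<theta> / 8" using B by (simp add: e_def field_simps)
      finally have "s * (e * (2 * B)) \<le> s * (\<theta> / 8)" using s(1) by (intro mult_left_mono) auto
      then show ?thesis by (simp add: mult.commute mult.left_commute)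
    qed
    finally have 2: "\<phi> ?w - \<phi> y \<le> ?q \<bullet> (?w - y) + s * (\<theta> / 8)" using d(2)[of ?w] wy sB(2) by simp
    have "?S ?w - \<phi> ?w \<le> ?S y - \<phi> y" using r(2)[of ?w] wy sB(1) by (simp add: dist_norm norm_minus_commute)
    moreover have "?S y \<le> s * (l x0 y a + p \<bullet> f x0 y a + b + \<theta> / 2) + ?S ?w"
      by (rule transit_cost_le[OF no_cycle \<sigma>(2)]) (use s \<zeta> in auto)
    moreover have "s * (l x0 y a + p \<bullet> f x0 y a + b + \<theta> / 2) = - (s * (?q \<bullet> ?g)) - s * (\<theta> / 2)"
      by (simp add: \<theta>_def algebra_simps)
    ultimately have "s * (\<theta> / 2) \<le> s * (\<theta> / 8) + s * (\<theta> / 8)" using 1 2 by linarith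
    then show False using s(1) \<theta> by simp
  qed
  then show "hamiltonian f g l A x0 y p ?q - ereal b \<le> 0" by (simp add: hamiltonian_minus_le_0_iff)
qed

lemma effective_hamiltonian_le_or_negative_cycle:
  "effective_hamiltonian f g l A x0 p \<le> b \<or> (\<exists>c<0. robust_transit x0 p b 0 0 c)"
proof (rule disjCI)
  assume "\<not> (\<exists>c<0. robust_transit x0 p b 0 0 c)"
  then have "viscosity_subsolution UNIV (\<lambda>y q. hamiltonian f g l A x0 y p q - ereal b) (transit_cost x0 p b)"
    by (intro transit_cost_subsolution) (meson not_le)
  then show "effective_hamiltonian f g l A x0 p \<le> b"
    unfolding effective_hamiltonian_def by (intro cInf_lower subsolution_levels_bdd_below) blast
qed

section \<open>Cycles of negative cost and the limit equation\<close>

text \<open>Running the cycle once from within \<open>\<rho>\<close> of \<open>0\<close> brings the fast variable back only to within \<open>\<delta>\<close>, where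
  \<open>\<rho>\<close> was chosen after \<open>\<delta>\<close> and may be smaller. Steering back to within \<open>\<rho>\<close> costs at most a multiple of
  \<open>\<delta>\<close>, and for small \<open>\<delta>\<close> this is less than what the cycle gains. The result can be repeated.\<close>

lemma robust_cycle_step:
  assumes cyc: "robust_transit x0 p b 0 0 c" and c: "c < 0"
  shows "\<exists>\<rho>>0. \<exists>Tmin>0. \<exists>Tmax. \<forall>\<epsilon> z. 0 < \<epsilon> \<and> \<epsilon> < \<rho> \<and> norm (fst z - x0) < \<rho> \<and> norm (snd z) < \<rho> \<longrightarrow>
     (\<exists>T C z'. reach \<epsilon> z T C z' \<and> Tmin \<le> T \<and> T \<le> Tmax \<and> norm (snd z') < \<rho> \<and>
        C + p \<bullet> (fst z' - fst z) / \<epsilon> + b * T \<le> 0)"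
proof -
  obtain T1 where T1: "\<And>\<delta>. \<delta> > 0 \<Longrightarrow> \<exists>\<rho>>0. \<forall>\<epsilon> z. 0 < \<epsilon> \<and> \<epsilon> < \<rho> \<and> norm (fst z - x0) < \<rho> \<and> norm (snd z) < \<rho> \<longrightarrow>
     (\<exists>T' C z'. reach \<epsilon> z T' C z' \<and> T' \<le> T1 \<and> norm (snd z') < \<delta> \<and> C + p \<bullet> (fst z' - fst z) / \<epsilon> + b * T' \<le> c + \<delta>)"
    using cyc unfolding robust_transit_def by auto
  obtain r \<kappa> where r: "r > 0" and \<kappa>: "\<kappa> \<ge> 0" and steer: "\<And>(\<epsilon>::real) z \<delta>. 0 < \<epsilon> \<Longrightarrow> \<epsilon> \<le> 1 \<Longrightarrow> 0 < \<delta> \<Longrightarrow> norm (snd z) \<le> 1 \<Longrightarrow>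
      norm (fst z - x0) + \<epsilon> * Q0 * (norm (snd z) / r) \<le> 3 \<Longrightarrow>
      \<exists>T C z'. reach \<epsilon> z T C z' \<and> T \<le> norm (snd z) / r \<and> C \<le> \<kappa> * T \<and> norm (snd z') \<le> \<delta>"
    using steering[of 1 0 x0 3] by auto
  define K where "K = \<kappa> + norm p * Q0 + \<bar>b\<bar>"
  have K: "K \<ge> 0" using \<kappa> Q0_nonneg by (simp add: K_def)
  obtain \<kappa>' where \<kappa>': "\<kappa>' \<ge> 0" "\<forall>x\<in>cball x0 3. \<forall>y. \<forall>a\<in>A. - \<kappa>' \<le> l x y a"
    using l_bounded_below[OF compact_cball] by blast
  define K' where "K' = \<kappa>' + norm p * Q0 + \<bar>b\<bar> + 1"
  have K': "K' > 0" using \<kappa>'(1) Q0_nonneg by (auto simp: K'_def intro!: add_nonneg_pos)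
  define \<delta> where "\<delta> = min 1 (- c / (2 * (1 + K / r)))"
  have Kr: "1 + K / r > 0" using K r by (auto intro!: add_pos_nonneg)
  have "0 < - c / (2 * (1 + K / r))" using c Kr by (intro divide_pos_pos) auto
  then have \<delta>: "\<delta> > 0" "\<delta> \<le> 1" by (auto simp: \<delta>_def)
  have "\<delta> \<le> - c / (2 * (1 + K / r))" by (simp add: \<delta>_def)
  then have "\<delta> * (2 * (1 + K / r)) \<le> - c" using Kr by (subst (asm) pos_le_divide_eq) auto
  moreover have "\<delta> * (2 * (1 + K / r)) = 2 * (\<delta> + K * (\<delta> / r))" by (simp add: algebra_simps)
  ultimately have "2 * (\<delta> + K * (\<delta> / r)) \<le> - c" by metis
  then have \<delta>c: "\<delta> + K * (\<delta> / r) \<le> - c / 2" by simp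
  obtain \<rho>1 where \<rho>1: "\<rho>1 > 0" "\<And>\<epsilon> z. 0 < \<epsilon> \<and> \<epsilon> < \<rho>1 \<and> norm (fst z - x0) < \<rho>1 \<and> norm (snd z) < \<rho>1 \<Longrightarrow>
     (\<exists>T' C z'. reach \<epsilon> z T' C z' \<and> T' \<le> T1 \<and> norm (snd z') < \<delta> \<and> C + p \<bullet> (fst z' - fst z) / \<epsilon> + b * T' \<le> c + \<delta>)"
    using T1[OF \<delta>(1)] by blast
  define Tmax where "Tmax = \<bar>T1\<bar> + \<delta> / r"
  define D where "D = Q0 * Tmax + 1"
  have D: "D > 0" using Q0_nonneg \<delta>(1) r by (auto simp: D_def Tmax_def intro!: add_nonneg_pos mult_nonneg_nonneg)
  define \<rho> where "\<rho> = Min {1, \<rho>1, 1 / D}"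
  have \<rho>: "\<rho> > 0" "\<rho> \<le> 1" "\<rho> \<le> \<rho>1" "\<rho> \<le> 1 / D" using \<rho>1(1) D by (auto simp: \<rho>_def)
  have \<rho>D: "\<rho> * D \<le> 1" using \<rho>(4) D by (simp add: pos_le_divide_eq)
  \<comment> \<open>a corrected run costs at most \<open>c / 2\<close> and at least \<open>- K' T\<close>, which forces \<open>T \<ge> Tmin\<close>\<close>
  define Tmin where "Tmin = - c / (2 * K')"
  have Tmin: "Tmin > 0" unfolding Tmin_def using c K' by (intro divide_pos_pos) auto
  have main: "\<exists>T C z'. reach \<epsilon> z T C z' \<and> Tmin \<le> T \<and> T \<le> Tmax \<and> norm (snd z') < \<rho> \<and>
        C + p \<bullet> (fst z' - fst z) / \<epsilon> + b * T \<le> 0"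
    if a: "0 < \<epsilon> \<and> \<epsilon> < \<rho> \<and> norm (fst z - x0) < \<rho> \<and> norm (snd z) < \<rho>" for \<epsilon> z
  proof -
    have \<epsilon>: "0 < \<epsilon>" "\<epsilon> \<le> 1" using a \<rho>(2) by auto
    have eQ: "0 \<le> \<epsilon> * Q0" using \<epsilon>(1) Q0_nonneg by simp
    obtain T' C z' where z': "reach \<epsilon> z T' C z'" "T' \<le> T1" "norm (snd z') < \<delta>" "C + p \<bullet> (fst z' - fst z) / \<epsilon> + b * T' \<le> c + \<delta>"
      using \<rho>1(2)[of \<epsilon> z] a \<rho>(3) by auto
    have T': "0 \<le> T'" by (rule reach_time_nonneg[OF z'(1)])
    have drift: "\<epsilon> * Q0 * T \<le> 1" if "T \<le> Tmax" for T
    proof -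
      have "\<epsilon> * D = \<epsilon> * Q0 * Tmax + \<epsilon>" by (simp add: D_def distrib_left mult.assoc)
      then have "\<epsilon> * Q0 * T \<le> \<epsilon> * D" using mult_left_mono[OF that eQ] \<epsilon>(1) by linarith
      also have "\<dots> \<le> \<rho> * D" using a D by (intro mult_right_mono) auto
      finally show ?thesis using \<rho>D by simp
    qed
    have n\<delta>: "norm (snd z') / r \<le> \<delta> / r" using z'(3) r by (simp add: divide_right_mono)
    have "0 \<le> \<delta> / r" using \<delta>(1) r by simp
    then have "T' \<le> Tmax" "norm (snd z') / r \<le> Tmax"
      using z'(2) n\<delta> unfolding Tmax_def by linarith+
    then have "norm (fst z' - fst z) \<le> 1" "\<epsilon> * Q0 * (norm (snd z') / r) \<le> 1"
      using reach_slow_drift[OF z'(1)] \<epsilon>(1) drift by fastforce+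
    then have "norm (fst z' - x0) + \<epsilon> * Q0 * (norm (snd z') / r) \<le> 3"
      using norm_triangle_ineq[of "fst z' - fst z" "fst z - x0"] a \<rho>(2) by simp
    from steer[OF \<epsilon> _ _ this, of "\<rho> / 2"] z'(3) \<delta>(2) \<rho>(1) obtain T2 C2 z2 where
      z2: "reach \<epsilon> z' T2 C2 z2" "T2 \<le> norm (snd z') / r" "C2 \<le> \<kappa> * T2" "norm (snd z2) \<le> \<rho> / 2" by auto
    have T2: "T2 \<le> \<delta> / r" using z2(2) n\<delta> by simp
    let ?T = "T' + T2" and ?C = "C + C2"
    have reach: "reach \<epsilon> z ?T ?C z2" by (rule reach_trans[OF z'(1) z2(1)])
    have "C2 + p \<bullet> (fst z2 - fst z') / \<epsilon> + b * T2 \<le> K * T2"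
      unfolding K_def by (rule reach_total_cost_le[OF z2(1) \<epsilon>(1) z2(3)])
    also have "\<dots> \<le> K * (\<delta> / r)" using T2 K by (intro mult_left_mono) auto
    finally have "C2 + p \<bullet> (fst z2 - fst z') / \<epsilon> + b * T2 \<le> K * (\<delta> / r)" .
    moreover have "p \<bullet> (fst z2 - fst z) / \<epsilon> = p \<bullet> (fst z' - fst z) / \<epsilon> + p \<bullet> (fst z2 - fst z') / \<epsilon>"
      by (simp add: inner_diff_right diff_divide_distrib)
    ultimately have total: "?C + p \<bullet> (fst z2 - fst z) / \<epsilon> + b * ?T \<le> c / 2"
      using z'(4) \<delta>c distrib_left[of b T' T2] by linarith
    have Tm: "?T \<le> Tmax" using z'(2) T2 by (simp add: Tmax_def)
    have T0: "0 \<le> ?T" by (rule reach_time_nonneg[OF reach])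
    have "cball (fst z) (\<epsilon> * Q0 * ?T) \<subseteq> cball x0 3"
    proof
      fix x assume "x \<in> cball (fst z) (\<epsilon> * Q0 * ?T)"
      then have "dist (fst z) x \<le> 1" using drift[OF Tm] by simp
      moreover have "dist x0 (fst z) \<le> 1" using a \<rho>(2) by (simp add: dist_norm norm_minus_commute)
      ultimately show "x \<in> cball x0 3" using dist_triangle[of x0 x "fst z"] by simp
    qed
    from reach_cost_lower_bound[OF reach _ \<kappa>'(2) this] \<epsilon>(1) have "- \<kappa>' * ?T \<le> ?C" by simp
    then have "- ?C \<le> \<kappa>' * ?T" by simp
    moreover have "- (p \<bullet> (fst z2 - fst z) / \<epsilon>) \<le> norm p * Q0 * ?T"
    proof -
      have "- (p \<bullet> (fst z2 - fst z)) \<le> norm p * (\<epsilon> * Q0 * ?T)"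
        using norm_cauchy_schwarz[of "- p" "fst z2 - fst z"] \<epsilon>(1)
          mult_left_mono[OF reach_slow_drift[OF reach], of "norm p"] by simp
      then show ?thesis using \<epsilon>(1) by (simp add: field_simps)
    qed
    moreover have "- (b * ?T) \<le> \<bar>b\<bar> * ?T" using T0 mult_right_mono[of "- b" "\<bar>b\<bar>" ?T] by simp
    ultimately have "- c / 2 \<le> (K' - 1) * ?T" using total by (simp add: K'_def distrib_right)
    also have "\<dots> \<le> K' * ?T" using T0 by (intro mult_right_mono) auto
    finally have "Tmin \<le> ?T" using K' by (simp add: Tmin_def field_simps)
    moreover have "norm (snd z2) < \<rho>" using z2(4) \<rho>(1) by simp
    moreover have "?C + p \<bullet> (fst z2 - fst z) / \<epsilon> + b * ?T \<le> 0" using total c by linarith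
    ultimately show ?thesis using reach Tm by blast
  qed
  show ?thesis
    by (rule exI[of _ \<rho>], rule conjI[OF \<rho>(1)], rule exI[of _ Tmin], rule conjI[OF Tmin], rule exI[of _ Tmax])
      (intro allI impI main)
qed

text \<open>The number of repetitions is unrestricted; only the drift of the slow variable, at most \<open>\<epsilon> Q0 S\<close>, has to
  keep it within \<open>\<rho>\<close> of \<open>x0\<close>.\<close>

lemma robust_cycle_repeated:
  assumes "robust_transit x0 p b 0 0 c" "c < 0"
  shows "\<exists>\<rho>>0. \<exists>Tmax. \<forall>\<epsilon> z S. 0 < \<epsilon> \<and> \<epsilon> < \<rho> \<and> norm (snd z) < \<rho> \<and> 0 \<le> S \<and> norm (fst z - x0) + \<epsilon> * Q0 * S < \<rho> \<longrightarrow>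
     (\<exists>T C z'. reach \<epsilon> z T C z' \<and> S \<le> T \<and> T \<le> S + Tmax \<and> norm (snd z') < \<rho> \<and>
        C + p \<bullet> (fst z' - fst z) / \<epsilon> + b * T \<le> 0)"
proof -
  obtain \<rho> Tmin Tmax where \<rho>: "\<rho> > 0" and Tmin: "Tmin > 0" and
    step: "\<And>\<epsilon> z. 0 < \<epsilon> \<and> \<epsilon> < \<rho> \<and> norm (fst z - x0) < \<rho> \<and> norm (snd z) < \<rho> \<Longrightarrow>
     (\<exists>T C z'. reach \<epsilon> z T C z' \<and> Tmin \<le> T \<and> T \<le> Tmax \<and> norm (snd z') < \<rho> \<and>
        C + p \<bullet> (fst z' - fst z) / \<epsilon> + b * T \<le> 0)"
    using robust_cycle_step[OF assms] by blast
  have iter: "\<exists>T C z'. reach \<epsilon> z T C z' \<and> S \<le> T \<and> T \<le> S + \<bar>Tmax\<bar> \<and> norm (snd z') < \<rho> \<and>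
        C + p \<bullet> (fst z' - fst z) / \<epsilon> + b * T \<le> 0"
    if \<epsilon>: "0 < \<epsilon>" "\<epsilon> < \<rho>" and "norm (snd z) < \<rho>" "0 \<le> S" "norm (fst z - x0) + \<epsilon> * Q0 * S < \<rho>" "S \<le> real n * Tmin" for \<epsilon> z S n
    using that(3-)
  proof (induction n arbitrary: z S)
    case 0
    then show ?case by (intro exI[of _ 0] exI[of _ z]) (auto intro: reach_refl)
  next
    case (Suc n)
    have eQ: "0 \<le> \<epsilon> * Q0" using \<epsilon>(1) Q0_nonneg by simp
    have "norm (fst z - x0) < \<rho>" using Suc.prems(3) mult_nonneg_nonneg[OF eQ Suc.prems(2)] by linarith
    then obtain T C z' where z': "reach \<epsilon> z T C z'" "Tmin \<le> T" "T \<le> Tmax" "norm (snd z') < \<rho>"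
        "C + p \<bullet> (fst z' - fst z) / \<epsilon> + b * T \<le> 0"
      using step[of \<epsilon> z] \<epsilon> Suc.prems(1) by blast
    show ?case
    proof (cases "S \<le> T")
      case True
      then show ?thesis using z' Suc.prems(2) by (intro exI[of _ T] exI[of _ C] exI[of _ z']) auto
    next
      case False
      have "norm (fst z' - fst z) \<le> \<epsilon> * Q0 * T" using reach_slow_drift[OF z'(1)] \<epsilon>(1) by simp
      then have "norm (fst z' - x0) + \<epsilon> * Q0 * (S - T) < \<rho>"
        using norm_triangle_ineq[of "fst z' - fst z" "fst z - x0"] Suc.prems(3) by (simp add: right_diff_distrib)
      moreover have "S - T \<le> real n * Tmin" using Suc.prems(4) z'(2) by (simp add: algebra_simps)
      ultimately obtain T2 C2 z2 where z2: "reach \<epsilon> z' T2 C2 z2" "S - T \<le> T2" "T2 \<le> S - T + \<bar>Tmax\<bar>" "norm (snd z2) < \<rho>"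
          "C2 + p \<bullet> (fst z2 - fst z') / \<epsilon> + b * T2 \<le> 0"
        using Suc.IH[of z' "S - T"] z'(4) False by auto
      have "p \<bullet> (fst z2 - fst z) / \<epsilon> = p \<bullet> (fst z' - fst z) / \<epsilon> + p \<bullet> (fst z2 - fst z') / \<epsilon>"
        by (simp add: inner_diff_right diff_divide_distrib)
      then have "(C + C2) + p \<bullet> (fst z2 - fst z) / \<epsilon> + b * (T + T2) \<le> 0"
        using z'(5) z2(5) by (simp add: distrib_left)
      then show ?thesis using reach_trans[OF z'(1) z2(1)] z2(2-4)
        by (intro exI[of _ "T + T2"] exI[of _ "C + C2"] exI[of _ z2]) auto
    qed
  qed
  have "\<exists>T C z'. reach \<epsilon> z T C z' \<and> S \<le> T \<and> T \<le> S + \<bar>Tmax\<bar> \<and> norm (snd z') < \<rho> \<and>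
        C + p \<bullet> (fst z' - fst z) / \<epsilon> + b * T \<le> 0"
    if a: "0 < \<epsilon> \<and> \<epsilon> < \<rho> \<and> norm (snd z) < \<rho> \<and> 0 \<le> S \<and> norm (fst z - x0) + \<epsilon> * Q0 * S < \<rho>" for \<epsilon> z S
  proof -
    obtain n :: nat where "S / Tmin \<le> real n" using real_arch_simple by blast
    then have "S \<le> real n * Tmin" using Tmin by (simp add: field_simps)
    then show ?thesis using iter[of \<epsilon> z S n] a by blast
  qed
  then show ?thesis using \<rho> by blast
qed

text \<open>Take \<open>\<epsilon>\<^sub>n \<rightarrow> 0\<close> and starting points near \<open>(x0, 0, t0)\<close> at which the values are almost as large as the
  semilimit. Repeat the cycle for the slow time \<open>h\<close>, and pass to a convergent subsequence of the end
  points. Their fast variables are only known to be bounded, but the semilimit at the limit point is the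
  same for every value of the fast variable.\<close>

lemma value_limsup_decreases_along_cycle:
  assumes "robust_transit x0 p b 0 0 c" "c < 0" "0 < t0"
  shows "\<exists>h0>0. \<forall>h. 0 < h \<and> h \<le> h0 \<longrightarrow>
    (\<exists>x. norm (x - x0) \<le> Q0 * h \<and> Vbar (x0, t0) \<le> Vbar (x, t0 - h) - p \<bullet> (x - x0) - b * h)"
proof -
  obtain \<rho> Tmax where \<rho>: "\<rho> > 0" and run: "\<And>\<epsilon> z S. 0 < \<epsilon> \<and> \<epsilon> < \<rho> \<and> norm (snd z) < \<rho> \<and> 0 \<le> S \<and> norm (fst z - x0) + \<epsilon> * Q0 * S < \<rho> \<Longrightarrow>
     (\<exists>T C z'. reach \<epsilon> z T C z' \<and> S \<le> T \<and> T \<le> S + Tmax \<and> norm (snd z') < \<rho> \<and>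
        C + p \<bullet> (fst z' - fst z) / \<epsilon> + b * T \<le> 0)"
    using robust_cycle_repeated[OF assms(1,2)] by blast
  define h0 where "h0 = min (t0 / 2) (\<rho> / (2 * (Q0 + 1)))"
  have h0: "h0 > 0" using assms(3) \<rho> Q0_nonneg by (simp add: h0_def)
  have main: "\<exists>x. norm (x - x0) \<le> Q0 * h \<and> Vbar (x0, t0) \<le> Vbar (x, t0 - h) - p \<bullet> (x - x0) - b * h"
    if h: "0 < h" "h \<le> h0" for h
  proof -
    have ht: "h \<le> t0 / 2" using h by (simp add: h0_def)
    have "h \<le> \<rho> / (2 * (Q0 + 1))" using h by (simp add: h0_def)
    then have "h * (2 * (Q0 + 1)) \<le> \<rho>" using Q0_nonneg by (simp add: pos_le_divide_eq)
    then have hQ: "Q0 * h \<le> \<rho> / 2" using h(1) by (simp add: algebra_simps)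
    define m where "m = min (\<rho> / 2) (min 1 (t0 / 4))"
    have m: "m > 0" "m \<le> \<rho> / 2" "m \<le> 1" "m \<le> t0 / 4" using \<rho> assms(3) by (auto simp: m_def)
    define \<rho>' where "\<rho>' n = m / real (Suc n)" for n
    have \<rho>': "\<rho>' n > 0" "\<rho>' n \<le> m" for n using m(1) by (auto simp: \<rho>'_def field_simps)
    have \<rho>'0: "\<rho>' \<longlonglongrightarrow> 0" unfolding \<rho>'_def by (rule lim_const_over_n[THEN LIMSEQ_Suc])
    have "\<exists>\<epsilon> z t. 0 < \<epsilon> \<and> \<epsilon> < \<rho>' n \<and> norm (fst z - x0) < \<rho>' n \<and> norm (snd z) < \<rho>' n \<and> \<bar>t - t0\<bar> < \<rho>' n \<and> 0 \<le> t \<and>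
        Vbar (x0, t0) - \<rho>' n < V \<epsilon> z t" for n
    proof (rule ccontr)
      assume neg: "\<not> ?thesis"
      have "upper_limit x0 0 t0 \<le> ereal (Vbar (x0, t0) - \<rho>' n)"
      proof (rule upper_limit_leI[OF \<rho>'(1)[of n]])
        fix \<epsilon> t' :: real and z :: "(real^'n) \<times> (real^'m)"
        assume "0 < \<epsilon>" "\<epsilon> < \<rho>' n" "norm (fst z - x0) < \<rho>' n" "norm (snd z - 0) < \<rho>' n" "\<bar>t' - t0\<bar> < \<rho>' n" "0 \<le> t'"
        then show "V \<epsilon> z t' \<le> Vbar (x0, t0) - \<rho>' n" using neg by (metis diff_zero not_le)
      qed
      then show False using upper_limit_eq_value_limsup[OF assms(3), of x0 0] \<rho>'(1)[of n] by simp
    qed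
    then obtain \<epsilon> z t where start: "\<And>n. 0 < \<epsilon> n" "\<And>n. \<epsilon> n < \<rho>' n" "\<And>n. norm (fst (z n) - x0) < \<rho>' n"
        "\<And>n. norm (snd (z n)) < \<rho>' n" "\<And>n. \<bar>t n - t0\<bar> < \<rho>' n" "\<And>n. Vbar (x0, t0) - \<rho>' n < V (\<epsilon> n) (z n) (t n)"
      by metis
    have small: "\<epsilon> n < \<rho>" "\<epsilon> n \<le> 1" for n using start(1,2)[of n] \<rho>'(2)[of n] m by auto
    have "\<exists>T C z'. reach (\<epsilon> n) (z n) T C z' \<and> h / \<epsilon> n \<le> T \<and> T \<le> h / \<epsilon> n + Tmax \<and> norm (snd z') < \<rho> \<and>
        C + p \<bullet> (fst z' - fst (z n)) / \<epsilon> n + b * T \<le> 0" for n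
    proof (rule run)
      have "\<epsilon> n * Q0 * (h / \<epsilon> n) = Q0 * h" using start(1)[of n] by simp
      then show "0 < \<epsilon> n \<and> \<epsilon> n < \<rho> \<and> norm (snd (z n)) < \<rho> \<and> 0 \<le> h / \<epsilon> n \<and> norm (fst (z n) - x0) + \<epsilon> n * Q0 * (h / \<epsilon> n) < \<rho>"
        using start(1,3,4)[of n] small[of n] \<rho>'(2)[of n] m hQ h(1) by auto
    qed
    then obtain T C z' where stop: "\<And>n. reach (\<epsilon> n) (z n) (T n) (C n) (z' n)" "\<And>n. h / \<epsilon> n \<le> T n" "\<And>n. T n \<le> h / \<epsilon> n + Tmax"
        "\<And>n. norm (snd (z' n)) < \<rho>" "\<And>n. C n + p \<bullet> (fst (z' n) - fst (z n)) / \<epsilon> n + b * T n \<le> 0"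
      by metis
    have \<epsilon>0: "\<epsilon> \<longlonglongrightarrow> 0"
      by (rule tendsto_sandwich[OF _ _ tendsto_const \<rho>'0]) (use start in \<open>auto intro!: always_eventually less_imp_le\<close>)
    have z0: "(\<lambda>n. fst (z n)) \<longlonglongrightarrow> x0"
      by (rule LIM_zero_cancel, rule Lim_null_comparison[OF _ \<rho>'0])
        (use start(3) in \<open>auto intro!: always_eventually less_imp_le\<close>)
    have t0: "t \<longlonglongrightarrow> t0"
      by (rule LIM_zero_cancel, rule Lim_null_comparison[OF _ \<rho>'0])
        (use start(5) in \<open>auto intro!: always_eventually less_imp_le\<close>)
    have eT: "h \<le> \<epsilon> n * T n" "\<epsilon> n * T n \<le> h + \<epsilon> n * Tmax" for n
      using mult_left_mono[OF stop(2)[of n], of "\<epsilon> n"] mult_left_mono[OF stop(3)[of n], of "\<epsilon> n"] start(1)[of n]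
      by (simp_all add: distrib_left)
    have eTmax: "(\<lambda>n. h + \<epsilon> n * Tmax) \<longlonglongrightarrow> h + 0 * Tmax" by (intro tendsto_intros \<epsilon>0)
    have T0: "(\<lambda>n. \<epsilon> n * T n) \<longlonglongrightarrow> h"
      by (rule tendsto_sandwich[OF _ _ tendsto_const eTmax[simplified]]) (use eT in \<open>auto intro!: always_eventually\<close>)
    have drift: "norm (fst (z' n) - fst (z n)) \<le> Q0 * (h + \<epsilon> n * Tmax)" for n
      using reach_slow_drift[OF stop(1)[of n]] mult_left_mono[OF eT(2)[of n] Q0_nonneg] start(1)[of n]
      by (simp add: mult.commute mult.left_commute)
    have "z' n \<in> cball x0 (\<rho> + Q0 * (h + \<bar>Tmax\<bar>)) \<times> cball 0 \<rho>" for n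
    proof -
      have "\<epsilon> n * Tmax \<le> \<epsilon> n * \<bar>Tmax\<bar>" using start(1)[of n] by (intro mult_left_mono) auto
      also have "\<dots> \<le> 1 * \<bar>Tmax\<bar>" using small[of n] by (intro mult_right_mono) auto
      finally have "\<epsilon> n * Tmax \<le> 1 * \<bar>Tmax\<bar>" .
      then have "Q0 * (h + \<epsilon> n * Tmax) \<le> Q0 * (h + \<bar>Tmax\<bar>)" using Q0_nonneg by (intro mult_left_mono) auto
      then have "norm (fst (z' n) - x0) \<le> \<rho> + Q0 * (h + \<bar>Tmax\<bar>)"
        using norm_triangle_ineq[of "fst (z' n) - fst (z n)" "fst (z n) - x0"] drift[of n] start(3)[of n] \<rho>'(2)[of n] m \<rho> by simp
      then show ?thesis using stop(4)[of n] by (cases "z' n") (auto simp: dist_norm norm_minus_commute)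
    qed
    moreover have "seq_compact (cball x0 (\<rho> + Q0 * (h + \<bar>Tmax\<bar>)) \<times> cball (0::real^'m) \<rho>)"
      by (intro compact_imp_seq_compact compact_Times compact_cball)
    ultimately obtain w k where k: "strict_mono (k :: nat \<Rightarrow> nat)" "(z' \<circ> k) \<longlonglongrightarrow> w"
      unfolding seq_compact_def by metis
    note sub = LIMSEQ_subseq_LIMSEQ[OF _ k(1), unfolded o_def]
    have lim: "(\<lambda>n. z' (k n)) \<longlonglongrightarrow> w" using k(2) by (simp add: o_def)
    have limx: "(\<lambda>n. fst (z' (k n))) \<longlonglongrightarrow> fst w" and limy: "(\<lambda>n. snd (z' (k n))) \<longlonglongrightarrow> snd w"
      by (intro tendsto_intros lim)+
    have wx: "norm (fst w - x0) \<le> Q0 * h"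
    proof (rule LIMSEQ_le)
      show "(\<lambda>n. norm (fst (z' (k n)) - fst (z (k n)))) \<longlonglongrightarrow> norm (fst w - x0)"
        by (intro tendsto_intros limx sub[OF z0])
      show "(\<lambda>n. Q0 * (h + \<epsilon> (k n) * Tmax)) \<longlonglongrightarrow> Q0 * h"
        using tendsto_mult[OF tendsto_const[of Q0] sub[OF eTmax]] by simp
      show "\<exists>N. \<forall>n\<ge>N. norm (fst (z' (k n)) - fst (z (k n))) \<le> Q0 * (h + \<epsilon> (k n) * Tmax)" using drift by blast
    qed
    have th: "0 < t0 - h" using ht h assms(3) by simp
    have "Vbar (x0, t0) + p \<bullet> (fst w - x0) + b * h \<le> Vbar (fst w, t0 - h) + e" if "e > 0" for e
    proof -
      have "upper_limit (fst w) (snd w) (t0 - h) < ereal (Vbar (fst w, t0 - h) + e)"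
        using upper_limit_eq_value_limsup[OF th] that by simp
      from upper_limit_lessD[OF this] obtain \<rho>2 where \<rho>2: "\<rho>2 > 0" "\<And>\<epsilon> z t'. 0 < \<epsilon> \<and> \<epsilon> < \<rho>2 \<and> norm (fst z - fst w) < \<rho>2 \<and>
          norm (snd z - snd w) < \<rho>2 \<and> \<bar>t' - (t0 - h)\<bar> < \<rho>2 \<and> 0 \<le> t' \<Longrightarrow> V \<epsilon> z t' < Vbar (fst w, t0 - h) + e" by blast
      have limt: "(\<lambda>n. t (k n) - \<epsilon> (k n) * T (k n)) \<longlonglongrightarrow> t0 - h" by (intro tendsto_intros sub[OF t0] sub[OF T0])
      have "\<forall>\<^sub>F n in sequentially. \<epsilon> (k n) < \<rho>2" by (rule order_tendstoD(2)[OF sub[OF \<epsilon>0] \<rho>2(1)])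
      moreover have "\<forall>\<^sub>F n in sequentially. norm (fst (z' (k n)) - fst w) < \<rho>2" "\<forall>\<^sub>F n in sequentially. norm (snd (z' (k n)) - snd w) < \<rho>2"
        using tendstoD[OF limx \<rho>2(1)] tendstoD[OF limy \<rho>2(1)] by (auto simp: dist_norm)
      moreover have "\<forall>\<^sub>F n in sequentially. \<bar>t (k n) - \<epsilon> (k n) * T (k n) - (t0 - h)\<bar> < \<rho>2"
        using tendstoD[OF limt \<rho>2(1)] by (simp add: dist_norm)
      moreover have "\<forall>\<^sub>F n in sequentially. 0 < t (k n) - \<epsilon> (k n) * T (k n)" by (rule order_tendstoD(1)[OF limt th])
      ultimately have "\<forall>\<^sub>F n in sequentially. Vbar (x0, t0) - \<rho>' (k n) + p \<bullet> (fst (z' (k n)) - fst (z (k n))) + b * (\<epsilon> (k n) * T (k n))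
          \<le> Vbar (fst w, t0 - h) + e"
      proof eventually_elim
        case (elim n)
        let ?k = "k n"
        have "V (\<epsilon> ?k) (z ?k) (t ?k) \<le> \<epsilon> ?k * C ?k + V (\<epsilon> ?k) (z' ?k) (t ?k - \<epsilon> ?k * T ?k)"
          by (rule value_dynamic_programming[OF stop(1) start(1) small(2)]) (use elim in simp)
        moreover have "V (\<epsilon> ?k) (z' ?k) (t ?k - \<epsilon> ?k * T ?k) < Vbar (fst w, t0 - h) + e"
          by (rule \<rho>2(2)) (use elim start(1) in auto)
        moreover have "\<epsilon> ?k * C ?k + p \<bullet> (fst (z' ?k) - fst (z ?k)) + b * (\<epsilon> ?k * T ?k) \<le> 0"
          using mult_left_mono[OF stop(5)[of ?k], of "\<epsilon> ?k"] start(1)[of ?k] by (simp add: distrib_left mult.left_commute)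
        ultimately show ?case using start(6)[of ?k] by linarith
      qed
      moreover have "(\<lambda>n. Vbar (x0, t0) - \<rho>' (k n) + p \<bullet> (fst (z' (k n)) - fst (z (k n))) + b * (\<epsilon> (k n) * T (k n)))
          \<longlonglongrightarrow> Vbar (x0, t0) - 0 + p \<bullet> (fst w - x0) + b * h"
        by (intro tendsto_intros limx sub[OF z0] sub[OF T0] sub[OF \<rho>'0])
      ultimately show ?thesis using tendsto_upperbound[of _ _ sequentially] by fastforce
    qed
    then have "Vbar (x0, t0) + p \<bullet> (fst w - x0) + b * h \<le> Vbar (fst w, t0 - h)"
      by (rule field_le_epsilon)
    then show ?thesis using wx by (intro exI[of _ "fst w"]) auto
  qed
  show ?thesis using h0 main by blast
qed

text \<open>If \<open>-\<tau>\<close> were below the effective Hamiltonian, some \<open>b = \<delta> - \<tau>\<close> with \<open>\<delta> > 0\<close> would be below it too.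
  Along the resulting cycle the semilimit decreases by \<open>\<delta> h\<close> more than the linearised test function,
  while the remainder of the test function is at most \<open>(\<delta> / 2) h\<close> for small \<open>h\<close>.\<close>

lemma value_limsup_test_function:
  assumes t0: "0 < t0"
    and d\<phi>: "(\<phi> has_derivative (\<lambda>h. (p, \<tau>) \<bullet> h)) (at (x0, t0))"
    and r: "0 < r" and max: "\<And>w. w \<in> ball (x0, t0) r \<inter> UNIV \<times> {0<..} \<Longrightarrow> Vbar w - \<phi> w \<le> Vbar (x0, t0) - \<phi> (x0, t0)"
  shows "\<tau> + effective_hamiltonian f g l A x0 p \<le> 0"
proof -
  have "effective_hamiltonian f g l A x0 p \<le> - \<tau> + \<delta>" if \<delta>: "\<delta> > 0" for \<delta>
  proof (rule ccontr)
    assume "\<not> ?thesis"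
    then obtain c where c: "c < 0" "robust_transit x0 p (- \<tau> + \<delta>) 0 0 c"
      using effective_hamiltonian_le_or_negative_cycle by blast
    from value_limsup_decreases_along_cycle[OF c(2,1) t0] obtain h0 where h0: "h0 > 0" "\<And>h. 0 < h \<and> h \<le> h0 \<Longrightarrow>
      \<exists>x. norm (x - x0) \<le> Q0 * h \<and> Vbar (x0, t0) \<le> Vbar (x, t0 - h) - p \<bullet> (x - x0) - (- \<tau> + \<delta>) * h" by blast
    \<comment> \<open>the end point \<open>(x, t0 - h)\<close> has distance at most \<open>(Q0 + 1) h\<close> from \<open>(x0, t0)\<close>\<close>
    define e where "e = \<delta> / (2 * (Q0 + 1))"
    have e: "e > 0" using \<delta> Q0_nonneg by (simp add: e_def)
    then obtain d where d: "d > 0" "\<And>w. norm (w - (x0, t0)) < d \<Longrightarrow>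
        \<bar>\<phi> w - \<phi> (x0, t0) - (p, \<tau>) \<bullet> (w - (x0, t0))\<bar> \<le> e * norm (w - (x0, t0))"
      using d\<phi> unfolding has_derivative_at_alt by fastforce
    define h where "h = min h0 (min (t0 / 2) (min d r / (2 * (Q0 + 1))))"
    have h: "h \<le> h0" "h \<le> t0 / 2" "h \<le> min d r / (2 * (Q0 + 1))" by (simp_all only: h_def min.cobounded1 min.cobounded2 min.coboundedI2)
    have "0 < min d r / (2 * (Q0 + 1))" using d(1) r Q0_nonneg by simp
    then have "0 < h" using h0(1) t0 by (simp add: h_def)
    note h = this h
    have "h * (2 * (Q0 + 1)) \<le> min d r" using h(4) Q0_nonneg by (simp add: pos_le_divide_eq)
    moreover have "(Q0 + 1) * h < h * (2 * (Q0 + 1))" using h(1) Q0_nonneg by (simp add: algebra_simps add_pos_nonneg)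
    ultimately have hd: "(Q0 + 1) * h < d" "(Q0 + 1) * h < r" by auto
    obtain x where x: "norm (x - x0) \<le> Q0 * h" "Vbar (x0, t0) \<le> Vbar (x, t0 - h) - p \<bullet> (x - x0) - (- \<tau> + \<delta>) * h"
      using h0(2)[of h] h by blast
    have nw: "norm ((x, t0 - h) - (x0, t0)) \<le> (Q0 + 1) * h"
      using norm_Pair_le[of "x - x0" "- h"] x(1) h(1) by (simp add: distrib_right)
    then have "\<phi> (x, t0 - h) - \<phi> (x0, t0) \<le> (p, \<tau>) \<bullet> ((x, t0 - h) - (x0, t0)) + e * norm ((x, t0 - h) - (x0, t0))"
      using d(2)[of "(x, t0 - h)"] hd(1) by linarith
    also have "\<dots> \<le> (p \<bullet> (x - x0) - \<tau> * h) + e * ((Q0 + 1) * h)"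
      using nw e by (intro add_mono mult_left_mono) (auto simp: inner_Pair)
    also have "e * ((Q0 + 1) * h) = \<delta> / 2 * h" using Q0_nonneg by (simp add: e_def field_simps)
    finally have "\<phi> (x, t0 - h) - \<phi> (x0, t0) \<le> p \<bullet> (x - x0) - \<tau> * h + \<delta> / 2 * h" .
    moreover have "Vbar (x, t0 - h) - \<phi> (x, t0 - h) \<le> Vbar (x0, t0) - \<phi> (x0, t0)"
    proof (rule max)
      have "dist (x, t0 - h) (x0, t0) < r" using nw hd(2) unfolding dist_norm by linarith
      then have "dist (x0, t0) (x, t0 - h) < r" by (subst dist_commute)
      then show "(x, t0 - h) \<in> ball (x0, t0) r \<inter> UNIV \<times> {0<..}" using h t0 by simp
    qed
    ultimately have "\<delta> * h \<le> \<delta> / 2 * h" using x(2) by (simp add: algebra_simps)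
    then show False using \<delta> h(1) by simp
  qed
  then have "effective_hamiltonian f g l A x0 p \<le> - \<tau>" by (rule field_le_epsilon)
  then show ?thesis by simp
qed

lemma value_limsup_subsolution:
  "viscosity_subsolution (UNIV \<times> {0<..})
     (\<lambda>(x, t) (p, \<tau>). ereal (\<tau> + effective_hamiltonian f g l A x p)) Vbar"
  unfolding viscosity_subsolution_def
proof (intro conjI allI impI value_limsup_usc)
  fix \<phi> :: "(real^'n) \<times> real \<Rightarrow> real" and D\<phi> z
  assume d\<phi>: "\<forall>w\<in>UNIV \<times> {0<..}. (\<phi> has_derivative (\<lambda>h. D\<phi> w \<bullet> h)) (at w)"
    and z: "z \<in> UNIV \<times> {0<..}"
    and "\<exists>r>0. \<forall>w\<in>ball z r \<inter> UNIV \<times> {0<..}. Vbar w - \<phi> w \<le> Vbar z - \<phi> z"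
  then obtain r where r: "r > 0" "\<forall>w\<in>ball z r \<inter> UNIV \<times> {0<..}. Vbar w - \<phi> w \<le> Vbar z - \<phi> z" by blast
  obtain x0 t0 where zz: "z = (x0, t0)" "0 < t0" using z by auto
  obtain p \<tau> where q: "D\<phi> z = (p, \<tau>)" by (cases "D\<phi> z")
  have "(\<phi> has_derivative (\<lambda>h. (p, \<tau>) \<bullet> h)) (at (x0, t0))"
    using d\<phi>[rule_format, OF z] unfolding q zz(1)[symmetric] .
  from value_limsup_test_function[OF zz(2) this r(1)] r(2) zz(1)
  have "\<tau> + effective_hamiltonian f g l A x0 p \<le> 0" by blast
  then show "(case z of (x, t) \<Rightarrow> \<lambda>(p, \<tau>). ereal (\<tau> + effective_hamiltonian f g l A x p)) (D\<phi> z) \<le> 0"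
    using q by (simp add: zz(1))
qed

end

theorem theorem4p3:
  fixes A :: "'k::euclidean_space set"
    and f :: "real^'n \<Rightarrow> real^'m \<Rightarrow> 'k \<Rightarrow> real^'n"
    and g :: "real^'n \<Rightarrow> real^'m \<Rightarrow> 'k \<Rightarrow> real^'m"
    and l :: "real^'n \<Rightarrow> real^'m \<Rightarrow> 'k \<Rightarrow> real"
    and u0 :: "real^'n \<Rightarrow> real^'m \<Rightarrow> real"
    and L0 Q0 :: real
  assumes A_compact: "compact A"
    and L0_pos: "L0 > 0"
    and f_lipschitz: "\<And>x1 y1 x2 y2 a. a \<in> A \<Longrightarrow>
          norm (f x1 y1 a - f x2 y2 a) \<le> L0 * (norm (x1 - x2) + norm (y1 - y2))"
    and g_lipschitz: "\<And>x1 y1 x2 y2 a. a \<in> A \<Longrightarrow>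
          norm (g x1 y1 a - g x2 y2 a) \<le> L0 * (norm (x1 - x2) + norm (y1 - y2))"
    and f_bounded: "\<And>x y a. a \<in> A \<Longrightarrow> norm (f x y a) \<le> Q0"
    and controllability: "\<And>K :: ((real^'n) \<times> (real^'m)) set. compact K \<Longrightarrow>
          \<exists>r>0. \<forall>(x, y)\<in>K. ball 0 r \<subseteq> closure (convex hull (g x y ` A))"
    and l_continuous: "continuous_on (UNIV \<times> UNIV \<times> A) (\<lambda>(x, y, a). l x y a)"
    and l_coercive: "\<And>B :: (real^'n) set. compact B \<Longrightarrow> B \<noteq> {} \<Longrightarrow>
          filterlim (\<lambda>y. INF (x, a)\<in>B \<times> A. l x y a) at_top at_infinity"
    and u0_continuous: "continuous_on UNIV (\<lambda>(x, y). u0 x y)"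
    and u0_bounded_below: "\<And>x y. - Q0 \<le> u0 x y"
  shows "viscosity_subsolution (UNIV \<times> {0<..})
           (\<lambda>(x, t) (p, \<tau>). ereal (\<tau> + effective_hamiltonian f g l A x p))
           (value_limsup f g l u0 A)
       \<and> (\<forall>x0. Limsup (at (x0, 0) within UNIV \<times> {0<..})
                 (\<lambda>z. ereal (value_limsup f g l u0 A z)) \<le> ereal (limit_datum u0 x0))"
proof -
  interpret two_scale_control A f g l u0 L0 Q0
    by (unfold_locales) (fact assms)+
  show ?thesis using value_limsup_subsolution value_limsup_initial_datum by blast
qed

end
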